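(* Let $H=h^3$ and let $F=F_4=\sum_{k\ge0}R_k(x)H^{k+1}$ be the reduced fourth-order generating function defined in the context. Let $P_4(x,H,F)=F^6+A_5F^5+A_4F^4+A_3F^3+A_2F^2+A_1F+A_0$ be the monic sextic with the coefficients $A_i\in\mathbb Q[x,H]$ listed in the context. Then $P_4(x,H,F_4)=0$, and the Galois group of $P_4$, as a polynomial in $F$ over $\mathbb Q(x,H)$, is the full symmetric group $S_6$. Moreover $$P_4(x,0,F)=\frac{F\,[27F+(1+x)^3]^3\,[27F^2+9x(1+x)F+x^2(x^2+x+1)]}{3^{12}}.$$
   Context: The rational functions $R_k(x)$ are defined by $R_0(x)=\frac23\frac{x}{1+x}$ and, for $k\ge1$, $$x\frac{d^4}{dx^4}R_{k-1}(x)=\frac{(3k+3)(3k+1)(3k)(3k-1)}{9}R_k(x).$$ $F_4$ is viewed in $\mathbb Q(x)[[H]]$. The coefficients are $$A_5=\frac{(1+x)(x^2+5x+1)}9-2H,$$ $$A_4=\frac{x^6+15x^5+60x^4+83x^3+60x^2+15x+1}{243}-\frac{2}{27}(3x^3+15x^2+15x+2)H+\frac43H^2,$$ $$\begin{aligned}A_3={}&\frac{(1+x)^3}{19683}(x^6+33x^5+204x^4+263x^3+204x^2+33x+1)\\&-\frac{2H}{729}(3x^6+36x^5+126x^4+166x^3+114x^2+24x+1)\\&+\frac{3x^3+48x^2+48x-5}{81}H^2-\frac8{27}H^3,\end{aligned}$$ $$\begin{aligned}A_2={}&\frac{x(1+x)^6}{59049}(x^4+13x^3+15x^2+13x+1)\\&-\frac{2x(1+x)^2}{19683}(x^6+25x^5+138x^4+241x^3+226x^2+99x+9)H\\&+\frac{x}{2187}(12x^5+27x^4+243x^3+422x^2+171x-45)H^2+\frac{2x(23x^2-12x-12)}{243}H^3,\end{aligned}$$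 $$\begin{aligned}A_1={}&\frac{x^2(1+x)^9(x^2+x+1)}{531441}-\frac{2x^2(1+x)^5}{177147}(2x^4+19x^3+29x^2+27x+9)H\\&+\frac{x^2(1+x)}{59049}(4x^6+68x^5+85x^4+729x^3+588x^2+513x-135)H^2\\&-\frac{4x^2}{6561}(2x^4-69x^3-51x^2+45x+18)H^3-\frac{4x^3}{27}H^4,\end{aligned}$$ $$\begin{aligned}A_0={}&-\frac{2x^3(1+x)^8(x^2+x+1)}{1594323}H+\frac{x^3(1+x)^4}{531441}(4x^4+24x^3+57x^2+57x+33)H^2\\&-\frac{2x^3}{531441}(4x^6+36x^5-585x^4+324x^3-135x^2+486x-486)H^3\\&-\frac{x^3(36x^2+36x-31)}{2187}H^4+\frac{8x^3}{243}H^5.\end{aligned}$$ *)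

theory Defs
  imports
    "HOL-Computational_Algebra.Computational_Algebra"
    "HOL-Algebra.Algebraic_Closure_Type"
    "HOL-Algebra.Generated_Fields"
    "HOL-Algebra.Bij"
    "HOL-Algebra.Sym_Groups"
begin

section \<open>Galois group of a polynomial over a field\<close>

text \<open>The splitting field is realised inside the algebraic closure \<open>'a alg_closure\<close> of the base
  field, which is embedded by \<open>to_ac\<close>. Automorphisms are taken to be extensional functions, as in
  \<^const>\<open>BijGroup\<close>, so that equal automorphisms are equal functions.\<close>

definition splitting_field :: "'a :: field poly \<Rightarrow> 'a alg_closure set" where
  "splitting_field p =
     generate_field ring_of_type_algebra (range to_ac \<union> {z. poly (map_poly to_ac p) z = 0})"

definition galois_group :: "'a :: field poly \<Rightarrow> ('a alg_closure \<Rightarrow> 'a alg_closure) monoid" where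
  "galois_group p = (let L = splitting_field p in
     BijGroup L \<lparr>carrier :=
       {\<sigma> \<in> Bij L.
          (\<forall>a\<in>L. \<forall>b\<in>L. \<sigma> (a + b) = \<sigma> a + \<sigma> b \<and> \<sigma> (a * b) = \<sigma> a * \<sigma> b) \<and>
          (\<forall>c. \<sigma> (to_ac c) = to_ac c)}\<rparr>)"

lemma splitting_field_to_ac: "to_ac c \<in> splitting_field p"
  unfolding splitting_field_def by (rule generate_field.incl) auto

lemma splitting_field_add:
  assumes "a \<in> splitting_field p" "b \<in> splitting_field p"
  shows "a + b \<in> splitting_field p"
  using generate_field.eng_add[OF assms[unfolded splitting_field_def]]
  by (simp add: splitting_field_def ring_of_type_algebra_def)

lemma splitting_field_mult:
  assumes "a \<in> splitting_field p" "b \<in> splitting_field p"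
  shows "a * b \<in> splitting_field p"
  using generate_field.eng_mult[OF assms[unfolded splitting_field_def]]
  by (simp add: splitting_field_def ring_of_type_algebra_def)

lemma group_galois_group: "group (galois_group p)"
proof -
  define L where "L = splitting_field p"
  define G where "G = {\<sigma> \<in> Bij L.
          (\<forall>a\<in>L. \<forall>b\<in>L. \<sigma> (a + b) = \<sigma> a + \<sigma> b \<and> \<sigma> (a * b) = \<sigma> a * \<sigma> b) \<and>
          (\<forall>c. \<sigma> (to_ac c) = to_ac c)}"
  have cl: "to_ac c \<in> L" "a \<in> L \<Longrightarrow> b \<in> L \<Longrightarrow> a + b \<in> L" "a \<in> L \<Longrightarrow> b \<in> L \<Longrightarrow> a * b \<in> L" for a b c
    by (auto simp: L_def splitting_field_to_ac splitting_field_add splitting_field_mult)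
  have "subgroup G (BijGroup L)"
  proof (rule group.subgroupI[OF group_BijGroup])
    show "G \<subseteq> carrier (BijGroup L)"
      by (auto simp: G_def BijGroup_def)
    have "(\<lambda>x\<in>L. x) \<in> G"
      using cl by (auto simp: G_def id_Bij)
    thus "G \<noteq> {}" by auto
  next
    fix \<sigma> assume s: "\<sigma> \<in> G"
    hence B: "\<sigma> \<in> Bij L" by (simp add: G_def)
    have inv: "inv_into L \<sigma> (f a b) = f (inv_into L \<sigma> a) (inv_into L \<sigma> b)"
      if "a \<in> L" "b \<in> L" "\<And>a b. a \<in> L \<Longrightarrow> b \<in> L \<Longrightarrow> \<sigma> (f a b) = f (\<sigma> a) (\<sigma> b)"
        "\<And>a b. a \<in> L \<Longrightarrow> b \<in> L \<Longrightarrow> f a b \<in> L" for f a b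
      by (rule Bij_inv_into_lemma[where S = L and g = f, OF _ B]) (use that in auto)
    have "inj_on \<sigma> L" using B by (auto simp: Bij_def bij_betw_def)
    hence "inv_into L \<sigma> (to_ac c) = to_ac c" for c
      using s cl(1)[of c] inv_into_f_f[of \<sigma> L "to_ac c"] by (auto simp: G_def)
    moreover have "inv_into L \<sigma> (a + b) = inv_into L \<sigma> a + inv_into L \<sigma> b"
      "inv_into L \<sigma> (a * b) = inv_into L \<sigma> a * inv_into L \<sigma> b" if "a \<in> L" "b \<in> L" for a b
      using s that cl by (auto intro!: inv simp: G_def)
    ultimately show "inv\<^bsub>BijGroup L\<^esub> \<sigma> \<in> G"
      using B cl by (simp add: inv_BijGroup G_def restrict_inv_into_Bij)
  next
    fix \<sigma> \<tau> assume "\<sigma> \<in> G" "\<tau> \<in> G"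
    thus "\<sigma> \<otimes>\<^bsub>BijGroup L\<^esub> \<tau> \<in> G"
      using cl Bij_imp_funcset[of \<tau> L]
      by (auto simp: G_def BijGroup_def compose_Bij compose_eq Pi_iff)
  qed
  from subgroup.subgroup_is_group[OF this group_BijGroup] show ?thesis
    by (simp add: galois_group_def L_def G_def Let_def)
qed


section \<open>The reduced fourth-order generating function\<close>

definition fract_deriv :: "'a :: field_gcd poly fract \<Rightarrow> 'a poly fract" where
  "fract_deriv f = (case quot_of_fract f of (p, q) \<Rightarrow> Fract (pderiv p * q - p * pderiv q) (q\<^sup>2))"

lemma fract_deriv_Fract:
  assumes "q \<noteq> 0"
  shows "fract_deriv (Fract p q) = Fract (pderiv p * q - p * pderiv q) (q\<^sup>2)"
proof -
  obtain r s where rs: "quot_of_fract (Fract p q) = (r, s)" by force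
  have s: "s \<noteq> 0"
    using snd_quot_of_fract_nonzero[of "Fract p q"] rs by simp
  have "Fract r s = Fract p q"
    using quot_to_fract_quot_of_fract[of "Fract p q"] rs by (simp add: quot_to_fract_def)
  hence eq: "p * s = r * q" using assms s by (simp add: eq_fract)
  have d: "p * pderiv s + s * pderiv p = r * pderiv q + q * pderiv r"
    using arg_cong[OF eq, of pderiv] by (simp add: pderiv_mult)
  have "(pderiv p * q - p * pderiv q) * s\<^sup>2 - (pderiv r * s - r * pderiv s) * q\<^sup>2
      = q * s * (p * pderiv s + s * pderiv p - (r * pderiv q + q * pderiv r))
        - (p * s - r * q) * (q * pderiv s + s * pderiv q)"
    by (simp add: algebra_simps power2_eq_square)
  also have "\<dots> = 0" using d eq by simp
  finally show ?thesis
    using assms s by (simp add: fract_deriv_def rs eq_fract)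
qed

primrec R4 :: "nat \<Rightarrow> rat poly fract" where
  "R4 0 = 2 / 3 * (to_fract [:0, 1:] / (1 + to_fract [:0, 1:]))"
| "R4 (Suc k) = 9 * (to_fract [:0, 1:] * (fract_deriv ^^ 4) (R4 k)) /
                  of_nat ((3 * k + 6) * (3 * k + 4) * (3 * k + 3) * (3 * k + 2))"

lemma R4_recurrence:
  assumes "k \<ge> 1"
  shows "to_fract [:0, 1:] * (fract_deriv ^^ 4) (R4 (k - 1)) =
           of_nat ((3 * k + 3) * (3 * k + 1) * (3 * k) * (3 * k - 1)) / 9 * R4 k"
proof -
  obtain j where k: "k = Suc j" using assms by (cases k) auto
  have nz: "(of_nat n :: rat poly fract) \<noteq> 0" if "n \<noteq> 0" for n
    using that by (simp add: of_nat_fract Zero_fract_def eq_fract)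
  define c where "c = (3 * j + 6) * (3 * j + 4) * (3 * j + 3) * (3 * j + 2)"
  have "c \<noteq> 0" by (simp add: c_def)
  hence c0: "(of_nat c :: rat poly fract) \<noteq> 0" by (rule nz)
  have 9: "(9 :: rat poly fract) \<noteq> 0" using nz[of 9] by simp
  have ck: "(3 * k + 3) * (3 * k + 1) * (3 * k) * (3 * k - 1) = c"
    by (simp add: k c_def algebra_simps)
  have R: "R4 k = 9 * (to_fract [:0, 1:] * (fract_deriv ^^ 4) (R4 j)) / of_nat c"
    unfolding k c_def by (rule R4.simps(2))
  show ?thesis
    unfolding ck R using c0 9 by (simp add: k del: funpow.simps)
qed

definition F4 :: "rat poly fract fps" where
  "F4 = Abs_fps (\<lambda>n. case n of 0 \<Rightarrow> 0 | Suc k \<Rightarrow> R4 k)"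


section \<open>The sextic\<close>

text \<open>\<open>\<rat>[x,H]\<close> is the type \<open>rat poly poly\<close>, with inner variable \<open>x\<close> and outer variable \<open>H\<close>.\<close>

abbreviation (input) cst :: "rat \<Rightarrow> rat poly poly" where "cst c \<equiv> [:[:c:]:]"
abbreviation (input) vx :: "rat poly poly" where "vx \<equiv> [:[:0, 1:]:]"
abbreviation (input) vH :: "rat poly poly" where "vH \<equiv> [:0, 1:]"

definition A5 :: "rat poly poly" where
  "A5 = (let x = vx; H = vH in
     cst (1/9) * (1 + x) * (x^2 + 5*x + 1) - 2*H)"

definition A4 :: "rat poly poly" where
  "A4 = (let x = vx; H = vH in
     cst (1/243) * (x^6 + 15*x^5 + 60*x^4 + 83*x^3 + 60*x^2 + 15*x + 1)
     - cst (2/27) * (3*x^3 + 15*x^2 + 15*x + 2) * H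
     + cst (4/3) * H^2)"

definition A3 :: "rat poly poly" where
  "A3 = (let x = vx; H = vH in
     cst (1/19683) * (1 + x)^3 * (x^6 + 33*x^5 + 204*x^4 + 263*x^3 + 204*x^2 + 33*x + 1)
     - cst (2/729) * H * (3*x^6 + 36*x^5 + 126*x^4 + 166*x^3 + 114*x^2 + 24*x + 1)
     + cst (1/81) * (3*x^3 + 48*x^2 + 48*x - 5) * H^2
     - cst (8/27) * H^3)"

definition A2 :: "rat poly poly" where
  "A2 = (let x = vx; H = vH in
     cst (1/59049) * x * (1 + x)^6 * (x^4 + 13*x^3 + 15*x^2 + 13*x + 1)
     - cst (2/19683) * x * (1 + x)^2
         * (x^6 + 25*x^5 + 138*x^4 + 241*x^3 + 226*x^2 + 99*x + 9) * H
     + cst (1/2187) * x * (12*x^5 + 27*x^4 + 243*x^3 + 422*x^2 + 171*x - 45) * H^2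
     + cst (2/243) * x * (23*x^2 - 12*x - 12) * H^3)"

definition A1 :: "rat poly poly" where
  "A1 = (let x = vx; H = vH in
     cst (1/531441) * x^2 * (1 + x)^9 * (x^2 + x + 1)
     - cst (2/177147) * x^2 * (1 + x)^5 * (2*x^4 + 19*x^3 + 29*x^2 + 27*x + 9) * H
     + cst (1/59049) * x^2 * (1 + x)
         * (4*x^6 + 68*x^5 + 85*x^4 + 729*x^3 + 588*x^2 + 513*x - 135) * H^2
     - cst (4/6561) * x^2 * (2*x^4 - 69*x^3 - 51*x^2 + 45*x + 18) * H^3
     - cst (4/27) * x^3 * H^4)"

definition A0 :: "rat poly poly" where
  "A0 = (let x = vx; H = vH in
     - cst (2/1594323) * x^3 * (1 + x)^8 * (x^2 + x + 1) * H
     + cst (1/531441) * x^3 * (1 + x)^4 * (4*x^4 + 24*x^3 + 57*x^2 + 57*x + 33) * H^2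
     - cst (2/531441) * x^3
         * (4*x^6 + 36*x^5 - 585*x^4 + 324*x^3 - 135*x^2 + 486*x - 486) * H^3
     - cst (1/2187) * x^3 * (36*x^2 + 36*x - 31) * H^4
     + cst (8/243) * x^3 * H^5)"

definition P4 :: "rat poly poly poly" where
  "P4 = [:A0, A1, A2, A3, A4, A5, 1:]"

end

theory Submission
  imports Defs
begin

text \<open>
  Put \<open>c = x\<^sup>3\<close>. The surface \<open>P\<^sub>4 = 0\<close> is rational: with a parameter \<open>z\<close> subject to
  \<open>9 H z\<^sup>3 = - (1 - z)\<^sup>3 (z\<^sup>3 + c)\<close> it is
  \<open>27 F = 3 c z\<^sup>-\<^sup>2 - 6 c z\<^sup>-\<^sup>1 + (2 x\<^sup>3 - 3 x\<^sup>2 - 3 x) - 3 z\<^sup>2 + 2 z\<^sup>3\<close>.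
  On the branch \<open>z = - x + O(H)\<close> the derivatives of \<open>F\<close> are simple rational functions of \<open>z\<close>, so that
  the recurrence defining \<open>F\<^sub>4\<close> becomes a differential equation that is checked by algebra.

  The roots of \<open>P\<^sub>4\<close> are the values of \<open>F\<close> at the six roots \<open>z\<close> of the sextic above, so its Galois group
  is that of the sextic. The latter is doubly transitive: the sextic has no root over \<open>\<rat>(x,H)\<close>, and after
  adjoining one root \<open>z\<close> the base field becomes \<open>\<rat>(x,z)\<close>, over which the remaining quintic is
  irreducible. It contains a transposition, because two roots collide at the simple branch point
  \<open>x = - \<tau>\<^sup>4\<close>, \<open>9 H = - (1 - \<tau>\<^sup>3)\<^sup>4\<close>. Hence it is the full symmetric group.
\<close>

subsection \<open>The rational parametrisation\<close>

text \<open>The formula for \<open>F\<close> is dictated by its first derivatives: with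
  \<open>theta = h d/dh\<close>, \<open>y = z/(z-1)\<close> and \<open>Y = 1/y\<close> one has
  \<open>theta F = 2 H y\<close> and \<open>9 dF/dx = (x Y)^2 - (1 + x)^2\<close>. As
  \<open>(3k+1)(3k)(3k-1) = n^3 - n\<close> for \<open>n = 3k\<close>, the recurrence turns into
  \<open>2 (theta^3 - theta) y = x (d/dx)^3 (x Y)^2\<close>.

  At \<open>H = 0\<close> the sextic in \<open>z\<close> degenerates to
  \<open>(1-z)^3 (z^3+x^3)\<close>. The triple root 1 gives \<open>27 F = -(1+x)^3\<close>, the root
  \<open>-x\<close> gives \<open>F = 0\<close>, and the other two cube roots of \<open>-x^3\<close>
  give the quadratic factor of \<open>P4(x,0,F)\<close>.

  On the Galois side the obstacle is that the automorphisms must live on one splitting field over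
  Q(x,H), while the evidence comes from larger fields: Q(x,z) and a field of Laurent series that is
  not even algebraic over Q(x,H). \<open>galois_transfer\<close> pulls this evidence back. That
  distinct \<open>z\<close> give distinct \<open>F\<close> also needs an argument: a coincidence
  would make a root of the irreducible quintic satisfy a quartic.\<close>

lemma P4_parametrization_identity:
  fixes x z n m :: "'a :: idom"
  assumes n: "n = 3*x^3 - 6*x^3*z + (2*x^3 - 3*x^2 - 3*x)*z^2 - 3*z^4 + 2*z^5"
    and m: "m = - ((1 - z)^3 * (z^3 + x^3))"
  shows "n^6 * z^3
   + (3 * (1 + x) * (x^2 + 5 * x + 1) * z^5 - 6 * m * z^2) * n^5
   + (3 * (x^6 + 15 * x^5 + 60 * x^4 + 83 * x^3 + 60 * x^2 + 15 * x + 1) * z^7 - 6 * (3 * x^3 + 15 * x^2 + 15 * x + 2) * m * z^4 + 12 * m^2 * z) * n^4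
   + ((1 + x)^3 * (x^6 + 33 * x^5 + 204 * x^4 + 263 * x^3 + 204 * x^2 + 33 * x + 1) * z^9 - 6 * (3 * x^6 + 36 * x^5 + 126 * x^4 + 166 * x^3 + 114 * x^2 + 24 * x + 1) * m * z^6 + 3 * (3 * x^3 + 48 * x^2 + 48 * x - 5) * m^2 * z^3 - 8 * m^3) * n^3
   + (9 * x * (1 + x)^6 * (x^4 + 13 * x^3 + 15 * x^2 + 13 * x + 1) * z^11 - 6 * x * (1 + x)^2 * (x^6 + 25 * x^5 + 138 * x^4 + 241 * x^3 + 226 * x^2 + 99 * x + 9) * m * z^8 + 3 * x * (12 * x^5 + 27 * x^4 + 243 * x^3 + 422 * x^2 + 171 * x - 45) * m^2 * z^5 + 6 * x * (23 * x^2 - 12 * x - 12) * m^3 * z^2) * n^2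
   + (27 * x^2 * (1 + x)^9 * (x^2 + x + 1) * z^13 - 18 * x^2 * (1 + x)^5 * (2 * x^4 + 19 * x^3 + 29 * x^2 + 27 * x + 9) * m * z^10 + 3 * x^2 * (1 + x) * (4 * x^6 + 68 * x^5 + 85 * x^4 + 729 * x^3 + 588 * x^2 + 513 * x - 135) * m^2 * z^7 - 12 * x^2 * (2 * x^4 - 69 * x^3 - 51 * x^2 + 45 * x + 18) * m^3 * z^4 - 324 * x^3 * m^4 * z) * n
   + (- 54 * x^3 * (1 + x)^8 * (x^2 + x + 1) * m * z^12 + 9 * x^3 * (1 + x)^4 * (4 * x^4 + 24 * x^3 + 57 * x^2 + 57 * x + 33) * m^2 * z^9 - 2 * x^3 * (4 * x^6 + 36 * x^5 - 585 * x^4 + 324 * x^3 - 135 * x^2 + 486 * x - 486) * m^3 * z^6 - 27 * x^3 * (36 * x^2 + 36 * x - 31) * m^4 * z^3 + 216 * x^3 * m^5) = 0"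
proof -
  \<comment> \<open>The identity is \<open>P4\<close> multiplied by \<open>27^6 * z^15\<close>, with
    \<open>n\<close> standing for \<open>27 F z^2\<close> and \<open>m\<close> for
    \<open>9 H z^3\<close>. In nested form the quintic expression for \<open>n\<close> is multiplied
    in one factor at a time.\<close>
  have horner: "n^6 * a6 + a5 * n^5 + a4 * n^4 + a3 * n^3 + a2 * n^2 + a1 * n + a0
      = ((((((a6 * n) + a5) * n + a4) * n + a3) * n + a2) * n + a1) * n + a0" for a0 a1 a2 a3 a4 a5 a6
    by Groebner_Basis.algebra
  show ?thesis unfolding horner unfolding n m by Groebner_Basis.algebra
qed

subsection \<open>Partial field homomorphisms\<close>

text \<open>Subfields are sets inside a fixed type, so that the domain of a homomorphism can grow
  step by step within one algebraic closure.\<close>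

locale subfld =
  fixes S :: "'a :: field set"
  assumes zero_in [simp, intro]: "0 \<in> S"
    and one_in [simp, intro]: "1 \<in> S"
    and add_in [intro]: "a \<in> S \<Longrightarrow> b \<in> S \<Longrightarrow> a + b \<in> S"
    and minus_in [intro]: "a \<in> S \<Longrightarrow> - a \<in> S"
    and mult_in [intro]: "a \<in> S \<Longrightarrow> b \<in> S \<Longrightarrow> a * b \<in> S"
    and inverse_in [intro]: "a \<in> S \<Longrightarrow> inverse a \<in> S"
begin

lemma sum_in: "(\<And>x. x \<in> A \<Longrightarrow> f x \<in> S) \<Longrightarrow> sum f A \<in> S"
  by (induction A rule: infinite_finite_induct) auto

definition pol :: "'a poly \<Rightarrow> bool" where
  "pol p \<longleftrightarrow> (\<forall>i. coeff p i \<in> S)"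

lemma pol_0 [simp]: "pol 0" and pol_1 [simp]: "pol 1"
  by (auto simp: pol_def coeff_1)

lemma pol_pCons [simp]: "pol (pCons a p) \<longleftrightarrow> a \<in> S \<and> pol p"
proof
  assume "pol (pCons a p)"
  hence *: "coeff (pCons a p) i \<in> S" for i by (simp add: pol_def)
  from *[of 0] *[of "Suc i" for i] show "a \<in> S \<and> pol p" by (simp add: pol_def)
next
  assume "a \<in> S \<and> pol p"
  thus "pol (pCons a p)" by (auto simp: pol_def coeff_pCons split: nat.splits)
qed

lemma pol_add: "pol p \<Longrightarrow> pol q \<Longrightarrow> pol (p + q)"
  and pol_minus: "pol p \<Longrightarrow> pol (- p)"
  by (auto simp: pol_def)

lemma pol_diff: "pol p \<Longrightarrow> pol q \<Longrightarrow> pol (p - q)"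
  using pol_add[of p "- q"] pol_minus[of q] by simp

lemma pol_mult: "pol p \<Longrightarrow> pol q \<Longrightarrow> pol (p * q)"
  by (auto simp: pol_def coeff_mult intro!: sum_in)

lemma pol_smult: "c \<in> S \<Longrightarrow> pol p \<Longrightarrow> pol (smult c p)"
  by (auto simp: pol_def)

lemma pol_monom: "c \<in> S \<Longrightarrow> pol (monom c n)"
  by (auto simp: pol_def)

lemma poly_in: "pol p \<Longrightarrow> x \<in> S \<Longrightarrow> poly p x \<in> S"
  by (induction p) auto

lemma pol_division:
  assumes "pol m" "m \<noteq> 0" "pol p"
  shows "\<exists>r s. pol r \<and> pol s \<and> p = m * r + s \<and> (s = 0 \<or> degree s < degree m)"
  using assms(3)
proof (induction "degree p" arbitrary: p rule: less_induct)
  case less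
  show ?case
  proof (cases "degree p < degree m \<or> p = 0")
    case True
    thus ?thesis using less.prems by (intro exI[of _ 0] exI[of _ p]) auto
  next
    case False
    define n where "n = degree p"
    define u where "u = monom (lead_coeff p * inverse (lead_coeff m)) (n - degree m)"
    have u: "pol u"
      using assms(1) less.prems unfolding u_def by (intro pol_monom) (auto simp: pol_def)
    have le: "degree m \<le> n" using False by (auto simp: n_def)
    define p' where "p' = p - m * u"
    have p': "pol p'" using u assms less.prems by (auto simp: p'_def intro: pol_diff pol_mult)
    have "degree u \<le> n - degree m" by (simp add: u_def degree_monom_le)
    hence "degree (m * u) \<le> n" using degree_mult_le[of m u] le by linarith
    hence d1: "degree p' \<le> n" by (auto simp: p'_def n_def intro: degree_diff_le)
    have "coeff (m * u) (degree m + (n - degree m)) = lead_coeff p"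
      using assms(2) by (simp add: u_def mult.commute[of m] coeff_monom_mult)
    hence d2: "coeff p' n = 0" using le by (simp add: p'_def n_def)
    have c: "p' = 0 \<or> degree p' < n"
      using eq_zero_or_degree_less[OF d1 d2] .
    have "\<exists>r s. pol r \<and> pol s \<and> p' = m * r + s \<and> (s = 0 \<or> degree s < degree m)"
    proof (cases "p' = 0")
      case True
      thus ?thesis by (intro exI[of _ 0]) auto
    next
      case False
      thus ?thesis using c p' less.hyps[of p'] by (auto simp: n_def)
    qed
    then obtain r s where "pol r" "pol s" "p' = m * r + s" "s = 0 \<or> degree s < degree m" by blast
    thus ?thesis using u
      by (intro exI[of _ "r + u"] exI[of _ s]) (auto simp: p'_def algebra_simps intro: pol_add)
  qed
qed

definition minimal :: "'a \<Rightarrow> 'a poly \<Rightarrow> bool" where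
  "minimal a m \<longleftrightarrow> pol m \<and> m \<noteq> 0 \<and> poly m a = 0 \<and>
     (\<forall>q. pol q \<and> q \<noteq> 0 \<and> poly q a = 0 \<longrightarrow> degree m \<le> degree q)"

lemma minimal_exists:
  assumes "pol p" "p \<noteq> 0" "poly p a = 0"
  shows "\<exists>m. minimal a m"
proof -
  let ?P = "\<lambda>q. pol q \<and> q \<noteq> 0 \<and> poly q a = 0"
  have "?P p" using assms by auto
  from ex_has_least_nat[of ?P, OF this, of degree] show ?thesis
    unfolding minimal_def by blast
qed

lemma minimal_dvd:
  assumes "minimal a m" "pol q" "poly q a = 0"
  shows "\<exists>r. pol r \<and> q = m * r"
proof -
  have m: "pol m" "m \<noteq> 0" "poly m a = 0"
    and le: "\<And>q. pol q \<Longrightarrow> q \<noteq> 0 \<Longrightarrow> poly q a = 0 \<Longrightarrow> degree m \<le> degree q"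
    using assms(1) unfolding minimal_def by auto
  from pol_division[OF m(1,2) assms(2)] obtain r s where
    rs: "pol r" "pol s" "q = m * r + s" "s = 0 \<or> degree s < degree m" by blast
  have "poly s a = 0" using rs(3) assms(3) m(3) by simp
  hence "s = 0" using le[OF rs(2)] rs(4) by fastforce
  thus ?thesis using rs by auto
qed

lemma degree_minimal_pos:
  assumes "minimal a m"
  shows "degree m > 0"
proof (rule ccontr)
  assume "\<not> ?thesis"
  then obtain c where "m = [:c:]" by (auto elim: degree_eq_zeroE)
  thus False using assms by (auto simp: minimal_def)
qed

text \<open>Euclidean descent on the degree of \<open>q\<close>: division of \<open>m\<close> by
  \<open>q\<close> gives \<open>q(a) r(a) = - s(a)\<close> with \<open>s\<close> of smaller degree.
  Here \<open>s(a)\<close> is nonzero, as otherwise \<open>r\<close> would be a nonzero annihilator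
  of \<open>a\<close> of degree below that of \<open>m\<close>.\<close>

lemma minimal_inverse:
  assumes m: "minimal a m" and "pol q" "poly q a \<noteq> 0"
  shows "\<exists>r. pol r \<and> poly r a * poly q a = 1"
proof -
  have m': "pol m" "m \<noteq> 0" "poly m a = 0"
    and le: "\<And>q. pol q \<Longrightarrow> q \<noteq> 0 \<Longrightarrow> poly q a = 0 \<Longrightarrow> degree m \<le> degree q"
    using assms(1) unfolding minimal_def by auto
  have *: "\<exists>r. pol r \<and> poly r a * poly q a = 1"
    if "pol q" "poly q a \<noteq> 0" "degree q < degree m" for q
    using that
  proof (induction "degree q" arbitrary: q rule: less_induct)
    case less
    show ?case
    proof (cases "degree q = 0")
      case True
      then obtain c where c: "q = [:c:]" by (auto elim: degree_eq_zeroE)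
      show ?thesis using less.prems by (intro exI[of _ "[:inverse c:]"]) (auto simp: c)
    next
      case False
      have q0: "q \<noteq> 0" using less.prems by auto
      from pol_division[OF less.prems(1) q0 m'(1)] obtain r s where
        rs: "pol r" "pol s" "m = q * r + s" "s = 0 \<or> degree s < degree q" by blast
      have qr: "poly q a * poly r a = - poly s a"
        using arg_cong[OF rs(3), of "\<lambda>p. poly p a"] m'(3) by (simp add: add_eq_0_iff)
      have "poly s a \<noteq> 0"
      proof
        assume "poly s a = 0"
        hence ra: "poly r a = 0" using qr less.prems(2) by simp
        have "s \<noteq> m" using rs(4) less.prems(3) m'(2) by auto
        hence r0: "r \<noteq> 0" using rs(3) by auto
        have "degree (q * r) = degree q + degree r" using q0 r0 by (simp add: degree_mult_eq)
        moreover have "degree (q * r) \<le> degree m"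
        proof -
          have "q * r = m - s" using rs(3) by simp
          moreover have "degree s \<le> degree m" using rs(4) less.prems(3) by auto
          ultimately show ?thesis by (simp add: degree_diff_le)
        qed
        ultimately show False using le[OF rs(1) r0 ra] False by linarith
      qed
      hence "degree s < degree q" using rs(4) by auto
      from less.hyps[OF this rs(2) \<open>poly s a \<noteq> 0\<close>] less.prems(3) this
      obtain t where t: "pol t" "poly t a * poly s a = 1" by force
      show ?thesis
      proof (intro exI[of _ "- (r * t)"] conjI)
        show "pol (- (r * t))" using t(1) rs(1) by (intro pol_minus pol_mult)
        have "poly (- (r * t)) a * poly q a = - (poly q a * poly r a) * poly t a" by simp
        also have "\<dots> = 1" unfolding qr using t(2) by (simp add: mult.commute)
        finally show "poly (- (r * t)) a * poly q a = 1" .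
      qed
    qed
  qed
  from pol_division[OF m'(1,2) assms(2)] obtain r s where
    rs: "pol r" "pol s" "q = m * r + s" "s = 0 \<or> degree s < degree m" by blast
  have "poly s a = poly q a" using rs(3) m'(3) by simp
  moreover from this have "degree s < degree m" using rs(4) assms(3) by auto
  ultimately show ?thesis using *[OF rs(2)] assms(3) by simp
qed

end

lemma subfld_UNIV: "subfld UNIV"
  by unfold_locales auto

locale partial_hom = subfld S for S :: "'a :: field set" +
  fixes f :: "'a \<Rightarrow> 'b :: field"
  assumes f_1 [simp]: "f 1 = 1"
    and f_add: "a \<in> S \<Longrightarrow> b \<in> S \<Longrightarrow> f (a + b) = f a + f b"
    and f_mult: "a \<in> S \<Longrightarrow> b \<in> S \<Longrightarrow> f (a * b) = f a * f b"
begin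

lemma f_0 [simp]: "f 0 = 0"
  using f_add[of 0 0] by (metis add_0 add_cancel_right_right zero_in)

lemma f_minus: "a \<in> S \<Longrightarrow> f (- a) = - f a"
  using f_add[of a "- a"] by (simp add: minus_in eq_neg_iff_add_eq_0 add.commute)

lemma f_diff: "a \<in> S \<Longrightarrow> b \<in> S \<Longrightarrow> f (a - b) = f a - f b"
  using f_add[of a "- b"] by (simp add: minus_in f_minus)

lemma f_eq_0_iff [simp]: "a \<in> S \<Longrightarrow> f a = 0 \<longleftrightarrow> a = 0"
  using f_mult[of a "inverse a"] by (cases "a = 0") (auto simp: inverse_in)

lemma f_inverse: "a \<in> S \<Longrightarrow> f (inverse a) = inverse (f a)"
  using f_mult[of a "inverse a"]
  by (cases "a = 0") (auto simp: inverse_in intro!: inverse_unique[symmetric])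

lemma f_eq_iff: "a \<in> S \<Longrightarrow> b \<in> S \<Longrightarrow> f a = f b \<longleftrightarrow> a = b"
  using f_diff[of a b] f_eq_0_iff[of "a - b"] add_in[of a "- b"] minus_in[of b] by auto

lemma f_inj: "inj_on f S"
  by (auto simp: inj_on_def f_eq_iff)

lemma f_sum: "(\<And>x. x \<in> A \<Longrightarrow> g x \<in> S) \<Longrightarrow> f (sum g A) = (\<Sum>x\<in>A. f (g x))"
  by (induction A rule: infinite_finite_induct) (auto simp: f_add sum_in)

lemma map_poly_add: "pol p \<Longrightarrow> pol q \<Longrightarrow> map_poly f (p + q) = map_poly f p + map_poly f q"
  by (intro poly_eqI) (auto simp: coeff_map_poly pol_def f_add)

lemma map_poly_minus: "pol p \<Longrightarrow> map_poly f (- p) = - map_poly f p"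
  by (intro poly_eqI) (auto simp: coeff_map_poly pol_def f_minus)

lemma map_poly_diff: "pol p \<Longrightarrow> pol q \<Longrightarrow> map_poly f (p - q) = map_poly f p - map_poly f q"
  by (intro poly_eqI) (auto simp: coeff_map_poly pol_def f_diff)

lemma map_poly_mult: "pol p \<Longrightarrow> pol q \<Longrightarrow> map_poly f (p * q) = map_poly f p * map_poly f q"
  by (intro poly_eqI) (auto simp: coeff_map_poly pol_def coeff_mult f_mult f_sum mult_in)

lemma map_poly_pCons: "map_poly f (pCons a p) = pCons (f a) (map_poly f p)"
  by (rule Polynomial.map_poly_pCons) simp

lemma map_poly_1 [simp]: "map_poly f 1 = 1"
  by (simp add: map_poly_pCons one_pCons)

lemma degree_map_poly: "pol p \<Longrightarrow> degree (map_poly f p) = degree p"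
  by (cases "p = 0") (auto simp: pol_def intro!: map_poly_degree_eq)

lemma map_poly_eq_0_iff: "pol p \<Longrightarrow> map_poly f p = 0 \<longleftrightarrow> p = 0"
  by (auto simp: poly_eq_iff coeff_map_poly pol_def)

lemma f_poly: "pol p \<Longrightarrow> x \<in> S \<Longrightarrow> f (poly p x) = poly (map_poly f p) (f x)"
  by (induction p) (auto simp: map_poly_pCons f_add f_mult poly_in mult_in)

text \<open>Well-definedness of the map that sends \<open>q(a)\<close> to the value at
  \<open>b\<close> of the transported polynomial.\<close>

lemma poly_map_poly_eqI:
  assumes "minimal a m" "poly (map_poly f m) b = 0" "pol p" "pol q" "poly p a = poly q a"
  shows "poly (map_poly f p) b = poly (map_poly f q) b"
proof -
  from minimal_dvd[OF assms(1) pol_diff[OF assms(3,4)]] assms(5)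
  obtain r where r: "pol r" "p - q = m * r" by auto
  have "pol m" using assms(1) by (simp add: minimal_def)
  from map_poly_mult[OF this r(1)] have "poly (map_poly f (p - q)) b = 0"
    by (simp add: r(2) assms(2))
  thus ?thesis by (simp add: map_poly_diff assms(3,4))
qed

text \<open>Since \<open>a\<close> is algebraic over \<open>S\<close>, the values of polynomials at
  \<open>a\<close> already form a field. The representing polynomial is chosen arbitrarily; two
  choices differ by a multiple of \<open>m\<close>, which is killed at \<open>b\<close>.\<close>

lemma simple_extension:
  assumes m: "minimal a m" and b: "poly (map_poly f m) b = 0"
  shows "\<exists>S' g. partial_hom S' g \<and> S \<subseteq> S' \<and> a \<in> S' \<and> (\<forall>x\<in>S. g x = f x) \<and> g a = b"
proof -
  define S' where "S' = (\<lambda>q. poly q a) ` Collect pol"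
  define g where "g x = poly (map_poly f (SOME q. pol q \<and> poly q a = x)) b" for x
  have g: "g (poly q a) = poly (map_poly f q) b" if "pol q" for q
  proof -
    have "\<exists>q'. pol q' \<and> poly q' a = poly q a" using that by auto
    from someI_ex[OF this] show ?thesis
      unfolding g_def by (intro poly_map_poly_eqI[OF m b]) (use that in auto)
  qed
  have S'I: "poly q a \<in> S'" if "pol q" for q using that by (auto simp: S'_def)
  have "S \<subseteq> S'"
  proof
    fix x assume "x \<in> S"
    thus "x \<in> S'" using S'I[of "[:x:]"] by simp
  qed
  moreover have "a \<in> S'" using S'I[of "[:0, 1:]"] by simp
  moreover have "g x = f x" if "x \<in> S" for x using g[of "[:x:]"] that by (simp add: map_poly_pCons)
  moreover have "g a = b" using g[of "[:0, 1:]"] by (simp add: map_poly_pCons)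
  moreover have "partial_hom S' g"
  proof unfold_locales
    show "0 \<in> S'" "1 \<in> S'" using \<open>S \<subseteq> S'\<close> by auto
    show "x + y \<in> S'" "g (x + y) = g x + g y" "x * y \<in> S'" "g (x * y) = g x * g y"
      if xy: "x \<in> S'" "y \<in> S'" for x y
    proof -
      from xy obtain p q where pq: "pol p" "pol q" "x = poly p a" "y = poly q a"
        by (auto simp: S'_def)
      show "x + y \<in> S'" "x * y \<in> S'"
        using S'I[OF pol_add[OF pq(1,2)]] S'I[OF pol_mult[OF pq(1,2)]] by (simp_all add: pq(3,4))
      show "g (x + y) = g x + g y" "g (x * y) = g x * g y"
        using g[OF pol_add[OF pq(1,2)]] g[OF pol_mult[OF pq(1,2)]] g[OF pq(1)] g[OF pq(2)] pq(1,2)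
        by (simp_all add: pq(3,4) map_poly_add map_poly_mult)
    qed
    show "- x \<in> S'" "inverse x \<in> S'" if x: "x \<in> S'" for x
    proof -
      from x obtain p where p: "pol p" "x = poly p a" by (auto simp: S'_def)
      show "- x \<in> S'" using S'I[OF pol_minus[OF p(1)]] by (simp add: p(2))
      show "inverse x \<in> S'"
      proof (cases "x = 0")
        case False
        then obtain r where r: "pol r" "poly r a * x = 1"
          using minimal_inverse[OF m p(1)] p(2) by auto
        hence "inverse x = poly r a" using inverse_unique[of x "poly r a"] by (simp add: mult.commute)
        thus ?thesis using S'I[OF r(1)] by simp
      qed (use \<open>S \<subseteq> S'\<close> in auto)
    qed
    show "g 1 = 1" using g[of 1] by simp
  qed
  ultimately show ?thesis by blast
qed

end

text \<open>Induction over the finitely many elements to be adjoined. At each step the minimal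
  polynomial over the current domain has a root in the algebraically closed target, and that root
  serves as the image of the new element.\<close>

lemma partial_hom_extends:
  fixes f :: "'a :: field \<Rightarrow> 'b :: alg_closed_field"
  assumes "partial_hom S f" "finite A" "\<And>a. a \<in> A \<Longrightarrow> \<exists>p. subfld.pol S p \<and> p \<noteq> 0 \<and> poly p a = 0"
  shows "\<exists>S' g. partial_hom S' g \<and> S \<subseteq> S' \<and> A \<subseteq> S' \<and> (\<forall>x\<in>S. g x = f x)"
  using assms(2,3)
proof (induction A rule: finite_induct)
  case empty
  thus ?case using assms(1) by blast
next
  case (insert a A)
  then obtain S' g where g: "partial_hom S' g" "S \<subseteq> S'" "A \<subseteq> S'" "\<forall>x\<in>S. g x = f x" by blast
  interpret S: partial_hom S f by fact
  interpret g: partial_hom S' g by fact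
  from insert.prems[of a] obtain p where p: "S.pol p" "p \<noteq> 0" "poly p a = 0" by auto
  have "g.pol p" using p(1) g(2) by (auto simp: S.pol_def g.pol_def)
  then obtain m where m: "g.minimal a m" using g.minimal_exists[OF _ p(2,3)] by blast
  hence "degree (map_poly g m) > 0"
    using g.degree_minimal_pos[OF m] by (simp add: g.degree_map_poly g.minimal_def)
  then obtain b where b: "poly (map_poly g m) b = 0" using alg_closed_imp_poly_has_root by blast
  from g.simple_extension[OF m b] obtain S'' h where
    "partial_hom S'' h" "S' \<subseteq> S''" "a \<in> S''" "\<forall>x\<in>S'. h x = g x" by blast
  thus ?case using g by (intro exI[of _ S''] exI[of _ h]) auto
qed

subsection \<open>Automorphisms of splitting fields\<close>

lemma (in partial_hom) partial_hom_subset: "subfld T \<Longrightarrow> T \<subseteq> S \<Longrightarrow> partial_hom T f"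
  by (auto simp: partial_hom_def partial_hom_axioms_def f_add f_mult subset_iff)

lemma (in partial_hom) subfld_image: "subfld (f ` S)"
proof
  show "0 \<in> f ` S" "1 \<in> f ` S" using f_0 f_1 zero_in one_in by (metis imageI)+
  show "a + b \<in> f ` S" "a * b \<in> f ` S" if "a \<in> f ` S" "b \<in> f ` S" for a b
    using that by (auto simp flip: f_add f_mult)
  show "- a \<in> f ` S" "inverse a \<in> f ` S" if "a \<in> f ` S" for a
    using that by (auto simp flip: f_minus f_inverse)
qed

lemma (in partial_hom) subfld_vimage: "subfld T \<Longrightarrow> subfld {x \<in> S. f x \<in> T}"
  by (auto simp: subfld_def f_add f_mult f_minus f_inverse add_in mult_in minus_in inverse_in)

lemma partial_hom_comp:
  assumes "partial_hom S f" "partial_hom T g" "f ` S \<subseteq> T"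
  shows "partial_hom S (\<lambda>x. g (f x))"
proof -
  interpret f: partial_hom S f by fact
  interpret g: partial_hom T g by fact
  show ?thesis using assms(3) by unfold_locales (auto simp: f.f_add f.f_mult g.f_add g.f_mult subset_iff)
qed

lemma partial_hom_id: "subfld S \<Longrightarrow> partial_hom S (\<lambda>x. x)"
  by (auto simp: partial_hom_def partial_hom_axioms_def)

lemma partial_hom_to_ac: "partial_hom UNIV to_ac"
  by unfold_locales auto

lemma pol_UNIV [simp]: "subfld.pol UNIV p"
  by (simp add: subfld.pol_def[OF subfld_UNIV])

lemma subfld_range_to_ac: "subfld (range to_ac)"
  using partial_hom.subfld_image[OF partial_hom_to_ac] .

lemma pol_range_to_ac_iff: "subfld.pol (range to_ac) q \<longleftrightarrow> (\<exists>r. q = map_poly to_ac r)"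
proof
  assume q: "subfld.pol (range to_ac) q"
  have "q = map_poly to_ac (map_poly of_ac q)"
    using q by (intro poly_eqI)
      (auto simp: subfld.pol_def[OF subfld_range_to_ac] coeff_map_poly to_ac_of_ac)
  thus "\<exists>r. q = map_poly to_ac r" ..
qed (auto simp: subfld.pol_def[OF subfld_range_to_ac] coeff_map_poly)

lemma partial_hom_of_ac:
  assumes "partial_hom UNIV e"
  shows "partial_hom (range to_ac) (\<lambda>x. e (of_ac x))"
proof -
  interpret e: partial_hom UNIV e by fact
  interpret S: subfld "range to_ac" by (rule subfld_range_to_ac)
  show ?thesis
    by unfold_locales (auto simp flip: to_ac_add to_ac_mult simp: e.f_add e.f_mult)
qed

abbreviation rts :: "('a :: field \<Rightarrow> 'b :: field) \<Rightarrow> 'a poly \<Rightarrow> 'b set" where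
  "rts h p \<equiv> {z. poly (map_poly h p) z = 0}"

text \<open>\<open>P\<close> splits into linear factors whose roots lie in \<open>S\<close>;
  applying \<open>f\<close> to this factorisation shows that the transported polynomial has exactly
  the images of these roots.\<close>

lemma bij_betw_roots:
  fixes P :: "'a :: alg_closed_field poly"
  assumes "partial_hom S f" "subfld.pol S P" "P \<noteq> 0" and sub: "{z. poly P z = 0} \<subseteq> S"
  shows "bij_betw f {z. poly P z = 0} {z. poly (map_poly f P) z = 0}"
proof -
  interpret partial_hom S f by fact
  obtain A where A: "P = smult (lead_coeff P) (\<Prod>x\<in>#A. [:-x, 1:])"
    using alg_closed_imp_factorization[OF assms(3)] by blast
  have lc: "lead_coeff P \<in> S" "lead_coeff P \<noteq> 0" using assms by (auto simp: pol_def)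
  have roots: "{z. poly (\<Prod>x\<in>#B. [:-h x, 1:]) z = 0} = h ` set_mset B"
    for B :: "'c multiset" and h :: "'c \<Rightarrow> 'd :: field"
    by (auto simp: poly_prod_mset prod_mset_zero_iff)
  have rP: "{z. poly P z = 0} = set_mset A"
    by (subst A) (use lc roots[of "\<lambda>x. x" A] in simp)
  have *: "pol (\<Prod>x\<in>#B. [:-x, 1:]) \<and>
    map_poly f (\<Prod>x\<in>#B. [:-x, 1:]) = (\<Prod>x\<in>#B. [:-f x, 1:])" if "set_mset B \<subseteq> S" for B
    using that
    by (induction B) (auto intro!: pol_mult pol_add simp: map_poly_mult map_poly_pCons f_minus minus_in
          simp del: mult_pCons_left)
  have "map_poly f P = map_poly f ([:lead_coeff P:] * (\<Prod>x\<in>#A. [:-x, 1:]))"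
    by (subst A) simp
  also have "\<dots> = [:f (lead_coeff P):] * (\<Prod>x\<in>#A. [:-f x, 1:])"
    using * sub rP lc by (subst map_poly_mult) (auto simp: map_poly_pCons)
  finally have "{z. poly (map_poly f P) z = 0} = f ` set_mset A"
    using lc roots[of f A] by simp
  thus ?thesis unfolding rP
    using f_inj sub rP by (auto simp: bij_betw_def intro: inj_on_subset)
qed

lemma finite_rts: "p \<noteq> 0 \<Longrightarrow> partial_hom UNIV h \<Longrightarrow> finite (rts h p)"
  by (rule poly_roots_finite) (simp add: partial_hom.map_poly_eq_0_iff)

lemma subfld_splitting_field: "subfld (splitting_field p)"
proof -
  let ?R = "ring_of_type_algebra :: 'a alg_closure ring"
  interpret R: field ?R by (rule field_from_type_algebra)
  have c: "carrier ?R = UNIV" "\<zero>\<^bsub>?R\<^esub> = 0" "\<one>\<^bsub>?R\<^esub> = 1" "x \<otimes>\<^bsub>?R\<^esub> y = x * y" "x \<oplus>\<^bsub>?R\<^esub> y = x + y" for x y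
    by (simp_all add: ring_of_type_algebra_def)
  have m: "inv\<^bsub>?R\<^esub> x = inverse x" if "x \<noteq> 0" for x
    by (rule R.comm_inv_char) (use that in \<open>auto simp: c\<close>)
  have n: "\<ominus>\<^bsub>?R\<^esub> x = - x" for x
    by (rule R.minus_equality) (auto simp: c)
  show ?thesis
  proof
    show 0: "0 \<in> splitting_field p" and "1 \<in> splitting_field p"
      using splitting_field_to_ac[of 0 p] splitting_field_to_ac[of 1 p] by auto
    show "- a \<in> splitting_field p" if "a \<in> splitting_field p" for a
      using generate_field.a_inv[OF that[unfolded splitting_field_def]]
      by (simp add: n splitting_field_def)
    show "inverse a \<in> splitting_field p" if "a \<in> splitting_field p" for a
      using generate_field.m_inv[OF that[unfolded splitting_field_def]] 0
      by (cases "a = 0") (simp_all add: m c splitting_field_def)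
  qed (auto intro: splitting_field_add splitting_field_mult)
qed

lemma roots_in_splitting_field: "rts to_ac p \<subseteq> splitting_field p"
  unfolding splitting_field_def by (auto intro: generate_field.incl)

text \<open>Serves as the induction principle for the splitting field: later inclusions and
  equalities follow by taking for \<open>T\<close> a preimage, an image, or the set where two
  homomorphisms agree.\<close>

lemma splitting_field_subset:
  assumes "subfld T" "range to_ac \<subseteq> T" "rts to_ac p \<subseteq> T"
  shows "splitting_field p \<subseteq> T"
proof
  interpret T: subfld T by fact
  let ?R = "ring_of_type_algebra :: 'a alg_closure ring"
  interpret R: field ?R by (rule field_from_type_algebra)
  have c: "carrier ?R = UNIV" "\<zero>\<^bsub>?R\<^esub> = 0" "\<one>\<^bsub>?R\<^esub> = 1" "x \<otimes>\<^bsub>?R\<^esub> y = x * y" "x \<oplus>\<^bsub>?R\<^esub> y = x + y" for x y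
    by (simp_all add: ring_of_type_algebra_def)
  have m: "inv\<^bsub>?R\<^esub> x = inverse x" if "x \<noteq> 0" for x
    by (rule R.comm_inv_char) (use that in \<open>auto simp: c\<close>)
  have n: "\<ominus>\<^bsub>?R\<^esub> x = - x" for x
    by (rule R.minus_equality) (auto simp: c)
  fix x assume "x \<in> splitting_field p"
  hence "x \<in> generate_field ?R (range to_ac \<union> rts to_ac p)" by (simp add: splitting_field_def)
  thus "x \<in> T"
    by induction (use assms in \<open>auto simp: c m n\<close>)
qed

lemma splitting_field_image_subset:
  assumes "partial_hom (splitting_field p) f" "subfld T" "\<And>c. f (to_ac c) \<in> T" "f ` rts to_ac p \<subseteq> T"
  shows "f ` splitting_field p \<subseteq> T"
proof -
  interpret f: partial_hom "splitting_field p" f by fact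
  have "splitting_field p \<subseteq> {x \<in> splitting_field p. f x \<in> T}"
    using f.subfld_vimage[OF assms(2)] assms(3,4) roots_in_splitting_field[of p]
    by (intro splitting_field_subset) (auto simp: splitting_field_to_ac)
  thus ?thesis by auto
qed

text \<open>Unlike the elements of \<open>galois_group\<close>, these maps are unconstrained outside
  the splitting field, so that compositions and maps defined on larger fields qualify as they are.
  Restriction to an extensional function happens only in
  \<open>galois_group_iso_sym_group\<close>.\<close>

definition aut :: "'k :: field poly \<Rightarrow> ('k alg_closure \<Rightarrow> 'k alg_closure) \<Rightarrow> bool" where
  "aut p \<sigma> \<longleftrightarrow> partial_hom (splitting_field p) \<sigma> \<and> \<sigma> ` splitting_field p = splitting_field p \<and>
     (\<forall>c. \<sigma> (to_ac c) = to_ac c)"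

lemma partial_hom_roots:
  assumes "partial_hom N \<tau>" "\<And>c. to_ac c \<in> N" "\<And>c. \<tau> (to_ac c) = to_ac c" "rts to_ac p \<subseteq> N" "p \<noteq> 0"
  shows "bij_betw \<tau> (rts to_ac p) (rts to_ac p)"
proof -
  interpret partial_hom N \<tau> by fact
  have "pol (map_poly to_ac p)" using assms(2) by (auto simp: pol_def coeff_map_poly)
  moreover have "map_poly \<tau> (map_poly to_ac p) = map_poly to_ac p"
    by (intro poly_eqI) (simp add: coeff_map_poly assms(3))
  moreover have "map_poly to_ac p \<noteq> 0"
    using assms(5) by (simp add: partial_hom.map_poly_eq_0_iff[OF partial_hom_to_ac])
  ultimately show ?thesis using bij_betw_roots[OF partial_hom_axioms, of "map_poly to_ac p"] assms(4) by simp
qed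

lemma aut_roots: "aut p \<sigma> \<Longrightarrow> p \<noteq> 0 \<Longrightarrow> bij_betw \<sigma> (rts to_ac p) (rts to_ac p)"
  by (rule partial_hom_roots[of "splitting_field p"])
    (auto simp: aut_def splitting_field_to_ac intro: subsetD[OF roots_in_splitting_field])

lemma aut_id: "aut p (\<lambda>x. x)"
  by (simp add: aut_def partial_hom_id subfld_splitting_field)

lemma aut_comp: "aut p \<sigma> \<Longrightarrow> aut p \<tau> \<Longrightarrow> aut p (\<lambda>x. \<sigma> (\<tau> x))"
  unfolding aut_def
  by (auto intro!: partial_hom_comp[of _ \<tau> "\<tau> ` splitting_field p"] simp: image_image[of \<sigma> \<tau>, symmetric])

lemma aut_inv:
  assumes "aut p \<sigma>"
  shows "aut p (inv_into (splitting_field p) \<sigma>)"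
proof -
  let ?L = "splitting_field p"
  interpret partial_hom ?L \<sigma> using assms by (simp add: aut_def)
  have im: "\<sigma> ` ?L = ?L" using assms by (simp add: aut_def)
  have i: "inv_into ?L \<sigma> x \<in> ?L" "\<sigma> (inv_into ?L \<sigma> x) = x" if "x \<in> ?L" for x
    using that im inv_into_into[of x \<sigma> ?L] f_inv_into_f[of x \<sigma> ?L] by auto
  have eq: "inv_into ?L \<sigma> x = y" if "y \<in> ?L" "\<sigma> y = x" for x y
    using that inv_into_f_f[OF f_inj] by auto
  have "partial_hom ?L (inv_into ?L \<sigma>)"
    by unfold_locales (auto intro!: eq simp: i f_add f_mult add_in mult_in)
  moreover have "inv_into ?L \<sigma> ` ?L = ?L"
    using bij_betw_inv_into[of \<sigma> ?L ?L] f_inj im by (auto simp: bij_betw_def)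
  moreover have "inv_into ?L \<sigma> (to_ac c) = to_ac c" for c
    using assms by (intro eq) (auto simp: aut_def splitting_field_to_ac)
  ultimately show ?thesis by (simp add: aut_def)
qed

text \<open>A field extension \<open>'m\<close> of \<open>'k\<close> need not be algebraic over \<open>'k\<close>; automorphisms of an algebraic
  closure of \<open>'m\<close> restrict to the image of the splitting field because that image is normal.\<close>

lemma galois_transfer:
  fixes p :: "'k :: field poly" and e :: "'k \<Rightarrow> 'm :: field"
  assumes e: "partial_hom UNIV e" and p: "p \<noteq> 0"
  shows "\<exists>\<iota>. partial_hom (splitting_field p) \<iota> \<and> (\<forall>c. \<iota> (to_ac c) = to_ac (e c)) \<and>
     bij_betw \<iota> (rts to_ac p) (rts to_ac (map_poly e p)) \<and>
     (\<forall>q a b. q \<noteq> 0 \<and> (\<forall>r s. q = r * s \<longrightarrow> degree r = 0 \<or> degree s = 0) \<and>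
        a \<in> rts to_ac q \<and> b \<in> rts to_ac q \<longrightarrow>
        (\<exists>\<sigma>. aut p \<sigma> \<and> (\<forall>z\<in>rts to_ac p. \<iota> z \<in> range to_ac \<longrightarrow> \<sigma> z = z) \<and>
             (\<forall>z\<in>rts to_ac p. \<iota> z = a \<longrightarrow> \<iota> (\<sigma> z) = b)))"
proof -
  let ?L = "splitting_field p"
  define p2 where "p2 = map_poly e p"
  have p2: "p2 \<noteq> 0" using p by (simp add: p2_def partial_hom.map_poly_eq_0_iff[OF e])
  have te: "partial_hom UNIV (\<lambda>x. to_ac (e x))"
    using partial_hom_comp[OF e partial_hom_to_ac] by simp
  have base: "\<exists>q. subfld.pol (range to_ac) q \<and> q \<noteq> 0 \<and> poly q a = 0"
    if "a \<in> rts to_ac q" "q \<noteq> 0" for a and q :: "'c :: field poly"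
    using that
    by (intro exI[of _ "map_poly to_ac q"])
       (auto simp: pol_range_to_ac_iff partial_hom.map_poly_eq_0_iff[OF partial_hom_to_ac])
  obtain S' \<iota> where \<iota>': "partial_hom S' \<iota>" "range to_ac \<subseteq> S'" "rts to_ac p \<subseteq> S'"
    "\<forall>x\<in>range to_ac. \<iota> x = to_ac (e (of_ac x))"
    using partial_hom_extends[OF partial_hom_of_ac[OF te] finite_rts[OF p partial_hom_to_ac]]
      base[OF _ p] by blast
  have S'L: "?L \<subseteq> S'" using \<iota>' by (intro splitting_field_subset) (auto simp: partial_hom_def)
  have \<iota>: "partial_hom ?L \<iota>"
    using partial_hom.partial_hom_subset[OF \<iota>'(1) subfld_splitting_field S'L] .
  interpret \<iota>: partial_hom ?L \<iota> by fact
  have \<iota>c: "\<iota> (to_ac c) = to_ac (e c)" for c using \<iota>'(4) by auto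
  have mp: "map_poly \<iota> (map_poly to_ac p) = map_poly to_ac p2"
    using partial_hom.f_0[OF e] by (intro poly_eqI) (simp add: coeff_map_poly \<iota>c p2_def)
  have bij: "bij_betw \<iota> (rts to_ac p) (rts to_ac p2)"
    using bij_betw_roots[OF \<iota>, of "map_poly to_ac p"] roots_in_splitting_field[of p] p
    by (simp add: mp partial_hom.map_poly_eq_0_iff[OF partial_hom_to_ac] \<iota>.pol_def coeff_map_poly
        splitting_field_to_ac)
  have "\<exists>\<sigma>. aut p \<sigma> \<and> (\<forall>z\<in>rts to_ac p. \<iota> z \<in> range to_ac \<longrightarrow> \<sigma> z = z) \<and>
             (\<forall>z\<in>rts to_ac p. \<iota> z = a \<longrightarrow> \<iota> (\<sigma> z) = b)"
    if q: "q \<noteq> 0" and irr: "\<forall>r s. q = r * s \<longrightarrow> degree r = 0 \<or> degree s = 0"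
      and a: "a \<in> rts to_ac q" and b: "b \<in> rts to_ac q" for q a b
  proof -
    interpret B: subfld "range to_ac :: 'm alg_closure set" by (rule subfld_range_to_ac)
    \<comment> \<open>As \<open>q\<close> has no factorisation into two nonconstant polynomials, it
      is a constant multiple of the minimal polynomial \<open>m\<close> of \<open>a\<close>. Hence
      \<open>b\<close> is a root of \<open>m\<close> too, and sending \<open>a\<close> to
      \<open>b\<close> extends to a homomorphism over the base field.\<close>
    obtain m where m: "B.minimal a m"
      using base[OF a q] B.minimal_exists by blast
    obtain r where r: "B.pol r" "map_poly to_ac q = m * r"
    proof -
      have "B.pol (map_poly to_ac q)" using pol_range_to_ac_iff by blast
      thus ?thesis using B.minimal_dvd[OF m, of "map_poly to_ac q"] a that by blast
    qed
    obtain m0 r0 where mr: "m = map_poly to_ac m0" "r = map_poly to_ac r0"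
      using r(1) m unfolding B.minimal_def pol_range_to_ac_iff by blast
    have "map_poly to_ac q = map_poly to_ac (m0 * r0)"
      using r(2) by (simp add: mr partial_hom.map_poly_mult[OF partial_hom_to_ac])
    hence "map_poly to_ac (q - m0 * r0) = 0"
      by (simp add: partial_hom.map_poly_diff[OF partial_hom_to_ac])
    hence qmr: "q = m0 * r0"
      by (simp add: partial_hom.map_poly_eq_0_iff[OF partial_hom_to_ac])
    have "degree m0 > 0"
      using B.degree_minimal_pos[OF m] by (simp add: mr partial_hom.degree_map_poly[OF partial_hom_to_ac])
    hence "degree r0 = 0" using irr[rule_format, OF qmr] by simp
    then obtain k where k: "r0 = [:k:]" by (auto elim: degree_eq_zeroE)
    have "k \<noteq> 0" using q qmr k by auto
    have "poly (map_poly to_ac q) b = poly m b * poly r b" unfolding r(2) by simp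
    moreover have "poly r b = to_ac k" unfolding mr(2) k by (simp add: map_poly_pCons)
    ultimately have "poly m b = 0" using b \<open>k \<noteq> 0\<close> by simp
    hence "poly (map_poly (\<lambda>x. x) m) b = 0" by (simp add: map_poly_idI)
    from partial_hom.simple_extension[OF partial_hom_id[OF B.subfld_axioms] m this] obtain N0 \<tau>0 where \<tau>0:
      "partial_hom N0 \<tau>0" "range to_ac \<subseteq> N0" "a \<in> N0" "\<forall>x\<in>range to_ac. \<tau>0 x = x" "\<tau>0 a = b"
      by blast
    have "\<exists>q. subfld.pol N0 q \<and> q \<noteq> 0 \<and> poly q z = 0" if z: "z \<in> rts to_ac p2" for z
    proof -
      from base[OF z p2] obtain q where "B.pol q" "q \<noteq> 0" "poly q z = 0" by blast
      moreover have "subfld N0" using \<tau>0(1) by (simp add: partial_hom_def)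
      ultimately show ?thesis using \<tau>0(2)
        by (intro exI[of _ q]) (auto simp: subfld.pol_def B.pol_def)
    qed
    from partial_hom_extends[OF \<tau>0(1) finite_rts[OF p2 partial_hom_to_ac] this]
    obtain N \<tau> where \<tau>: "partial_hom N \<tau>" "N0 \<subseteq> N" "rts to_ac p2 \<subseteq> N" "\<forall>x\<in>N0. \<tau> x = \<tau>0 x"
      by blast
    interpret \<tau>: partial_hom N \<tau> by fact
    have \<tau>c: "\<tau> (to_ac c) = to_ac c" "to_ac c \<in> N" for c
      using \<tau> \<tau>0 by (metis rangeI subsetD)+
    have \<tau>r: "\<tau> ` rts to_ac p2 = rts to_ac p2"
      using partial_hom_roots[OF \<tau>(1) \<tau>c(2,1) \<tau>(3) p2] by (simp add: bij_betw_def)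
    have \<iota>r: "\<iota> ` rts to_ac p = rts to_ac p2" using bij by (simp add: bij_betw_def)
    have 1: "\<iota> ` ?L \<subseteq> N"
      using \<iota> \<tau>.subfld_axioms by (rule splitting_field_image_subset) (use \<iota>r \<tau>(3) in \<open>auto simp: \<iota>c \<tau>c\<close>)
    have h: "partial_hom ?L (\<lambda>x. \<tau> (\<iota> x))" by (rule partial_hom_comp[OF \<iota> \<tau>(1) 1])
    interpret h: partial_hom ?L "\<lambda>x. \<tau> (\<iota> x)" by fact
    \<comment> \<open>Normality: \<open>\<tau>\<close> permutes the roots of \<open>p2\<close>, so
      \<open>\<iota>\<close> and its composite with \<open>\<tau>\<close> have the same image. This
      inclusion makes \<open>\<sigma>\<close> well defined as \<open>\<tau>\<close> conjugated by
      \<open>\<iota>\<close>, and the converse one makes it surjective.\<close>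
    have 2: "(\<lambda>x. \<tau> (\<iota> x)) ` ?L \<subseteq> \<iota> ` ?L"
      using h \<iota>.subfld_image
    proof (rule splitting_field_image_subset)
      show "\<tau> (\<iota> (to_ac c)) \<in> \<iota> ` ?L" for c
        using \<iota>c \<tau>c splitting_field_to_ac by (metis imageI)
      have "(\<lambda>x. \<tau> (\<iota> x)) ` rts to_ac p = \<iota> ` rts to_ac p"
        using \<iota>r \<tau>r by (metis image_image)
      thus "(\<lambda>x. \<tau> (\<iota> x)) ` rts to_ac p \<subseteq> \<iota> ` ?L"
        using roots_in_splitting_field[of p] by blast
    qed
    have 3: "\<iota> ` ?L \<subseteq> (\<lambda>x. \<tau> (\<iota> x)) ` ?L"
      using \<iota> h.subfld_image
    proof (rule splitting_field_image_subset)
      show "\<iota> (to_ac c) \<in> (\<lambda>x. \<tau> (\<iota> x)) ` ?L" for c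
        using \<iota>c \<tau>c splitting_field_to_ac by (metis (mono_tags, lifting) imageI)
      have "(\<lambda>x. \<tau> (\<iota> x)) ` rts to_ac p = \<iota> ` rts to_ac p"
        using \<iota>r \<tau>r by (metis image_image)
      thus "\<iota> ` rts to_ac p \<subseteq> (\<lambda>x. \<tau> (\<iota> x)) ` ?L"
        using roots_in_splitting_field[of p] by blast
    qed
    define \<sigma> where "\<sigma> x = inv_into ?L \<iota> (\<tau> (\<iota> x))" for x
    have \<iota>\<sigma>: "\<iota> (\<sigma> x) = \<tau> (\<iota> x)" and \<sigma>L: "\<sigma> x \<in> ?L" if "x \<in> ?L" for x
      using that 2 f_inv_into_f[of "\<tau> (\<iota> x)" \<iota> ?L] inv_into_into[of "\<tau> (\<iota> x)" \<iota> ?L]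
      by (auto simp: \<sigma>_def)
    have \<sigma>eq: "\<sigma> x = y" if "x \<in> ?L" "y \<in> ?L" "\<tau> (\<iota> x) = \<iota> y" for x y
      using that inv_into_f_f[OF \<iota>.f_inj] by (auto simp: \<sigma>_def)
    have "\<tau> (\<iota> a + \<iota> b) = \<tau> (\<iota> a) + \<tau> (\<iota> b)" "\<tau> (\<iota> a * \<iota> b) = \<tau> (\<iota> a) * \<tau> (\<iota> b)"
      if "a \<in> ?L" "b \<in> ?L" for a b
      using that 1 by (auto intro!: \<tau>.f_add \<tau>.f_mult)
    note \<tau>\<iota> = this
    have "aut p \<sigma>"
      unfolding aut_def
    proof (intro conjI allI)
      show "partial_hom ?L \<sigma>"
        by unfold_locales
          (auto intro!: \<sigma>eq simp: \<iota>\<sigma> \<sigma>L \<iota>.f_add \<iota>.f_mult \<tau>\<iota> \<iota>.add_in \<iota>.mult_in)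
      show "\<sigma> (to_ac c) = to_ac c" for c
        by (rule \<sigma>eq) (auto simp: \<iota>c \<tau>c splitting_field_to_ac)
      have "y \<in> \<sigma> ` ?L" if y: "y \<in> ?L" for y
      proof -
        from 3 y obtain x where "x \<in> ?L" "\<iota> y = \<tau> (\<iota> x)" by blast
        thus ?thesis using \<sigma>eq[of x y] y by auto
      qed
      thus "\<sigma> ` ?L = ?L" using \<sigma>L by auto
    qed
    moreover have "\<sigma> z = z" if "z \<in> rts to_ac p" "\<iota> z \<in> range to_ac" for z
      using that roots_in_splitting_field[of p] \<tau>c by (intro \<sigma>eq) auto
    moreover have "\<iota> (\<sigma> z) = b" if "z \<in> rts to_ac p" "\<iota> z = a" for z
      using that roots_in_splitting_field[of p] \<tau>0 \<tau> by (subst \<iota>\<sigma>) auto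
    ultimately show ?thesis by blast
  qed
  thus ?thesis using \<iota> \<iota>c bij unfolding p2_def by blast
qed

subsection \<open>Permutation groups\<close>

locale perm_group =
  fixes Z :: "'a set" and G :: "('a \<Rightarrow> 'a) set"
  assumes finite_Z: "finite Z"
    and permutes: "\<pi> \<in> G \<Longrightarrow> \<pi> permutes Z"
    and id_in: "id \<in> G"
    and comp_in: "\<pi> \<in> G \<Longrightarrow> \<rho> \<in> G \<Longrightarrow> \<pi> \<circ> \<rho> \<in> G"
    and inv_in: "\<pi> \<in> G \<Longrightarrow> Hilbert_Choice.inv \<pi> \<in> G"
begin

text \<open>An element moving \<open>z\<close>, followed by the stabiliser of \<open>z\<close>,
  reaches every point, so the group is transitive. For pairs: carry \<open>a\<close> to
  \<open>z\<close>, adjust the second entry inside the stabiliser, then carry \<open>z\<close> to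
  \<open>u\<close>.\<close>

lemma doubly_transitive:
  assumes z: "z \<in> Z" and stab: "\<And>u v. u \<in> Z - {z} \<Longrightarrow> v \<in> Z - {z} \<Longrightarrow> \<exists>\<pi>\<in>G. \<pi> z = z \<and> \<pi> u = v"
    and moved: "\<exists>\<pi>\<in>G. \<pi> z \<noteq> z"
    and ab: "a \<in> Z" "b \<in> Z" "a \<noteq> b" and uv: "u \<in> Z" "v \<in> Z" "u \<noteq> v"
  shows "\<exists>\<pi>\<in>G. \<pi> a = u \<and> \<pi> b = v"
proof -
  have trans: "\<exists>\<pi>\<in>G. \<pi> z = w" if w: "w \<in> Z" for w
  proof (cases "w = z")
    case True
    thus ?thesis using id_in by (intro bexI[of _ id]) auto
  next
    case False
    obtain \<pi> where \<pi>: "\<pi> \<in> G" "\<pi> z \<noteq> z" using moved by blast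
    have "\<pi> z \<in> Z - {z}" using permutes_in_image[OF permutes[OF \<pi>(1)]] z \<pi>(2) by auto
    then obtain \<rho> where "\<rho> \<in> G" "\<rho> z = z" "\<rho> (\<pi> z) = w" using stab[of "\<pi> z" w] w False by auto
    thus ?thesis using \<pi> by (intro bexI[of _ "\<rho> \<circ> \<pi>"]) (auto intro: comp_in)
  qed
  obtain \<alpha> where \<alpha>: "\<alpha> \<in> G" "\<alpha> z = a" using trans[OF ab(1)] by blast
  obtain \<beta> where \<beta>: "\<beta> \<in> G" "\<beta> z = u" using trans[OF uv(1)] by blast
  have \<alpha>p: "\<alpha> permutes Z" and \<beta>p: "\<beta> permutes Z" using \<alpha> \<beta> permutes by auto
  have "Hilbert_Choice.inv \<alpha> b \<in> Z - {z}"
    using \<alpha> ab permutes_in_image[OF permutes_inv[OF \<alpha>p]] permutes_inverses(1)[OF \<alpha>p] by force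
  moreover have "Hilbert_Choice.inv \<beta> v \<in> Z - {z}"
    using \<beta> uv permutes_in_image[OF permutes_inv[OF \<beta>p]] permutes_inverses(1)[OF \<beta>p] by force
  ultimately obtain \<rho> where \<rho>: "\<rho> \<in> G" "\<rho> z = z" "\<rho> (Hilbert_Choice.inv \<alpha> b) = Hilbert_Choice.inv \<beta> v" using stab by blast
  have "Hilbert_Choice.inv \<alpha> a = z" using \<alpha> permutes_inverses(2)[OF \<alpha>p] by metis
  thus ?thesis using \<alpha> \<beta> \<rho> permutes_inverses(1)[OF \<beta>p]
    by (intro bexI[of _ "\<beta> \<circ> \<rho> \<circ> Hilbert_Choice.inv \<alpha>"]) (auto intro!: comp_in inv_in)
qed

text \<open>Conjugating the given transposition by elements that realise all pairs of distinct
  points yields every transposition, and these generate all permutations of a finite set.\<close>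

lemma contains_all_permutations:
  assumes two: "\<And>a b u v. a \<in> Z \<Longrightarrow> b \<in> Z \<Longrightarrow> a \<noteq> b \<Longrightarrow> u \<in> Z \<Longrightarrow> v \<in> Z \<Longrightarrow> u \<noteq> v \<Longrightarrow>
      \<exists>\<pi>\<in>G. \<pi> a = u \<and> \<pi> b = v"
    and t: "Transposition.transpose a b \<in> G" "a \<in> Z" "b \<in> Z" "a \<noteq> b"
    and "\<pi> permutes Z"
  shows "\<pi> \<in> G"
proof -
  have tr: "Transposition.transpose u v \<in> G" if uv: "u \<in> Z" "v \<in> Z" "u \<noteq> v" for u v
  proof -
    obtain \<rho> where \<rho>: "\<rho> \<in> G" "\<rho> a = u" "\<rho> b = v" using two[OF t(2-4) uv] by blast
    hence p: "\<rho> permutes Z" using permutes by blast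
    have "\<rho> \<circ> Transposition.transpose a b \<circ> Hilbert_Choice.inv \<rho> = Transposition.transpose u v"
    proof
      fix x
      have x: "\<rho> (Hilbert_Choice.inv \<rho> x) = x" by (rule permutes_inverses(1)[OF p])
      have i: "Hilbert_Choice.inv \<rho> u = a" "Hilbert_Choice.inv \<rho> v = b" using \<rho> permutes_inverses(2)[OF p] by auto
      have "Hilbert_Choice.inv \<rho> x \<noteq> a" if "x \<noteq> u" using that x \<rho>(2) by auto
      moreover have "Hilbert_Choice.inv \<rho> x \<noteq> b" if "x \<noteq> v" using that x \<rho>(3) by auto
      ultimately show "(\<rho> \<circ> Transposition.transpose a b \<circ> Hilbert_Choice.inv \<rho>) x = Transposition.transpose u v x"
        using x i \<rho> by (auto simp: Transposition.transpose_def)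
    qed
    thus ?thesis using comp_in[OF comp_in[OF \<rho>(1) t(1)] inv_in[OF \<rho>(1)]] by simp
  qed
  from \<open>\<pi> permutes Z\<close> finite_Z show ?thesis
    by (induction rule: permutes_induct) (rule id_in, rule comp_in, rule tr, assumption+)
qed

end

section \<open>Automorphisms as permutations of the roots\<close>

definition root_perm :: "'k :: field poly \<Rightarrow> ('k alg_closure \<Rightarrow> 'k alg_closure) \<Rightarrow> 'k alg_closure \<Rightarrow> 'k alg_closure" where
  "root_perm p \<sigma> z = (if z \<in> rts to_ac p then \<sigma> z else z)"

lemma root_perm_permutes:
  assumes "aut p \<sigma>" "p \<noteq> 0"
  shows "root_perm p \<sigma> permutes rts to_ac p"
proof (rule bij_imp_permutes)
  show "bij_betw (root_perm p \<sigma>) (rts to_ac p) (rts to_ac p)"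
    using aut_roots[OF assms] by (subst bij_betw_cong) (auto simp: root_perm_def)
qed (auto simp: root_perm_def)

lemma perm_group_root_perm:
  fixes p :: "'k :: field poly"
  assumes "p \<noteq> 0"
  shows "perm_group (rts to_ac p) (root_perm p ` Collect (aut p))"
proof
  show "finite (rts to_ac p)" using finite_rts[OF assms partial_hom_to_ac] .
  show "\<pi> permutes rts to_ac p" if "\<pi> \<in> root_perm p ` Collect (aut p)" for \<pi>
    using that root_perm_permutes assms by auto
  have "root_perm p (\<lambda>x. x) = id" by (auto simp: root_perm_def)
  thus "id \<in> root_perm p ` Collect (aut p)" using aut_id[of p] by (metis imageI mem_Collect_eq)
  show "\<pi> \<circ> \<rho> \<in> root_perm p ` Collect (aut p)"
    if "\<pi> \<in> root_perm p ` Collect (aut p)" "\<rho> \<in> root_perm p ` Collect (aut p)" for \<pi> \<rho>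
  proof -
    from that obtain \<sigma> \<tau> where st: "aut p \<sigma>" "aut p \<tau>" "\<pi> = root_perm p \<sigma>" "\<rho> = root_perm p \<tau>"
      by auto
    have "\<tau> z \<in> rts to_ac p" if "z \<in> rts to_ac p" for z
      using aut_roots[OF st(2) assms] that unfolding bij_betw_def by blast
    hence "(\<pi> \<circ> \<rho>) z = root_perm p (\<lambda>x. \<sigma> (\<tau> x)) z" for z
      by (cases "z \<in> rts to_ac p") (simp_all add: st(3,4) root_perm_def)
    hence "\<pi> \<circ> \<rho> = root_perm p (\<lambda>x. \<sigma> (\<tau> x))" by (rule ext)
    thus ?thesis using aut_comp[OF st(1,2)] by auto
  qed
  show "Hilbert_Choice.inv \<pi> \<in> root_perm p ` Collect (aut p)" if "\<pi> \<in> root_perm p ` Collect (aut p)" for \<pi>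
  proof -
    from that obtain \<sigma> where s: "aut p \<sigma>" "\<pi> = root_perm p \<sigma>" by auto
    let ?\<tau> = "inv_into (splitting_field p) \<sigma>"
    interpret partial_hom "splitting_field p" \<sigma> using s by (simp add: aut_def)
    have r: "\<sigma> z \<in> rts to_ac p" if "z \<in> rts to_ac p" for z
      using aut_roots[OF s(1) assms] that unfolding bij_betw_def by blast
    have "root_perm p ?\<tau> (\<pi> z) = z" for z
    proof (cases "z \<in> rts to_ac p")
      case True
      hence "z \<in> splitting_field p" using roots_in_splitting_field by blast
      thus ?thesis using True r[OF True] inv_into_f_f[OF f_inj] by (simp add: s(2) root_perm_def)
    qed (simp add: s(2) root_perm_def)
    moreover have "\<pi> permutes rts to_ac p" using root_perm_permutes s assms by auto
    ultimately have "root_perm p ?\<tau> = Hilbert_Choice.inv \<pi>"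
      by (metis (no_types, lifting) ext permutes_inverses(1))
    thus ?thesis using aut_inv[OF s(1)] by (metis imageI mem_Collect_eq)
  qed
qed

text \<open>Restricting to the roots is injective, because two automorphisms agree on a subfield; if
  they agree on the roots, this subfield contains the base field and the roots and is the whole
  splitting field. Surjectivity is the assumption \<open>all\<close>, transported along a numbering
  \<open>e\<close> of the roots.\<close>

lemma galois_group_iso_sym_group:
  fixes p :: "'k :: field poly"
  assumes p: "p \<noteq> 0" and card: "card (rts to_ac p) = n"
    and all: "\<And>\<pi>. \<pi> permutes rts to_ac p \<Longrightarrow> \<exists>\<sigma>. aut p \<sigma> \<and> (\<forall>z\<in>rts to_ac p. \<sigma> z = \<pi> z)"
  shows "galois_group p \<cong> sym_group n"
proof -
  let ?L = "splitting_field p" and ?Z = "rts to_ac p" and ?G = "galois_group p"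
  have fin: "finite ?Z" using finite_rts[OF p partial_hom_to_ac] .
  obtain e where e: "bij_betw e {1..n} ?Z"
    using ex_bij_betw_nat_finite_1[OF fin] card by auto
  let ?e' = "inv_into {1..n} e"
  have e': "bij_betw ?e' ?Z {1..n}" using bij_betw_inv_into[OF e] .
  have ee': "e (?e' z) = z" "?e' z \<in> {1..n}" if "z \<in> ?Z" for z
    using that e e' bij_betw_inv_into_right[OF e] by (auto dest: bij_betwE)
  have e'e: "?e' (e i) = i" "e i \<in> ?Z" if "i \<in> {1..n}" for i
    using that e bij_betw_inv_into_left[OF e] by (auto dest: bij_betwE)
  have carr: "aut p \<sigma>" "\<sigma> \<in> extensional ?L" "\<sigma> \<in> Bij ?L" if "\<sigma> \<in> carrier ?G" for \<sigma>
  proof -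
    from that have s: "\<sigma> \<in> Bij ?L" "\<And>a b. a \<in> ?L \<Longrightarrow> b \<in> ?L \<Longrightarrow> \<sigma> (a + b) = \<sigma> a + \<sigma> b \<and> \<sigma> (a * b) = \<sigma> a * \<sigma> b"
      "\<And>c. \<sigma> (to_ac c) = to_ac c" by (auto simp: galois_group_def Let_def)
    interpret subfld ?L by (rule subfld_splitting_field)
    have "\<sigma> 1 = 1" using s(3)[of 1] by simp
    hence "partial_hom ?L \<sigma>" using s(2) by unfold_locales auto
    thus "aut p \<sigma>" using s by (auto simp: aut_def Bij_def bij_betw_def)
    show "\<sigma> \<in> extensional ?L" "\<sigma> \<in> Bij ?L" using s(1) by (auto simp: Bij_def)
  qed
  have carrI: "restrict \<sigma> ?L \<in> carrier ?G" if "aut p \<sigma>" for \<sigma>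
  proof -
    interpret partial_hom ?L \<sigma> using that by (simp add: aut_def)
    show ?thesis using that f_inj
      by (auto simp: galois_group_def Let_def Bij_def aut_def bij_betw_def splitting_field_to_ac
          f_add f_mult add_in mult_in inj_on_restrict_eq)
  qed
  have rng: "\<sigma> z \<in> ?Z" if "\<sigma> \<in> carrier ?G" "z \<in> ?Z" for \<sigma> z
    using aut_roots[OF carr(1)[OF that(1)] p] that(2) unfolding bij_betw_def by blast
  define \<phi> where "\<phi> \<sigma> i = (if i \<in> {1..n} then ?e' (\<sigma> (e i)) else i)" for \<sigma> i
  have "\<phi> \<in> hom ?G (sym_group n)"
  proof (rule homI)
    fix \<sigma> assume s: "\<sigma> \<in> carrier ?G"
    have "bij_betw (\<lambda>i. ?e' (\<sigma> (e i))) {1..n} {1..n}"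
      using bij_betw_trans[OF bij_betw_trans[OF e aut_roots[OF carr(1)[OF s] p]] e'] by (simp add: o_def)
    hence "bij_betw (\<phi> \<sigma>) {1..n} {1..n}"
      by (subst bij_betw_cong) (auto simp: \<phi>_def)
    thus "\<phi> \<sigma> \<in> carrier (sym_group n)"
      unfolding sym_group_def by (auto intro!: bij_imp_permutes simp: \<phi>_def)
  next
    fix \<sigma> \<tau> assume s: "\<sigma> \<in> carrier ?G" and t: "\<tau> \<in> carrier ?G"
    have m: "\<sigma> \<otimes>\<^bsub>?G\<^esub> \<tau> = compose ?L \<sigma> \<tau>"
      using carr(3)[OF s] carr(3)[OF t] by (simp add: galois_group_def Let_def BijGroup_def)
    show "\<phi> (\<sigma> \<otimes>\<^bsub>?G\<^esub> \<tau>) = \<phi> \<sigma> \<otimes>\<^bsub>sym_group n\<^esub> \<phi> \<tau>"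
    proof
      fix i
      show "\<phi> (\<sigma> \<otimes>\<^bsub>?G\<^esub> \<tau>) i = (\<phi> \<sigma> \<otimes>\<^bsub>sym_group n\<^esub> \<phi> \<tau>) i"
      proof (cases "i \<in> {1..n}")
        case True
        have z: "e i \<in> ?Z" by (rule e'e(2)[OF True])
        hence "e i \<in> ?L" using roots_in_splitting_field by blast
        hence "\<phi> (\<sigma> \<otimes>\<^bsub>?G\<^esub> \<tau>) i = ?e' (\<sigma> (\<tau> (e i)))"
          using True unfolding m \<phi>_def by (simp add: compose_def)
        moreover have "\<phi> \<sigma> (\<phi> \<tau> i) = ?e' (\<sigma> (\<tau> (e i)))"
          using ee'[OF rng[OF t z]] True by (simp add: \<phi>_def)
        ultimately show ?thesis by (simp add: sym_group_def)
      qed (auto simp: \<phi>_def sym_group_def)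
    qed
  qed
  moreover have "bij_betw \<phi> (carrier ?G) (carrier (sym_group n))"
  proof (rule bij_betwI')
    fix \<sigma> \<tau> assume s: "\<sigma> \<in> carrier ?G" and t: "\<tau> \<in> carrier ?G"
    show "(\<phi> \<sigma> = \<phi> \<tau>) = (\<sigma> = \<tau>)"
    proof
      assume eq: "\<phi> \<sigma> = \<phi> \<tau>"
      have z: "\<sigma> z = \<tau> z" if "z \<in> ?Z" for z
      proof -
        have "?e' (\<sigma> z) = ?e' (\<tau> z)"
          using fun_cong[OF eq, of "?e' z"] ee'[OF that] by (simp add: \<phi>_def)
        thus ?thesis using ee'(1)[OF rng[OF s that]] ee'(1)[OF rng[OF t that]] by metis
      qed
      interpret \<sigma>: partial_hom ?L \<sigma> using carr(1)[OF s] by (simp add: aut_def)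
      interpret \<tau>: partial_hom ?L \<tau> using carr(1)[OF t] by (simp add: aut_def)
      have "subfld {x \<in> ?L. \<sigma> x = \<tau> x}"
        by unfold_locales
          (auto simp: \<sigma>.f_add \<tau>.f_add \<sigma>.f_mult \<tau>.f_mult \<sigma>.f_minus \<tau>.f_minus \<sigma>.f_inverse \<tau>.f_inverse
            \<sigma>.add_in \<sigma>.mult_in \<sigma>.minus_in \<sigma>.inverse_in)
      hence "?L \<subseteq> {x \<in> ?L. \<sigma> x = \<tau> x}"
      proof (rule splitting_field_subset)
        show "range to_ac \<subseteq> {x \<in> ?L. \<sigma> x = \<tau> x}"
          using carr(1)[OF s] carr(1)[OF t] by (auto simp: aut_def splitting_field_to_ac)
        show "?Z \<subseteq> {x \<in> ?L. \<sigma> x = \<tau> x}" using z roots_in_splitting_field[of p] by auto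
      qed
      thus "\<sigma> = \<tau>" using carr(2)[OF s] carr(2)[OF t] by (intro extensionalityI[of \<sigma> ?L \<tau>]) auto
    qed simp
  next
    fix \<sigma> assume "\<sigma> \<in> carrier ?G"
    thus "\<phi> \<sigma> \<in> carrier (sym_group n)" using \<open>\<phi> \<in> hom ?G (sym_group n)\<close> by (auto simp: hom_def)
  next
    fix \<rho> assume "\<rho> \<in> carrier (sym_group n)"
    hence \<rho>: "\<rho> permutes {1..n}" by (simp add: sym_group_def)
    define \<pi> where "\<pi> z = (if z \<in> ?Z then e (\<rho> (?e' z)) else z)" for z
    have "bij_betw (\<lambda>z. e (\<rho> (?e' z))) ?Z ?Z"
      using bij_betw_trans[OF bij_betw_trans[OF e' permutes_imp_bij[OF \<rho>]] e] by (simp add: o_def)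
    hence "bij_betw \<pi> ?Z ?Z" by (subst bij_betw_cong) (auto simp: \<pi>_def)
    hence "\<pi> permutes ?Z" by (rule bij_imp_permutes) (auto simp: \<pi>_def)
    from all[OF this] obtain \<sigma> where s: "aut p \<sigma>" "\<forall>z\<in>?Z. \<sigma> z = \<pi> z" by blast
    have "\<phi> (restrict \<sigma> ?L) i = \<rho> i" for i
    proof (cases "i \<in> {1..n}")
      case True
      have "e i \<in> ?L" using e'e(2)[OF True] roots_in_splitting_field by blast
      thus ?thesis using True e'e[OF True] s(2) e'e(1)[of "\<rho> i"] permutes_in_image[OF \<rho>, of i]
        by (simp add: \<phi>_def \<pi>_def)
    next
      case False
      hence "\<phi> (restrict \<sigma> ?L) i = i" unfolding \<phi>_def by (rule if_not_P)
      thus ?thesis using permutes_not_in[OF \<rho> False] by simp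
    qed
    hence "\<rho> = \<phi> (restrict \<sigma> ?L)" by (intro ext) (rule sym)
    thus "\<exists>\<sigma>\<in>carrier ?G. \<rho> = \<phi> \<sigma>" using carrI[OF s(1)] by blast
  qed
  ultimately show ?thesis unfolding is_iso_def iso_def by blast
qed

subsection \<open>Ring homomorphisms\<close>

locale rhom =
  fixes h :: "'a :: comm_ring_1 \<Rightarrow> 'b :: comm_ring_1"
  assumes h_1 [simp]: "h 1 = 1"
    and h_add: "h (a + b) = h a + h b"
    and h_mult: "h (a * b) = h a * h b"
begin

lemma h_0 [simp]: "h 0 = 0"
  using h_add[of 0 0] by simp

lemma h_minus: "h (- a) = - h a"
  using h_add[of a "- a"] by (simp add: eq_neg_iff_add_eq_0 add.commute)

lemma h_diff: "h (a - b) = h a - h b"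
  using h_add[of a "- b"] by (simp add: h_minus)

lemma h_sum: "h (sum f A) = (\<Sum>x\<in>A. h (f x))"
  by (induction A rule: infinite_finite_induct) (auto simp: h_add)

lemma h_power: "h (a ^ n) = h a ^ n"
  by (induction n) (auto simp: h_mult)

lemma h_of_nat [simp]: "h (of_nat n) = of_nat n"
  by (induction n) (auto simp: h_add)

lemma h_numeral [simp]: "h (numeral n) = numeral n"
  using h_of_nat[of "numeral n"] by (simp del: h_of_nat)

lemmas h_simps = h_add h_diff h_minus h_mult h_power

lemma map_poly_add: "map_poly h (p + q) = map_poly h p + map_poly h q"
  by (intro poly_eqI) (simp add: coeff_map_poly h_add)

lemma map_poly_mult: "map_poly h (p * q) = map_poly h p * map_poly h q"
  by (intro poly_eqI) (simp add: coeff_map_poly coeff_mult h_mult h_sum)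

lemma map_poly_pCons: "map_poly h (pCons a p) = pCons (h a) (map_poly h p)"
  by (rule Polynomial.map_poly_pCons) simp

lemma h_poly: "h (poly p x) = poly (map_poly h p) (h x)"
  by (induction p) (auto simp: map_poly_pCons h_add h_mult)

lemma rhom_map_poly: "rhom (map_poly h)"
  by unfold_locales (simp_all add: map_poly_add map_poly_mult one_pCons map_poly_pCons)

lemma rhom_eval: "rhom (\<lambda>p. poly (map_poly h p) y)"
  by unfold_locales (simp_all add: map_poly_add map_poly_mult one_pCons map_poly_pCons)

end

lemma rhom_id: "rhom (\<lambda>x. x)"
  by unfold_locales auto

lemma rhom_comp: "rhom h \<Longrightarrow> rhom k \<Longrightarrow> rhom (\<lambda>x. k (h x))"
  by (auto simp: rhom_def)

lemma rhom_const: "rhom (\<lambda>c. [:c:])"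
  by unfold_locales (auto simp: one_pCons)

lemma rhom_to_fract: "rhom to_fract"
  by unfold_locales auto

lemma rhom_to_ac: "rhom to_ac"
  by unfold_locales auto

lemma partial_hom_UNIV_iff: "partial_hom UNIV h \<longleftrightarrow> rhom h"
  by (auto simp: partial_hom_def partial_hom_axioms_def rhom_def subfld_UNIV)

text \<open>Evaluates \<open>h\<close> on the normalised representative of a fraction. When
  \<open>h\<close> is injective, every representative gives the same value.\<close>

definition fract_lift :: "('d :: {factorial_ring_gcd, semiring_gcd_mult_normalize} \<Rightarrow> 'm :: field) \<Rightarrow> 'd fract \<Rightarrow> 'm" where
  "fract_lift h r = h (fst (quot_of_fract r)) / h (snd (quot_of_fract r))"

context
  fixes h :: "'d :: {factorial_ring_gcd, semiring_gcd_mult_normalize} \<Rightarrow> 'm :: field"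
  assumes h: "rhom h" and inj: "\<And>a. h a = 0 \<Longrightarrow> a = 0"
begin

interpretation rhom h by (rule h)

lemma fract_lift_Fract:
  assumes "b \<noteq> 0"
  shows "fract_lift h (Fract a b) = h a / h b"
proof -
  obtain r s where rs: "quot_of_fract (Fract a b) = (r, s)" by force
  have s: "s \<noteq> 0" using snd_quot_of_fract_nonzero[of "Fract a b"] rs by simp
  have "Fract r s = Fract a b"
    using quot_to_fract_quot_of_fract[of "Fract a b"] rs by (simp add: quot_to_fract_def)
  hence "r * b = a * s" using assms s by (simp add: eq_fract)
  hence "h r * h b = h a * h s" by (metis h_mult)
  moreover have "h s \<noteq> 0" "h b \<noteq> 0" using inj s assms by auto
  ultimately show ?thesis by (simp add: fract_lift_def rs field_simps)
qed

lemma fract_lift_to_fract: "fract_lift h (to_fract a) = h a"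
  by (simp add: to_fract_def fract_lift_Fract)

lemma rhom_fract_lift: "rhom (fract_lift h)"
proof
  show "fract_lift h 1 = 1" using fract_lift_to_fract[of 1] by simp
  fix p q :: "'d fract"
  obtain a b where p: "p = Fract a b" "b \<noteq> 0" by (cases p)
  obtain c d where q: "q = Fract c d" "d \<noteq> 0" by (cases q)
  have [simp]: "h b \<noteq> 0" "h d \<noteq> 0" using inj p q by auto
  show "fract_lift h (p + q) = fract_lift h p + fract_lift h q"
    "fract_lift h (p * q) = fract_lift h p * fract_lift h q"
    using p q by (simp_all add: fract_lift_Fract h_add h_mult field_simps)
qed

end

subsection \<open>The sextic in the uniformising parameter\<close>

definition sextic :: "'a :: comm_ring_1 \<Rightarrow> 'a \<Rightarrow> 'a poly" where
  "sextic x h = [:x ^ 3, - 3 * x ^ 3, 3 * x ^ 3, 1 - x ^ 3 + 9 * h, - 3, 3, - 1:]"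

lemma poly_sextic: "poly (sextic x h) z = (1 - z) ^ 3 * (z ^ 3 + x ^ 3) + 9 * h * z ^ 3"
  by (simp add: sextic_def algebra_simps eval_nat_numeral)

lemma sextic_nonzero [simp]: "sextic x h \<noteq> 0"
  and degree_sextic [simp]: "degree (sextic x h) = 6"
  by (simp_all add: sextic_def)

lemma (in rhom) map_poly_sextic: "map_poly h (sextic x y) = sextic (h x) (h y)"
  by (simp add: sextic_def map_poly_pCons h_simps)

abbreviation xK :: "rat poly poly fract" where "xK \<equiv> to_fract [:[:0, 1:]:]"
abbreviation hK :: "rat poly poly fract" where "hK \<equiv> to_fract [:0, 1:]"

text \<open>At \<open>x = H = 1\<close> the sextic is \<open>1 + z + \<dots> + z\<^sup>6\<close> modulo 2, which has no root.\<close>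

lemma sextic_no_rational_root: "poly (sextic 1 1) (q :: rat) \<noteq> 0"
proof
  assume 0: "poly (sextic 1 1) q = 0"
  obtain m n where mn: "quotient_of q = (m, n)" by force
  have n: "n > 0" "coprime m n" "q = of_int m / of_int n"
    using quotient_of_denom_pos[OF mn] quotient_of_coprime[OF mn] quotient_of_div[OF mn] by auto
  have "of_int (n^6 - 3*m*n^5 + 3*m^2*n^4 + 9*m^3*n^3 - 3*m^4*n^2 + 3*m^5*n - m^6)
      = poly (sextic 1 1) q * of_int n ^ 6"
    using n(1) by (simp add: n(3) sextic_def field_simps eval_nat_numeral)
  hence "of_int (n^6 - 3*m*n^5 + 3*m^2*n^4 + 9*m^3*n^3 - 3*m^4*n^2 + 3*m^5*n - m^6) = (0::rat)"
    using 0 by simp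
  hence eq: "n^6 - 3*m*n^5 + 3*m^2*n^4 + 9*m^3*n^3 - 3*m^4*n^2 + 3*m^5*n - m^6 = 0"
    by (simp only: of_int_eq_0_iff)
  \<comment> \<open>All coefficients are odd, so modulo 2 this is the sum of all monomials
    \<open>m^i n^(6-i)\<close>. It is odd unless both \<open>m\<close> and \<open>n\<close> are
    even.\<close>
  have "even (n^6 - 3*m*n^5 + 3*m^2*n^4 + 9*m^3*n^3 - 3*m^4*n^2 + 3*m^5*n - m^6)"
    unfolding eq by simp
  hence "even m" "even n" by auto
  thus False using n(2) by (meson coprime_common_divisor odd_one)
qed

text \<open>The sextic has leading coefficient \<open>-1\<close>, so the denominator of a root in
  lowest terms is a unit of Q[x,H]. It therefore survives the specialisation
  \<open>x = H = 1\<close>, and the root would specialise to a rational root.\<close>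

lemma sextic_no_root: "poly (sextic xK hK) r \<noteq> 0"
proof
  assume 0: "poly (sextic xK hK) r = 0"
  obtain a b where ab: "quot_of_fract r = (a, b)" by force
  have b: "b \<noteq> 0" "coprime a b" "r = to_fract a / to_fract b"
    using snd_quot_of_fract_nonzero[of r] coprime_quot_of_fract[of r] Fract_quot_of_fract[of r]
    by (auto simp: ab Fract_conv_to_fract)
  define x :: "rat poly poly" where "x = [:[:0, 1:]:]"
  define H :: "rat poly poly" where "H = [:0, 1:]"
  define T where "T = x^3*b^6 - 3*x^3*a*b^5 + 3*x^3*a^2*b^4 + (1 - x^3 + 9*H)*a^3*b^3
    - 3*a^4*b^2 + 3*a^5*b - a^6"
  have n: "to_fract (numeral k) = (numeral k :: rat poly poly fract)" for k
    using rhom.h_numeral[OF rhom_to_fract] .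
  have p: "to_fract (u ^ k) = to_fract u ^ k" for u :: "rat poly poly" and k
    using rhom.h_power[OF rhom_to_fract] .
  have "to_fract T = poly (sextic (to_fract x) (to_fract H)) r * to_fract b ^ 6"
    using b(1) by (simp add: b(3) T_def sextic_def n p field_simps eval_nat_numeral)
  hence "to_fract T = 0" using 0 by (simp add: x_def H_def)
  hence T: "T = 0" by simp
  have "a ^ 6 = b * (x^3*b^5 - 3*x^3*a*b^4 + 3*x^3*a^2*b^3 + (1 - x^3 + 9*H)*a^3*b^2 - 3*a^4*b + 3*a^5)"
    using T unfolding T_def by (simp add: algebra_simps eval_nat_numeral)
  hence "b dvd a ^ 6" by (rule dvdI)
  moreover have "coprime (a ^ 6) b" using b(2) by simp
  ultimately have "is_unit b" by (metis coprime_absorb_right)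
  then obtain c where c: "b * c = 1" by (auto elim: dvdE)
  define ev where "ev p = poly (poly p 1) 1" for p :: "rat poly poly"
  interpret ev: rhom ev unfolding ev_def by unfold_locales auto
  have b1: "ev b \<noteq> 0" using arg_cong[OF c, of ev] by (auto simp: ev.h_mult)
  have "ev x = 1" "ev H = 1" by (simp_all add: ev_def x_def H_def)
  hence "(ev b)^6 - 3*ev a*ev b^5 + 3*ev a^2*ev b^4 + 9*ev a^3*ev b^3 - 3*ev a^4*ev b^2 + 3*ev a^5*ev b - ev a^6 = 0"
    using arg_cong[OF T, of ev] unfolding T_def by (simp add: ev.h_simps)
  moreover have "(ev b)^6 - 3*ev a*ev b^5 + 3*ev a^2*ev b^4 + 9*ev a^3*ev b^3 - 3*ev a^4*ev b^2 + 3*ev a^5*ev b - ev a^6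
      = poly (sextic 1 1) (ev a / ev b) * ev b ^ 6"
    using b1 by (simp add: sextic_def field_simps eval_nat_numeral)
  ultimately show False using b1 sextic_no_rational_root by simp
qed

subsection \<open>The quintic factor over the field of the parameter\<close>

definition quintic :: "'a :: comm_ring_1 \<Rightarrow> 'a \<Rightarrow> 'a poly" where
  "quintic x z = [:x^3 * z^2, x^3 * (z - 3*z^2), x^3 * (3*z^2 - 3*z + 1),
     z^3 * (3 - 3*z + z^2), z^3 * (z - 3), z^3:]"

lemma (in rhom) map_poly_quintic: "map_poly h (quintic x y) = quintic (h x) (h y)"
  by (simp add: quintic_def map_poly_pCons h_simps)

lemma sextic_quintic:
  assumes "9 * h * z ^ 3 = - ((1 - z) ^ 3 * (z ^ 3 + x ^ 3))"
  shows "z ^ 3 * poly (sextic x h) w = (z - w) * poly (quintic x z) w"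
proof -
  have "z ^ 3 * poly (sextic x h) w = z^3 * ((1 - w) ^ 3 * (w ^ 3 + x ^ 3)) + (9 * h * z ^ 3) * w^3"
    by (simp add: poly_sextic algebra_simps)
  also have "\<dots> = (z - w) * poly (quintic x z) w"
    unfolding assms by (simp add: quintic_def algebra_simps eval_nat_numeral)
  finally show ?thesis .
qed

text \<open>The type that models Q[x,H] is reused for Q[x,z], its outer variable now standing for
  \<open>z\<close>. Accordingly, in the field of the parameter \<open>hK\<close> denotes
  \<open>z\<close>, and \<open>H\<close> becomes the fraction \<open>hz\<close> below.\<close>

abbreviation xD :: "rat poly poly" where "xD \<equiv> [:[:0, 1:]:]"
abbreviation zD :: "rat poly poly" where "zD \<equiv> [:0, 1:]"

text \<open>The two elements are coefficients of the quintic, of degrees 5 and 2 in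
  \<open>w\<close>. Their coprimality shows that the quintic is primitive, as required for the Gauss
  lemma.\<close>

lemma no_common_constant_factor:
  assumes "d dvd zD ^ 3" "d dvd xD ^ 3 * (3 * zD ^ 2 - 3 * zD + 1)"
  shows "is_unit d"
proof -
  have 1: "coprime zD xD"
  proof (rule coprimeI)
    fix e :: "rat poly poly" assume e: "e dvd zD" "e dvd xD"
    have "degree e = 0" using dvd_imp_degree_le[OF e(2)] by simp
    then obtain k where k: "e = [:k:]" by (auto elim: degree_eq_zeroE)
    have "k dvd coeff zD 1" using e(1) unfolding k const_poly_dvd_iff by blast
    thus "is_unit e" by (simp add: k is_unit_const_poly_iff)
  qed
  have 2: "coprime zD (3 * zD ^ 2 - 3 * zD + 1)"
  proof (rule coprimeI)
    fix e :: "rat poly poly" assume e: "e dvd zD" "e dvd 3 * zD ^ 2 - 3 * zD + 1"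
    have "1 = (3 * zD ^ 2 - 3 * zD + 1) - zD * (3 * zD - 3)"
      by (simp add: algebra_simps power2_eq_square)
    thus "is_unit e" using e by (metis dvd_diff dvd_mult2)
  qed
  have "coprime (zD ^ 3) (xD ^ 3 * (3 * zD ^ 2 - 3 * zD + 1))"
    using 1 2 by (simp del: power_Suc add: coprime_mult_right_iff)
  thus ?thesis using assms by (meson coprime_common_divisor)
qed

text \<open>The product is \<open>x^3 A(w) + C(w)\<close> with outer variable \<open>x\<close>. A
  factor \<open>\<alpha> x + \<beta>\<close> forces \<open>\<alpha>^3 C = \<beta>^3 A\<close>, which
  is impossible at a point where \<open>C\<close> vanishes to order 1 and \<open>A\<close> does not
  vanish, since the two orders would differ modulo 3.\<close>

lemma quintic_cubic_no_linear_factor: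
  fixes R S :: "complex poly poly"
  assumes "R * S = [:[:0, 0, 0, 8, - 8, 8:], 0, 0, [:4, - 10, 7:]:]"
  shows "degree R \<noteq> 1"
proof
  assume R1: "degree R = 1"
  define A where "A = [:4, - 10, 7 :: complex:]"
  define C where "C = [:0, 0, 0, 8, - 8, 8 :: complex:]"
  have RS: "R * S = [:C, 0, 0, A:]" using assms by (simp add: A_def C_def)
  have A0: "A \<noteq> 0" by (simp add: A_def)
  have "degree (R * S) = 3" using A0 by (simp add: RS)
  moreover have "R \<noteq> 0" "S \<noteq> 0" using RS A0 by auto
  ultimately have S2: "degree S = 2" using R1 by (simp add: degree_mult_eq)
  define \<beta> \<alpha> s0 s1 s2 where "\<beta> = coeff R 0" "\<alpha> = coeff R 1"
    "s0 = coeff S 0" "s1 = coeff S 1" "s2 = coeff S 2"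
  note defs = this
  have R: "R = [:\<beta>, \<alpha>:]"
    using R1 by (intro poly_eqI) (auto simp: defs coeff_pCons coeff_eq_0 split: nat.splits)
  have S: "S = [:s0, s1, s2:]"
    using S2 by (intro poly_eqI)
      (auto simp: defs coeff_pCons coeff_eq_0 numeral_2_eq_2 split: nat.splits)
  have eqs: "\<beta> * s0 = C" "\<beta> * s1 + \<alpha> * s0 = 0" "\<beta> * s2 + \<alpha> * s1 = 0" "\<alpha> * s2 = A"
    using RS by (simp_all add: R S algebra_simps)
  have "\<alpha> ^ 3 * C = \<alpha>^2 * \<beta> * (\<alpha> * s0)" by (simp add: eqs(1)[symmetric] eval_nat_numeral)
  also have "\<alpha> * s0 = - (\<beta> * s1)" using eqs(2) by (simp add: add_eq_0_iff)
  also have "\<alpha>^2 * \<beta> * (- (\<beta> * s1)) = \<alpha> * \<beta>^2 * (- (\<alpha> * s1))" by (simp add: eval_nat_numeral)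
  also have "- (\<alpha> * s1) = \<beta> * s2" using eqs(3) by (simp add: add_eq_0_iff)
  also have "\<alpha> * \<beta>^2 * (\<beta> * s2) = \<beta> ^ 3 * A" by (simp add: eqs(4)[symmetric] eval_nat_numeral)
  finally have eq: "\<alpha> ^ 3 * C = \<beta> ^ 3 * A" .
  \<comment> \<open>\<open>C\<close> is \<open>8 w^3 (w^2 - w + 1)\<close>. A primitive sixth root
    of unity is a simple zero of it, and \<open>A\<close> takes the value
    \<open>-3 (\<nu> + 1)\<close> there.\<close>
  obtain \<nu> :: complex where "poly [:1, - 1, 1:] \<nu> = 0"
    using alg_closed_imp_poly_has_root[of "[:1, - 1, 1 :: complex:]"] by auto
  hence \<nu>: "\<nu> ^ 2 = \<nu> - 1" by (simp add: algebra_simps power2_eq_square)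
  have \<nu>0: "\<nu> \<noteq> 0" using \<nu> by auto
  have \<nu>1: "\<nu> \<noteq> 1 - \<nu>"
  proof
    assume "\<nu> = 1 - \<nu>"
    hence "2 * \<nu> = 1" by (simp add: algebra_simps)
    hence "\<nu> = 1 / 2" by (simp add: field_simps)
    show False using \<nu> unfolding \<open>\<nu> = 1 / 2\<close> by (simp add: power2_eq_square)
  qed
  define C' where "C' = [:0, 0, 0, 8:] * [:\<nu> - 1, 1:]"
  have "\<nu> * (\<nu> * 8) = \<nu>^2 * 8" by (simp add: power2_eq_square)
  hence "\<nu> * (\<nu> * 8) = \<nu> * 8 - 8" by (simp add: \<nu> left_diff_distrib)
  hence CC: "C = [:- \<nu>, 1:] * C'" by (simp add: C_def C'_def algebra_simps)
  have "poly C' \<nu> \<noteq> 0" using \<nu>0 \<nu>1 by (simp add: C'_def)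
  hence oC': "order \<nu> C' = 0" by (rule order_0I)
  have C0: "C \<noteq> 0" by (simp add: C_def)
  have oC: "order \<nu> C = 1"
    using C0 order_power_n_n[of \<nu> 1] oC' unfolding CC by (subst order_mult) auto
  have "poly A \<nu> = 4 - 10 * \<nu> + 7 * \<nu>^2" by (simp add: A_def algebra_simps power2_eq_square)
  hence "poly A \<nu> = - 3 * (\<nu> + 1)" by (simp add: \<nu> algebra_simps)
  moreover have "\<nu> + 1 \<noteq> 0"
  proof
    assume "\<nu> + 1 = 0"
    hence "\<nu> = - 1" by (simp add: add_eq_0_iff2)
    thus False using \<nu> by simp
  qed
  ultimately have "poly A \<nu> \<noteq> 0" by (simp only: mult_eq_0_iff) simp
  hence oA: "order \<nu> A = 0" by (rule order_0I)
  have nz: "\<alpha> \<noteq> 0" "\<beta> \<noteq> 0" using eqs A0 C0 by auto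
  have o3: "order \<nu> (p ^ 3) = 3 * order \<nu> p" if "p \<noteq> 0" for p :: "complex poly"
    using that by (simp add: eval_nat_numeral order_mult)
  have "order \<nu> (\<alpha> ^ 3 * C) = 3 * order \<nu> \<alpha> + 1" using nz C0 by (simp add: order_mult o3 oC del: power_Suc)
  moreover have "order \<nu> (\<beta> ^ 3 * A) = 3 * order \<nu> \<beta>" using nz A0 by (simp add: order_mult o3 oA)
  ultimately have "3 * order \<nu> \<alpha> + 1 = 3 * order \<nu> \<beta>" using eq by simp
  thus False by presburger
qed

lemma degree_quintic [simp]: "z \<noteq> 0 \<Longrightarrow> degree (quintic x (z :: 'a :: idom)) = 5"
  by (simp add: quintic_def)

lemma coeff_quintic:
  "coeff (quintic x z) 2 = x ^ 3 * (3 * z ^ 2 - 3 * z + 1)" "coeff (quintic x z) 5 = z ^ 3"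
  by (simp_all add: quintic_def coeff_pCons numeral_2_eq_2 eval_nat_numeral)

text \<open>Setting \<open>z = 2\<close> makes the quintic a polynomial \<open>x\<^sup>3 A(w) + C(w)\<close>. A factor of degree 0 in \<open>x\<close>
  divides both \<open>A\<close> and \<open>C\<close>, which are coprime; a factor of degree 1 in \<open>x\<close> makes \<open>C / A\<close> a cube.\<close>

lemma irreducible_quintic: "irreducible (fract_poly (quintic xD zD))"
proof -
  define \<kappa> :: "rat poly poly \<Rightarrow> complex poly poly"
    where "\<kappa> d = map_poly (\<lambda>c. [:of_rat c:]) (poly d [:2:])" for d
  have rat: "rhom (\<lambda>c. [:of_rat c :: complex:])"
    by unfold_locales (auto simp: of_rat_add of_rat_mult one_pCons)
  have ev2: "rhom (\<lambda>d. poly d [:2 :: rat:])" by unfold_locales auto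
  have \<kappa>: "rhom \<kappa>"
    unfolding \<kappa>_def using rhom_comp[OF ev2 rhom.rhom_map_poly[OF rat]] .
  interpret \<kappa>: rhom \<kappa> by (rule \<kappa>)
  \<comment> \<open>Besides setting \<open>z = 2\<close> this exchanges the roles of the variables:
    the result is a polynomial in \<open>x\<close> whose coefficients are polynomials in
    \<open>w\<close>.\<close>
  define \<psi> where "\<psi> r = poly (map_poly \<kappa> r) [:[:0, 1:]:]" for r
  interpret \<psi>: rhom \<psi> unfolding \<psi>_def by (rule \<kappa>.rhom_eval)
  define ev0 :: "rat poly poly \<Rightarrow> complex" where "ev0 d = of_rat (poly (poly d [:2:]) 0)" for d
  interpret ev0: rhom ev0 unfolding ev0_def by unfold_locales (auto simp: of_rat_add of_rat_mult)
  have eval0: "poly (\<psi> r) 0 = map_poly ev0 r" for r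
  proof (induction r)
    case (pCons d r)
    have "poly (\<kappa> d) 0 = [:ev0 d:]"
      by (simp add: \<kappa>_def ev0_def poly_0_coeff_0 coeff_map_poly)
    thus ?case using pCons.IH by (simp add: \<psi>_def \<kappa>.map_poly_pCons ev0.map_poly_pCons)
  qed (simp add: \<psi>_def)
  define q where "q = quintic xD zD"
  have "\<kappa> xD = [:0, 1:]" by (simp add: \<kappa>_def rhom.map_poly_pCons[OF rat] one_pCons)
  moreover have "\<kappa> zD = 2" by (simp add: \<kappa>_def rhom.map_poly_pCons[OF rat] numeral_poly)
  ultimately have \<psi>q: "\<psi> q = [:[:0, 0, 0, 8, - 8, 8:], 0, 0, [:4, - 10, 7:]:]"
    unfolding \<psi>_def q_def \<kappa>.map_poly_quintic
    by (simp add: quintic_def eval_nat_numeral numeral_poly algebra_simps one_pCons)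
  have degq: "degree q = 5" by (simp add: q_def)
  have q0: "q \<noteq> 0" using degq by auto
  \<comment> \<open>The leading coefficient of \<open>r\<close> in \<open>w\<close> divides
    \<open>z^3\<close>, so its value at \<open>z = 2\<close>, \<open>x = 0\<close> is nonzero and
    the degree in \<open>w\<close> is preserved there. If the specialised \<open>r\<close> did not
    involve \<open>x\<close> while having positive degree in \<open>w\<close>, it would supply a
    common zero of \<open>A\<close> and \<open>C\<close>.\<close>
  have deg0: "degree r = 0" if rs: "q = r * s" and d: "degree (\<psi> r) = 0" for r s
  proof (rule ccontr)
    assume n0: "degree r \<noteq> 0"
    have "lead_coeff r * lead_coeff s = zD ^ 3"
      using arg_cong[OF rs, of lead_coeff] by (simp add: lead_coeff_mult q_def quintic_def)
    hence "ev0 (lead_coeff r) * ev0 (lead_coeff s) = ev0 (zD ^ 3)" by (metis ev0.h_mult)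
    also have "\<dots> \<noteq> 0" by (simp add: ev0.h_power) (simp add: ev0_def)
    finally have "ev0 (lead_coeff r) \<noteq> 0" by auto
    hence dr: "degree (map_poly ev0 r) = degree r" by (rule map_poly_degree_eq)
    obtain r0 where r0: "\<psi> r = [:r0:]" using d by (auto elim: degree_eq_zeroE)
    have "degree r0 > 0" using eval0[of r] dr n0 by (simp add: r0)
    then obtain \<nu> where \<nu>: "poly r0 \<nu> = 0" using alg_closed_imp_poly_has_root by blast
    have "[:r0:] dvd \<psi> q" unfolding rs \<psi>.h_mult r0 by (rule dvd_triv_left)
    hence c: "r0 dvd coeff (\<psi> q) n" for n by (simp add: const_poly_dvd_iff)
    have z: "poly (coeff (\<psi> q) n) \<nu> = 0" for n using c[of n] \<nu> by (auto elim!: dvdE)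
    have A: "4 - 10 * \<nu> + 7 * \<nu>^2 = 0" using z[of 3]
      unfolding \<psi>q by (simp add: eval_nat_numeral algebra_simps)
    have "8 * \<nu>^3 * (\<nu>^2 - \<nu> + 1) = 0" using z[of 0]
      unfolding \<psi>q by (simp add: eval_nat_numeral algebra_simps)
    moreover have "\<nu> \<noteq> 0" using A by auto
    ultimately have "\<nu>^2 - \<nu> + 1 = 0" by simp
    moreover have "\<nu>^2 = (\<nu>^2 - \<nu> + 1) + (\<nu> - 1)" by simp
    ultimately have B: "\<nu>^2 = \<nu> - 1" by simp
    have "- 3 * (\<nu> + 1) = 0" using A unfolding B by (simp add: algebra_simps)
    hence "\<nu> = - 1" unfolding mult_eq_0_iff by (simp add: add_eq_0_iff2)
    thus False using B by simp
  qed
  \<comment> \<open>The degrees in \<open>x\<close> of the two specialised factors add up to 3 and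
    neither is 1, so one of them is 0.\<close>
  have split: "degree r = 0 \<or> degree s = 0" if rs: "q = r * s" for r s
  proof -
    have m: "\<psi> r * \<psi> s = \<psi> q" unfolding rs \<psi>.h_mult ..
    have "\<psi> q \<noteq> 0" "degree (\<psi> q) = 3" unfolding \<psi>q by simp_all
    moreover from this have "\<psi> r \<noteq> 0" "\<psi> s \<noteq> 0" using m by auto
    ultimately have "degree (\<psi> r) + degree (\<psi> s) = 3"
      using m degree_mult_eq[of "\<psi> r" "\<psi> s"] by simp
    moreover have "degree (\<psi> r) \<noteq> 1"
      using quintic_cubic_no_linear_factor[of "\<psi> r" "\<psi> s"] m \<psi>q by simp
    moreover have "degree (\<psi> s) \<noteq> 1"
      using quintic_cubic_no_linear_factor[of "\<psi> s" "\<psi> r"] m \<psi>q by (simp add: mult.commute)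
    ultimately have "degree (\<psi> r) = 0 \<or> degree (\<psi> s) = 0" by linarith
    thus ?thesis using deg0[OF rs] deg0[of s r] rs by (auto simp: mult.commute)
  qed
  have const: "r dvd 1" if rs: "r dvd q" and d: "degree r = 0" for r
  proof -
    obtain k where k: "r = [:k:]" using d by (auto elim: degree_eq_zeroE)
    have c: "k dvd coeff q n" for n using rs by (simp add: k const_poly_dvd_iff)
    have "k dvd zD ^ 3" using c[of 5] by (simp add: q_def coeff_quintic)
    moreover have "k dvd xD ^ 3 * (3 * zD ^ 2 - 3 * zD + 1)"
      using c[of 2] by (simp only: q_def coeff_quintic)
    ultimately have "is_unit k" by (rule no_common_constant_factor)
    thus ?thesis by (simp add: k is_unit_const_poly_iff)
  qed
  have "irreducible q"
  proof (rule irreducibleI)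
    show "\<not> q dvd 1" using degq by (auto simp: is_unit_poly_iff)
    fix r s assume rs: "q = r * s"
    thus "r dvd 1 \<or> s dvd 1" using split[OF rs] const[of r] const[of s] by auto
  qed (fact q0)
  thus ?thesis using nonconst_poly_irreducible_iff[of q] degq by (simp add: q_def)
qed

lemma irreducible_degree:
  fixes q :: "'a :: field poly"
  assumes "irreducible q"
  shows "\<forall>r s. q = r * s \<longrightarrow> degree r = 0 \<or> degree s = 0"
  using irreducibleD[OF assms] by (fastforce simp: is_unit_poly_iff)

text \<open>An irreducible polynomial is, up to a constant, the minimal polynomial of each of its
  roots. This is what later excludes a quartic relation for a root of the quintic.\<close>

lemma irreducible_min_degree:
  fixes q w :: "'m :: field poly"
  assumes irr: "irreducible q" and b: "b \<in> rts to_ac q" "b \<in> rts to_ac w" and w: "w \<noteq> 0"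
  shows "degree q \<le> degree w"
proof -
  interpret B: subfld "range to_ac :: 'm alg_closure set" by (rule subfld_range_to_ac)
  interpret t: partial_hom UNIV "to_ac :: 'm \<Rightarrow> _" by (rule partial_hom_to_ac)
  have P: "B.pol (map_poly to_ac p)" for p using pol_range_to_ac_iff by blast
  have q0: "q \<noteq> 0" using irr by auto
  obtain m where m: "B.minimal b m"
    using B.minimal_exists[OF P[of w]] b w by (auto simp: t.map_poly_eq_0_iff)
  have le: "degree m \<le> degree w"
    using m P[of w] b w by (auto simp: B.minimal_def t.map_poly_eq_0_iff t.degree_map_poly
      dest!: spec[of _ "map_poly to_ac w"])
  obtain r where r: "B.pol r" "map_poly to_ac q = m * r"
    using B.minimal_dvd[OF m P[of q]] b by blast
  obtain m0 r0 where mr: "m = map_poly to_ac m0" "r = map_poly to_ac r0"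
    using r(1) m unfolding B.minimal_def pol_range_to_ac_iff by blast
  have "map_poly to_ac (q - m0 * r0) = 0"
    using r(2) by (simp add: mr t.map_poly_mult t.map_poly_diff)
  hence qmr: "q = m0 * r0" by (simp add: t.map_poly_eq_0_iff)
  have dm: "degree m = degree m0" by (simp add: mr t.degree_map_poly)
  hence "degree r0 = 0"
    using irreducible_degree[OF irr, rule_format, OF qmr] B.degree_minimal_pos[OF m] by simp
  hence "degree q = degree m0" using q0 qmr by (simp add: degree_mult_eq)
  thus ?thesis using le dm by simp
qed

subsection \<open>Adjoining one root: the field of the parameter\<close>

text \<open>The relation between \<open>H\<close> and \<open>z\<close> is linear in
  \<open>H\<close>; this is its solution in Q(x,z), with \<open>hK\<close> playing the role of
  \<open>z\<close>.\<close>

definition hz :: "rat poly poly fract" where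
  "hz = - ((1 - hK) ^ 3 * (hK ^ 3 + xK ^ 3)) / (9 * hK ^ 3)"

lemma hz_eq: "9 * hz * hK ^ 3 = - ((1 - hK) ^ 3 * (hK ^ 3 + xK ^ 3))"
  by (simp add: hz_def)

definition param_hom :: "rat poly poly \<Rightarrow> rat poly poly fract" where
  "param_hom a = poly (map_poly (\<lambda>c. to_fract [:c:]) a) hz"

lemma rhom_const_fract: "rhom (\<lambda>c. to_fract [:c:])"
  using rhom_comp[OF rhom_const rhom_to_fract] .

lemma rhom_param_hom: "rhom param_hom"
  unfolding param_hom_def by (rule rhom.rhom_eval[OF rhom_const_fract])

text \<open>Clearing the denominator \<open>9 z\<^sup>3\<close> of \<open>hz\<close> and setting \<open>z = 0\<close> isolates the leading coefficient.\<close>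

lemma param_hom_eq_0D:
  assumes "param_hom a = 0"
  shows "a = 0"
proof (rule ccontr)
  assume "a \<noteq> 0"
  define N where "N = - ((1 - zD) ^ 3 * (zD ^ 3 + xD ^ 3))"
  define E where "E = 9 * zD ^ 3"
  interpret j: rhom "\<lambda>c. to_fract [:c:] :: rat poly poly fract" by (rule rhom_const_fract)
  interpret t: rhom "to_fract :: rat poly poly \<Rightarrow> _" by (rule rhom_to_fract)
  have E0: "to_fract E \<noteq> 0" by (simp add: E_def)
  have NE: "hz * to_fract E = to_fract N"
    using hz_eq by (simp add: E_def N_def t.h_power mult_ac del: to_fract_eq_iff)
  have ev: "poly E 0 = 0" "poly N 0 = - ([:0, 1:] ^ 3)" by (simp_all add: E_def N_def)
  have "\<exists>U. param_hom a * to_fract E ^ degree a = to_fract U \<and>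
      poly U 0 = lead_coeff a * (- ([:0, 1:] ^ 3)) ^ degree a"
    using \<open>a \<noteq> 0\<close>
  proof (induction a)
    case (pCons a0 a)
    show ?case
    proof (cases "a = 0")
      case True
      thus ?thesis by (intro exI[of _ "[:a0:]"]) (simp add: param_hom_def j.map_poly_pCons)
    next
      case False
      then obtain U where U: "param_hom a * to_fract E ^ degree a = to_fract U"
        "poly U 0 = lead_coeff a * (- ([:0, 1:] ^ 3)) ^ degree a" using pCons.IH by blast
      have "param_hom (pCons a0 a) * to_fract E ^ Suc (degree a)
          = to_fract [:a0:] * to_fract E ^ Suc (degree a)
            + (hz * to_fract E) * (param_hom a * to_fract E ^ degree a)"
        by (simp add: param_hom_def j.map_poly_pCons algebra_simps)
      also have "\<dots> = to_fract ([:a0:] * E ^ Suc (degree a) + N * U)"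
        unfolding U NE by (simp only: t.h_simps)
      finally show ?thesis using False
        by (intro exI[of _ "[:a0:] * E ^ Suc (degree a) + N * U"]) (simp add: ev U(2))
    qed
  qed simp
  then obtain U where "to_fract U = 0" "poly U 0 = lead_coeff a * (- ([:0, 1:] ^ 3)) ^ degree a"
    using assms by auto
  thus False using \<open>a \<noteq> 0\<close> by simp
qed

definition param_emb :: "rat poly poly fract \<Rightarrow> rat poly poly fract" where
  "param_emb = fract_lift param_hom"

lemma rhom_param_emb: "rhom param_emb"
  unfolding param_emb_def using rhom_param_hom param_hom_eq_0D by (rule rhom_fract_lift)

lemma param_emb_xK: "param_emb xK = xK" and param_emb_hK: "param_emb hK = hz"
  using fract_lift_to_fract[OF rhom_param_hom param_hom_eq_0D]
  by (simp_all add: param_emb_def param_hom_def rhom.map_poly_pCons[OF rhom_const_fract] flip: one_pCons)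

text \<open>Without a root in the base field, the minimal polynomial of a root has degree at least
  2; in characteristic 0 it is separable, so it has a second root to which the first can be sent.
  The polynomial \<open>p\<close> itself need not be irreducible, and merely moving \<open>z\<close>
  is what \<open>doubly_transitive\<close> asks for.\<close>

lemma aut_moves_root:
  fixes p :: "'k :: field_char_0 poly"
  assumes p: "p \<noteq> 0" and z: "z \<in> rts to_ac p" and no: "\<And>r. poly p r \<noteq> 0"
  shows "\<exists>\<sigma>. aut p \<sigma> \<and> \<sigma> z \<noteq> z"
proof -
  have hid: "partial_hom UNIV (\<lambda>x :: 'k. x)" by (rule partial_hom_id[OF subfld_UNIV])
  have mid: "map_poly (\<lambda>x. x) q = q" for q :: "'k poly" by (simp add: map_poly_idI)
  obtain \<iota> where \<iota>: "bij_betw \<iota> (rts to_ac p) (rts to_ac p)"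
    and *: "\<forall>q a b. q \<noteq> 0 \<and> (\<forall>r s. q = r * s \<longrightarrow> degree r = 0 \<or> degree s = 0) \<and>
        a \<in> rts to_ac q \<and> b \<in> rts to_ac q \<longrightarrow>
        (\<exists>\<sigma>. aut p \<sigma> \<and> (\<forall>z\<in>rts to_ac p. \<iota> z \<in> range to_ac \<longrightarrow> \<sigma> z = z) \<and>
             (\<forall>z\<in>rts to_ac p. \<iota> z = a \<longrightarrow> \<iota> (\<sigma> z) = b))"
    using galois_transfer[OF hid p] unfolding mid by (elim exE conjE)
  have tr: "\<exists>\<sigma>. aut p \<sigma> \<and> (\<forall>z\<in>rts to_ac p. \<iota> z = a \<longrightarrow> \<iota> (\<sigma> z) = b)"
    if "q \<noteq> 0" "\<forall>r s. q = r * s \<longrightarrow> degree r = 0 \<or> degree s = 0" "a \<in> rts to_ac q" "b \<in> rts to_ac q"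
    for q a b
    using *[rule_format, of q a b] that by blast
  define a where "a = \<iota> z"
  have a: "a \<in> rts to_ac p" using \<iota> z unfolding a_def bij_betw_def by blast
  interpret B: subfld "range to_ac :: 'k alg_closure set" by (rule subfld_range_to_ac)
  interpret t: partial_hom UNIV "to_ac :: 'k \<Rightarrow> _" by (rule partial_hom_to_ac)
  have P: "B.pol (map_poly to_ac q)" for q using pol_range_to_ac_iff by blast
  obtain m where m: "B.minimal a m"
    using B.minimal_exists[OF P[of p]] a p by (auto simp: t.map_poly_eq_0_iff)
  hence m': "B.pol m" "m \<noteq> 0" "poly m a = 0"
    and le: "\<And>q. B.pol q \<Longrightarrow> q \<noteq> 0 \<Longrightarrow> poly q a = 0 \<Longrightarrow> degree m \<le> degree q"
    unfolding B.minimal_def by auto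
  obtain m0 where m0: "m = map_poly to_ac m0" using m'(1) pol_range_to_ac_iff by blast
  have m00: "m0 \<noteq> 0" using m'(2) m0 by auto
  have irr: "\<forall>r s. m0 = r * s \<longrightarrow> degree r = 0 \<or> degree s = 0"
  proof (intro allI impI)
    fix r s assume rs: "m0 = r * s"
    have nz: "r \<noteq> 0" "s \<noteq> 0" using rs m00 by auto
    have d: "degree m = degree r + degree s"
      using nz by (simp add: m0 rs t.degree_map_poly degree_mult_eq)
    have "poly (map_poly to_ac r) a = 0 \<or> poly (map_poly to_ac s) a = 0"
      using m'(3) by (simp add: m0 rs t.map_poly_mult)
    hence "degree m \<le> degree r \<or> degree m \<le> degree s"
      using le[OF P, of r] le[OF P, of s] nz by (auto simp: t.map_poly_eq_0_iff t.degree_map_poly)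
    thus "degree r = 0 \<or> degree s = 0" using d by auto
  qed
  \<comment> \<open>The value of the cofactor \<open>s\<close> at \<open>a\<close> is the derivative
    of \<open>m\<close> there, nonzero by minimality of \<open>m\<close>. So any root
    \<open>b\<close> of \<open>s\<close> differs from \<open>a\<close>.\<close>
  obtain s where s: "m = [:- a, 1:] * s" using m'(3) by (auto simp: poly_eq_0_iff_dvd elim: dvdE)
  have dpos: "degree m > 0" by (rule B.degree_minimal_pos[OF m])
  have "B.pol (pderiv m)"
    unfolding m0 pol_range_to_ac_iff
    by (intro exI[of _ "pderiv m0"] poly_eqI) (simp add: coeff_pderiv coeff_map_poly)
  moreover have "degree (pderiv m) < degree m" "pderiv m \<noteq> 0"
    using dpos by (auto simp: degree_pderiv pderiv_eq_0_iff)
  ultimately have "poly (pderiv m) a \<noteq> 0" using le by fastforce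
  moreover have "poly (pderiv m) a = poly s a" unfolding s pderiv_mult by (simp add: pderiv_pCons)
  ultimately have sa: "poly s a \<noteq> 0" by simp
  have "degree s > 0"
  proof (rule ccontr)
    assume "\<not> ?thesis"
    then obtain k where k: "s = [:k:]" by (auto elim: degree_eq_zeroE)
    have "m = [:- a * k, k:]" unfolding s k by simp
    hence "k \<in> range to_ac" "- a * k \<in> range to_ac" "k \<noteq> 0"
      using m'(1) sa unfolding k by simp_all
    hence "- ((- a * k) * inverse k) \<in> range to_ac" by (metis B.minus_in B.mult_in B.inverse_in)
    moreover have "- ((- a * k) * inverse k) = a" using \<open>k \<noteq> 0\<close> by (simp add: field_simps)
    ultimately have "a \<in> range to_ac" by (simp only:)
    then obtain r where r: "a = to_ac r" by blast
    have "to_ac (poly p r) = 0" using a by (simp add: r t.f_poly)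
    thus False using no by simp
  qed
  then obtain b where b: "poly s b = 0" using alg_closed_imp_poly_has_root by blast
  have "b \<in> rts to_ac m0" "a \<in> rts to_ac m0" using b m'(3) by (auto simp: s simp flip: m0)
  from tr[OF m00 irr this(2,1)] obtain \<sigma> where "aut p \<sigma>" "\<iota> (\<sigma> z) = b"
    using z by (auto simp: a_def)
  moreover have "b \<noteq> a" using sa b by auto
  ultimately show ?thesis by (auto simp: a_def)
qed

abbreviation gK :: "rat poly poly fract poly" where "gK \<equiv> sextic xK hK"

text \<open>Over Q(x,z) the sextic has the root \<open>z\<close> itself, written \<open>hK\<close>.
  Being in the base field it is fixed by the transferred automorphisms, while the remaining roots
  satisfy the irreducible quintic and can be moved to one another.\<close>

lemma sextic_over_parameter:
  shows "\<exists>\<iota> z. partial_hom (splitting_field gK) \<iota> \<and> (\<forall>c. \<iota> (to_ac c) = to_ac (param_emb c)) \<and>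
     z \<in> rts to_ac gK \<and> \<iota> z = to_ac hK \<and>
     (\<forall>u\<in>rts to_ac gK - {z}. \<iota> u \<in> rts to_ac (quintic xK hK)) \<and>
     (\<forall>u\<in>rts to_ac gK - {z}. \<forall>v\<in>rts to_ac gK - {z}. \<exists>\<sigma>. aut gK \<sigma> \<and> \<sigma> z = z \<and> \<sigma> u = v)"
proof -
  let ?Z = "rts to_ac gK"
  have e: "partial_hom UNIV param_emb" by (simp add: partial_hom_UNIV_iff rhom_param_emb)
  have mp: "map_poly param_emb gK = sextic xK hz"
    by (simp only: rhom.map_poly_sextic[OF rhom_param_emb] param_emb_xK param_emb_hK)
  from galois_transfer[OF e sextic_nonzero, of xK hK] obtain \<iota> where
    \<iota>: "partial_hom (splitting_field gK) \<iota>" "\<forall>c. \<iota> (to_ac c) = to_ac (param_emb c)"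
      "bij_betw \<iota> ?Z (rts to_ac (sextic xK hz))"
    and tr: "\<forall>q a b. q \<noteq> 0 \<and> (\<forall>r s. q = r * s \<longrightarrow> degree r = 0 \<or> degree s = 0) \<and>
        a \<in> rts to_ac q \<and> b \<in> rts to_ac q \<longrightarrow>
        (\<exists>\<sigma>. aut gK \<sigma> \<and> (\<forall>z\<in>?Z. \<iota> z \<in> range to_ac \<longrightarrow> \<sigma> z = z) \<and> (\<forall>z\<in>?Z. \<iota> z = a \<longrightarrow> \<iota> (\<sigma> z) = b))"
    unfolding mp by (elim exE conjE) (rule that)
  define q where "q = quintic xK hK"
  have q: "q = fract_poly (quintic xD zD)"
    unfolding q_def rhom.map_poly_quintic[OF rhom_to_fract] ..
  have irr: "irreducible q" unfolding q by (rule irreducible_quintic)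
  have rel: "to_ac hK ^ 3 * poly (map_poly to_ac (sextic xK hz)) w
      = (to_ac hK - w) * poly (map_poly to_ac q) w" for w
    unfolding q_def rhom.map_poly_quintic[OF rhom_to_ac] rhom.map_poly_sextic[OF rhom_to_ac]
    by (rule sextic_quintic) (use arg_cong[OF hz_eq, of to_ac] in simp)
  have h0: "to_ac hK \<noteq> 0" by simp
  have "to_ac hK \<in> rts to_ac (sextic xK hz)" using rel[of "to_ac hK"] h0 by simp
  hence "to_ac hK \<in> \<iota> ` ?Z" unfolding bij_betw_imp_surj_on[OF \<iota>(3)] .
  then obtain z where z: "z \<in> ?Z" "\<iota> z = to_ac hK" by (elim imageE) (rule that, simp_all)
  have \<iota>inj: "\<iota> u = \<iota> v \<Longrightarrow> u = v" if "u \<in> ?Z" "v \<in> ?Z" for u v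
    using inj_onD[OF bij_betw_imp_inj_on[OF \<iota>(3)] _ that] .
  have rq: "\<iota> u \<in> rts to_ac q" if u: "u \<in> ?Z - {z}" for u
  proof -
    have "\<iota> u \<noteq> to_ac hK" using u z \<iota>inj[of u z] by auto
    moreover have "\<iota> u \<in> rts to_ac (sextic xK hz)" using bij_betw_apply[OF \<iota>(3), of u] u by simp
    ultimately show ?thesis using rel[of "\<iota> u"] by simp
  qed
  have "\<exists>\<sigma>. aut gK \<sigma> \<and> \<sigma> z = z \<and> \<sigma> u = v" if u: "u \<in> ?Z - {z}" and v: "v \<in> ?Z - {z}" for u v
  proof -
    have "q \<noteq> 0" using irr by auto
    from tr[THEN spec, THEN spec, THEN spec, THEN HOL.mp,
        OF conjI[OF this conjI[OF irreducible_degree[OF irr] conjI[OF rq[OF u] rq[OF v]]]]] obtain \<sigma> where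
      s: "aut gK \<sigma>" "\<forall>z\<in>?Z. \<iota> z \<in> range to_ac \<longrightarrow> \<sigma> z = z" "\<forall>z\<in>?Z. \<iota> z = \<iota> u \<longrightarrow> \<iota> (\<sigma> z) = \<iota> v"
      by blast
    have "\<sigma> z = z" using s(2) z by simp
    moreover have "\<sigma> u \<in> ?Z" using bij_betw_apply[OF aut_roots[OF s(1)], of u] u by simp
    moreover have "\<iota> (\<sigma> u) = \<iota> v" using s(3) u by simp
    ultimately have "\<sigma> u = v" using v \<iota>inj[of "\<sigma> u" v] by simp
    thus ?thesis using s(1) \<open>\<sigma> z = z\<close> by blast
  qed
  thus ?thesis using \<iota>(1,2) z rq unfolding q_def
    by - (rule exI[of _ \<iota>], rule exI[of _ z], intro conjI ballI, simp_all)
qed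

lemma sextic_doubly_transitive:
  assumes "a \<in> rts to_ac gK" "b \<in> rts to_ac gK" "a \<noteq> b"
    and "u \<in> rts to_ac gK" "v \<in> rts to_ac gK" "u \<noteq> v"
  shows "\<exists>\<sigma>. aut gK \<sigma> \<and> \<sigma> a = u \<and> \<sigma> b = v"
proof -
  interpret perm_group "rts to_ac gK" "root_perm gK ` Collect (aut gK)"
    by (rule perm_group_root_perm) simp
  obtain z where z: "z \<in> rts to_ac gK"
    and st: "\<And>u v. u \<in> rts to_ac gK - {z} \<Longrightarrow> v \<in> rts to_ac gK - {z} \<Longrightarrow> \<exists>\<sigma>. aut gK \<sigma> \<and> \<sigma> z = z \<and> \<sigma> u = v"
    using sextic_over_parameter by blast
  have rp: "root_perm gK \<sigma> w = \<sigma> w" if "w \<in> rts to_ac gK" for \<sigma> w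
    using that by (simp add: root_perm_def)
  have "\<exists>\<pi>\<in>root_perm gK ` Collect (aut gK). \<pi> a = u \<and> \<pi> b = v"
  proof (rule doubly_transitive[OF z])
    show "\<exists>\<pi>\<in>root_perm gK ` Collect (aut gK). \<pi> z = z \<and> \<pi> u = v"
      if "u \<in> rts to_ac gK - {z}" "v \<in> rts to_ac gK - {z}" for u v
      using st[OF that] rp[OF z] rp[of u] that by auto
    show "\<exists>\<pi>\<in>root_perm gK ` Collect (aut gK). \<pi> z \<noteq> z"
      using aut_moves_root[OF sextic_nonzero z] sextic_no_root rp[OF z] by auto
  qed (use assms in auto)
  thus ?thesis using rp assms by auto
qed

subsection \<open>The roots of \<open>P\<^sub>4\<close> in terms of the parameter\<close>

definition numer :: "'a :: comm_ring_1 \<Rightarrow> 'a poly" where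
  "numer x = [:3 * x ^ 3, - 6 * x ^ 3, 2 * x ^ 3 - 3 * x ^ 2 - 3 * x, 0, - 3, 2:]"

lemma (in rhom) map_poly_numer: "map_poly h (numer x) = numer (h x)"
  by (simp add: numer_def map_poly_pCons h_simps)

definition quartic :: "'a :: comm_ring_1 \<Rightarrow> 'a \<Rightarrow> 'a poly" where
  "quartic x z = [:- 3 * x ^ 3 * z, 6 * x ^ 3 * z - 3 * x ^ 3, 2 * z ^ 4 - 3 * z ^ 3, 2 * z ^ 3 - 3 * z ^ 2, 2 * z ^ 2:]"

lemma (in rhom) map_poly_quartic: "map_poly h (quartic x y) = quartic (h x) (h y)"
  by (simp add: quartic_def map_poly_pCons h_simps)

lemma numer_quartic: "w ^ 2 * poly (numer x) z - z ^ 2 * poly (numer x) w = (z - w) * poly (quartic x z) w"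
  by (simp add: numer_def quartic_def algebra_simps eval_nat_numeral)

text \<open>The hypothesis says that \<open>F\<close> takes the same value at \<open>u\<close> and
  \<open>v\<close>. Double transitivity moves the pair to one whose first member becomes the
  parameter; the second is then a root of the irreducible quintic and, by
  \<open>numer_quartic\<close>, also of a nonzero quartic.\<close>

lemma numer_separates_roots:
  assumes u: "u \<in> rts to_ac gK" and v: "v \<in> rts to_ac gK"
    and eq: "v ^ 2 * poly (numer (to_ac xK)) u = u ^ 2 * poly (numer (to_ac xK)) v"
  shows "u = v"
proof (rule ccontr)
  assume uv: "u \<noteq> v"
  obtain \<iota> z where \<iota>: "partial_hom (splitting_field gK) \<iota>" "\<And>c. \<iota> (to_ac c) = to_ac (param_emb c)"
    "z \<in> rts to_ac gK" "\<iota> z = to_ac hK" "\<forall>u\<in>rts to_ac gK - {z}. \<iota> u \<in> rts to_ac (quintic xK hK)"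
    using sextic_over_parameter by blast
  obtain w where w: "w \<in> rts to_ac gK" "w \<noteq> z"
    using u v uv by blast
  obtain \<sigma> where \<sigma>: "aut gK \<sigma>" "\<sigma> u = z" "\<sigma> v = w"
    using sextic_doubly_transitive[OF u v uv \<iota>(3) w(1)] w(2) by blast
  have h: "partial_hom (splitting_field gK) (\<lambda>x. \<iota> (\<sigma> x))"
    using \<sigma>(1) \<iota>(1) by (auto simp: aut_def intro: partial_hom_comp)
  interpret h: partial_hom "splitting_field gK" "\<lambda>x. \<iota> (\<sigma> x)" by fact
  have L: "u \<in> splitting_field gK" "v \<in> splitting_field gK"
    using u v roots_in_splitting_field[of gK] by auto
  have P: "h.pol (numer (to_ac xK))"
    unfolding rhom.map_poly_numer[OF rhom_to_ac, symmetric]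
    by (simp add: h.pol_def coeff_map_poly splitting_field_to_ac)
  have "map_poly (\<lambda>x. \<iota> (\<sigma> x)) (numer (to_ac xK)) = numer (to_ac xK)"
  proof -
    have "map_poly (\<lambda>x. \<iota> (\<sigma> x)) (map_poly to_ac (numer xK)) = map_poly to_ac (map_poly param_emb (numer xK))"
      using \<sigma>(1) rhom.h_0[OF rhom_param_emb]
      by (intro poly_eqI) (simp add: coeff_map_poly \<iota>(2) aut_def)
    thus ?thesis
      by (simp only: rhom.map_poly_numer[OF rhom_to_ac] rhom.map_poly_numer[OF rhom_param_emb] param_emb_xK)
  qed
  hence n: "\<iota> (\<sigma> (poly (numer (to_ac xK)) x)) = poly (numer (to_ac xK)) (\<iota> (\<sigma> x))"
    if "x \<in> splitting_field gK" for x
    using h.f_poly[OF P that] by simp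
  define b where "b = \<iota> w"
  have "b ^ 2 * poly (numer (to_ac xK)) (to_ac hK) = (to_ac hK) ^ 2 * poly (numer (to_ac xK)) b"
    using arg_cong[OF eq, of "\<lambda>x. \<iota> (\<sigma> x)"] L h.poly_in[OF P]
    by (simp add: power2_eq_square h.f_mult h.mult_in n \<sigma> \<iota>(4) b_def)
  hence "(to_ac hK - b) * poly (quartic (to_ac xK) (to_ac hK)) b = 0"
    using numer_quartic[of b "to_ac xK" "to_ac hK"] by simp
  moreover have "b \<noteq> to_ac hK"
  proof -
    interpret i: partial_hom "splitting_field gK" \<iota> by fact
    have "w \<in> splitting_field gK" "z \<in> splitting_field gK"
      using w \<iota>(3) roots_in_splitting_field[of gK] by auto
    thus ?thesis using i.f_eq_iff[of w z] w(2) by (simp add: b_def \<iota>(4))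
  qed
  ultimately have "poly (map_poly to_ac (quartic xK hK)) b = 0"
    by (simp add: rhom.map_poly_quartic[OF rhom_to_ac])
  moreover have "b \<in> rts to_ac (quintic xK hK)" using \<iota>(5) w by (simp add: b_def)
  moreover have "irreducible (quintic xK hK)"
    using irreducible_quintic unfolding rhom.map_poly_quintic[OF rhom_to_fract] .
  moreover have "quartic xK hK \<noteq> 0" by (simp add: quartic_def)
  ultimately have "degree (quintic xK hK) \<le> degree (quartic xK hK)"
    using irreducible_min_degree[of "quintic xK hK" b "quartic xK hK"] by simp
  thus False by (simp add: quartic_def)
qed

subsection \<open>Implicit functions in power series\<close>

lemma rhom_fps_const: "rhom fps_const"
  by unfold_locales auto

lemma rhom_fps_to_fls: "rhom fps_to_fls"
  by unfold_locales (auto simp: fls_times_fps_to_fls)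

lemma rhom_fps_nth_0: "rhom (\<lambda>f. fps_nth f 0)"
  by unfold_locales auto

lemma poly_fps_const_compose:
  fixes b :: "'a :: field fps"
  assumes "b $ 0 = 0"
  shows "poly (map_poly fps_const A) t oo b = poly (map_poly fps_const A) (t oo b)"
  by (induction A) (simp_all add: rhom.map_poly_pCons[OF rhom_fps_const] fps_compose_add_distrib
      fps_compose_mult_distrib[OF assms])

lemma poly_fps_const_nth:
  "poly (map_poly fps_const A) (fps_const a + fps_X) $ 0 = poly A a"
  "poly (map_poly fps_const A) (fps_const a + fps_X) $ Suc 0 = poly (pderiv A) (a :: 'a :: field)"
  by (induction A) (simp_all add: rhom.map_poly_pCons[OF rhom_fps_const] pderiv_pCons)

text \<open>Along \<open>z = a + s\<close> the equation reads \<open>t = - A(a+s) / B(a+s)\<close>.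
  The right-hand side is a series in \<open>s\<close> without constant term, and its linear
  coefficient is nonzero because \<open>a\<close> is a simple root, so it has a compositional
  inverse.\<close>

lemma pencil_root_exists:
  fixes A B :: "'a :: field poly"
  assumes "poly A a = 0" "poly B a \<noteq> 0" "poly (pderiv A) a \<noteq> 0"
  shows "\<exists>z. z $ 0 = a \<and> poly (map_poly fps_const A) z + fps_X * poly (map_poly fps_const B) z = 0"
proof -
  define t where "t = fps_const a + fps_X"
  define PA PB where "PA = poly (map_poly fps_const A) t" and "PB = poly (map_poly fps_const B) t"
  define F where "F = - PA * inverse PB"
  have c: "PA $ 0 = 0" "PA $ 1 \<noteq> 0" "PB $ 0 \<noteq> 0"
    using assms by (simp_all add: PA_def PB_def t_def poly_fps_const_nth)
  have F: "F $ 0 = 0" "F $ 1 \<noteq> 0" using c by (simp_all add: F_def)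
  have PA: "PA = - F * PB" using inverse_mult_eq_1[OF c(3)] by (simp add: F_def mult.assoc)
  define b where "b = fps_inv F"
  have b0: "b $ 0 = 0" by (simp add: b_def fps_inv_def)
  have Fb: "F oo b = fps_X" unfolding b_def by (rule fps_inv_right[OF F])
  have tb: "t oo b = fps_const a + b" using b0 by (simp add: t_def fps_compose_add_distrib)
  have "PA oo b = - fps_X * (PB oo b)"
    unfolding PA by (simp add: fps_compose_mult_distrib[OF b0] fps_compose_uminus Fb)
  thus ?thesis using b0
    by (intro exI[of _ "fps_const a + b"])
       (simp add: PA_def PB_def poly_fps_const_compose[OF b0] tb)
qed

lemma prod_linear_dvd:
  fixes p :: "'a :: idom poly"
  assumes "finite A" "\<And>a. a \<in> A \<Longrightarrow> poly p a = 0"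
  shows "(\<Prod>a\<in>A. [:- a, 1:]) dvd p"
  using assms
proof (induction A rule: finite_induct)
  case (insert a A)
  then obtain r where r: "p = (\<Prod>a\<in>A. [:- a, 1:]) * r" by (auto elim: dvdE)
  have "poly (\<Prod>a\<in>A. [:- a, 1:]) a \<noteq> 0"
    using insert.hyps by (auto simp: poly_prod)
  hence "poly r a = 0" using insert.prems[of a] by (auto simp: r)
  hence "[:- a, 1:] dvd r" by (simp add: poly_eq_0_iff_dvd)
  thus ?case using insert.hyps by (simp add: r mult.commute mult_dvd_mono del: mult_pCons_left mult_pCons_right)
qed simp

subsection \<open>A branch point of the sextic\<close>

text \<open>At \<open>x = -\<tau>\<^sup>4\<close> and \<open>9H = -(1 - \<tau>\<^sup>3)\<^sup>4\<close> two roots collide at \<open>\<tau>\<^sup>3\<close>, and they are conjugate over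
  the field of Laurent series in \<open>H\<close> at this point.\<close>

type_synonym k = "rat poly fract alg_closure"

text \<open>By \<open>pderiv_sextic\<close>, a multiple root \<open>w\<close> other than 0 and 1
  satisfies \<open>w^4 = - x^3\<close>. This curve is parametrised by \<open>w = tau^3\<close>,
  \<open>x = - tau^4\<close> with \<open>tau\<close> transcendental over the rationals, and the
  sextic equation then forces \<open>9 H = - (1 - w)^4\<close>.\<close>

definition tau :: k where "tau = to_ac (to_fract [:0, 1:])"
definition rho :: k where "rho = tau ^ 3"
definition xi :: k where "xi = - (tau ^ 4)"
definition H0 :: k where "H0 = - ((1 - rho) ^ 4) / 9"

definition emb :: "rat \<Rightarrow> k" where "emb c = to_ac (to_fract [:c:])"

lemma rhom_emb: "rhom emb"
  unfolding emb_def using rhom_comp[OF rhom_comp[OF rhom_const rhom_to_fract] rhom_to_ac] .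

lemmas emb_simps = rhom.map_poly_pCons[OF rhom_emb] rhom.h_minus[OF rhom_emb] rhom.h_numeral[OF rhom_emb]
  rhom.h_0[OF rhom_emb] rhom.h_1[OF rhom_emb]

lemma poly_tau_eq_0D:
  assumes "poly (map_poly emb p) tau = 0"
  shows "p = 0"
proof -
  have "poly (map_poly emb p) tau = to_ac (to_fract p)"
  proof (induction p)
    case (pCons c p)
    have e: "pCons c p = [:c:] + [:0, 1:] * p" by simp
    have "to_ac (to_fract (pCons c p)) = emb c + tau * to_ac (to_fract p)"
      unfolding tau_def emb_def by (subst e) (simp only: to_fract_add to_fract_mult to_ac_add to_ac_mult)
    thus ?case using pCons.IH by (simp add: emb_simps)
  qed simp
  thus ?thesis using assms by simp
qed

lemma xi_cube: "xi ^ 3 = - (rho ^ 4)"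
  by (simp add: xi_def rho_def flip: power_mult)

lemma tau_nz: "tau \<noteq> 0" and rho_nz: "rho \<noteq> 0" and rho_ne_1: "rho \<noteq> 1"
proof -
  show "tau \<noteq> 0" by (simp add: tau_def)
  thus "rho \<noteq> 0" by (simp add: rho_def)
  have "poly (map_poly emb [:- 1, 0, 0, 1:]) tau = rho - 1"
    by (simp add: rho_def emb_simps eval_nat_numeral)
  thus "rho \<noteq> 1" using poly_tau_eq_0D[of "[:- 1, 0, 0, 1:]"] by auto
qed

definition cofactor :: "k poly" where
  "cofactor = [:rho ^ 2, 2 * rho - 3 * rho ^ 2, 3 - 6 * rho + 3 * rho ^ 2, 2 * rho - 3, 1:]"

lemma sextic_branch: "sextic xi H0 = - ([:- rho, 1:] ^ 2 * cofactor)"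
proof -
  have "9 * H0 = - ((1 - rho) ^ 4)" by (simp add: H0_def)
  thus ?thesis
    unfolding sextic_def xi_cube
    by (simp add: cofactor_def algebra_simps eval_nat_numeral)
qed

text \<open>The combination with \<open>3\<close> times the sextic eliminates \<open>h\<close>, so
  that the critical roots are located without knowing \<open>h\<close>.\<close>

lemma pderiv_sextic:
  "w * poly (pderiv (sextic x h)) w = 3 * poly (sextic x h) w - 3 * (1 - w) ^ 2 * (w ^ 4 + (x :: 'a :: idom) ^ 3)"
  by (simp add: sextic_def pderiv_pCons algebra_simps eval_nat_numeral)

lemma cofactor_root_ne_rho: "poly cofactor rho \<noteq> 0"
proof -
  have "poly cofactor rho = 6 * rho ^ 2 * (1 - rho) ^ 2"
    by (simp add: cofactor_def algebra_simps eval_nat_numeral)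
  thus ?thesis using rho_nz rho_ne_1 by simp
qed

text \<open>A second multiple root \<open>w\<close> would satisfy both \<open>w^4 = rho^4\<close>
  and \<open>(1-w)^4 = (1-rho)^4\<close>. Since \<open>w \<noteq> rho\<close>, either
  \<open>w = - rho\<close> or \<open>w^2 = - rho^2\<close>, and each case yields a nontrivial
  algebraic equation for the transcendental \<open>tau\<close>.\<close>

lemma cofactor_roots_simple:
  assumes w: "poly cofactor w = 0"
  shows "poly (pderiv (sextic xi H0)) w \<noteq> 0"
proof
  assume d: "poly (pderiv (sextic xi H0)) w = 0"
  have s: "poly (sextic xi H0) w = 0" using w by (simp add: sextic_branch)
  have "(1 - w) ^ 2 * (w ^ 4 + xi ^ 3) = 0"
    using pderiv_sextic[of w xi H0] d s by simp
  moreover have "w \<noteq> 1"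
  proof
    assume "w = 1"
    hence "H0 = 0" using s by (simp add: poly_sextic)
    thus False using rho_ne_1 by (simp add: H0_def)
  qed
  ultimately have w4: "w ^ 4 = rho ^ 4" by (simp add: xi_cube)
  have wne: "w \<noteq> rho" using w cofactor_root_ne_rho by auto
  have "w \<noteq> 0" using w4 rho_nz by auto
  have "(1 - w) ^ 3 * (w ^ 3 - w ^ 4) = (1 - rho) ^ 4 * w ^ 3"
    using s by (simp add: poly_sextic xi_cube H0_def w4)
  hence "w ^ 3 * (1 - w) ^ 4 = w ^ 3 * (1 - rho) ^ 4"
    by (simp add: algebra_simps eval_nat_numeral)
  hence w14: "(1 - w) ^ 4 = (1 - rho) ^ 4" using \<open>w \<noteq> 0\<close> by simp
  have "(w - rho) * ((w + rho) * (w ^ 2 + rho ^ 2)) = w ^ 4 - rho ^ 4"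
    by (simp add: algebra_simps eval_nat_numeral)
  hence 1: "(w + rho) * (w ^ 2 + rho ^ 2) = 0" using w4 wne by simp
  \<comment> \<open>The difference of the two fourth-power conditions is only cubic in
    \<open>w\<close>; the factor \<open>w - rho\<close> is split off from it.\<close>
  have "(w - rho) * (- 4 + 6 * (w + rho) - 4 * (w ^ 2 + w * rho + rho ^ 2)) = ((1 - w) ^ 4 - w ^ 4) - ((1 - rho) ^ 4 - rho ^ 4)"
    by (simp add: algebra_simps eval_nat_numeral)
  hence "- 4 + 6 * (w + rho) - 4 * (w ^ 2 + w * rho + rho ^ 2) = 0" using w4 w14 wne by simp
  moreover have "- 4 + 6 * (w + rho) - 4 * (w ^ 2 + w * rho + rho ^ 2)
      = - 2 * (2 - 3 * (w + rho) + 2 * (w ^ 2 + w * rho + rho ^ 2))" by (simp add: algebra_simps)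
  ultimately have 2: "2 - 3 * (w + rho) + 2 * (w ^ 2 + w * rho + rho ^ 2) = 0" by (simp only: mult_eq_0_iff) simp
  show False
  proof (cases "w + rho = 0")
    case True
    hence "w = - rho" by (simp add: eq_neg_iff_add_eq_0)
    hence "2 * (1 + rho ^ 2) = 0" using 2 by (simp add: power2_eq_square)
    hence "1 + rho ^ 2 = 0" by (simp only: mult_eq_0_iff) simp
    hence "1 + tau ^ 6 = 0" by (simp add: rho_def flip: power_mult)
    moreover have "poly (map_poly emb [:1, 0, 0, 0, 0, 0, 1:]) tau = 1 + tau ^ 6"
      by (simp add: emb_simps eval_nat_numeral)
    ultimately show False using poly_tau_eq_0D[of "[:1, 0, 0, 0, 0, 0, 1:]"] by auto
  next
    case False
    hence w2: "w ^ 2 = - (rho ^ 2)" using 1 by (simp add: add_eq_0_iff2)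
    \<comment> \<open>With \<open>w^2 = - rho^2\<close> the second condition is linear in
      \<open>w\<close>. Squaring and replacing \<open>w^2\<close> once more eliminates
      \<open>w\<close>.\<close>
    have a: "w * (3 - 2 * rho) = 2 - 3 * rho" using 2 unfolding distrib_left w2 by (simp add: algebra_simps)
    have "(w * (3 - 2 * rho)) ^ 2 = w ^ 2 * (3 - 2 * rho) ^ 2" by (simp add: power_mult_distrib)
    hence "- (rho ^ 2) * (3 - 2 * rho) ^ 2 = (2 - 3 * rho) ^ 2" unfolding a w2 by simp
    hence "4 - 12 * rho + 18 * rho ^ 2 - 12 * rho ^ 3 + 4 * rho ^ 4 = 0"
      by (simp add: algebra_simps eval_nat_numeral)
    moreover have "poly (map_poly emb [:4, 0, 0, - 12, 0, 0, 18, 0, 0, - 12, 0, 0, 4:]) tau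
       = 4 - 12 * rho + 18 * rho ^ 2 - 12 * rho ^ 3 + 4 * rho ^ 4"
      by (simp add: emb_simps eval_nat_numeral rho_def algebra_simps)
    ultimately show False using poly_tau_eq_0D[of "[:4, 0, 0, - 12, 0, 0, 18, 0, 0, - 12, 0, 0, 4:]"] by auto
  qed
qed

text \<open>A repeated root of the cofactor would be a critical root of the sextic, contrary to
  \<open>cofactor_roots_simple\<close>.\<close>

lemma cofactor_roots:
  "\<exists>W. finite W \<and> card W = 4 \<and> cofactor = (\<Prod>w\<in>W. [:- w, 1:])"
proof -
  have "cofactor \<noteq> 0" by (simp add: cofactor_def)
  from alg_closed_imp_factorization[OF this] obtain A where
    A: "size A = degree cofactor" "cofactor = smult (lead_coeff cofactor) (\<Prod>x\<in>#A. [:- x, 1:])" by blast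
  have c: "cofactor = (\<Prod>x\<in>#A. [:- x, 1:])" "size A = 4"
    using A by (simp_all add: cofactor_def)
  have "count A w \<le> 1" for w
  proof (rule ccontr)
    assume "\<not> count A w \<le> 1"
    hence "{#w, w#} \<subseteq># A" by (auto simp: subseteq_mset_def)
    then obtain B where "A = {#w, w#} + B" by (auto simp: mset_subset_eq_exists_conv)
    hence cw: "cofactor = [:- w, 1:] * ([:- w, 1:] * (\<Prod>x\<in>#B. [:- x, 1:]))" by (simp add: c(1))
    define R where "R = - ([:- rho, 1:] ^ 2 * (\<Prod>x\<in>#B. [:- x, 1:]))"
    have "sextic xi H0 = [:- w, 1:] * ([:- w, 1:] * R)"
      unfolding sextic_branch cw R_def by (simp only: mult_minus_right mult.left_commute)
    hence "poly (pderiv (sextic xi H0)) w = 0"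
      by (simp add: pderiv_mult pderiv_pCons del: mult_pCons_left)
    moreover have "poly cofactor w = 0" unfolding cw by simp
    ultimately show False using cofactor_roots_simple by blast
  qed
  hence "A = mset_set (set_mset A)"
    by (intro multiset_eqI) (metis count_greater_zero_iff count_mset_set(1,3) finite_set_mset le_antisym
        less_one not_less not_in_iff)
  hence "cofactor = (\<Prod>w\<in>set_mset A. [:- w, 1:])" "card (set_mset A) = 4"
    using c by (metis prod_unfold_prod_mset, metis size_mset_set)
  thus ?thesis by (intro exI[of _ "set_mset A"]) simp
qed

text \<open>Here \<open>x\<close> is frozen at the branch value and the series variable is the local
  parameter \<open>t = H - H0\<close>.\<close>

definition local_sextic :: "k fps poly" where
  "local_sextic = sextic (fps_const xi) (fps_const H0 + fps_X)"

lemma poly_local_sextic: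
  "poly local_sextic z = poly (map_poly fps_const (sextic xi H0)) z + fps_X * poly (map_poly fps_const [:0, 0, 0, 9:]) z"
  unfolding local_sextic_def rhom.map_poly_sextic[OF rhom_fps_const]
  by (simp add: sextic_def rhom.map_poly_pCons[OF rhom_fps_const] rhom.h_numeral[OF rhom_fps_const] algebra_simps)

text \<open>The four simple roots lift to power series by \<open>pencil_root_exists\<close>.
  Dividing them out leaves a quadratic with leading coefficient \<open>-1\<close>, and cancelling
  the cofactor modulo \<open>t\<close> identifies its reduction as
  \<open>- (w - rho)^2\<close>.\<close>

lemma local_sextic_factorization:
  "\<exists>W \<zeta> \<gamma> \<beta>. finite W \<and> card W = 4 \<and> (\<forall>w\<in>W. \<zeta> w $ 0 = w) \<and>
     local_sextic = (\<Prod>w\<in>W. [:- \<zeta> w, 1:]) * [:\<gamma>, \<beta>, - 1:] \<and> \<gamma> $ 0 = - (rho ^ 2) \<and> \<beta> $ 0 = 2 * rho"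
proof -
  obtain W where W: "finite W" "card W = 4" "cofactor = (\<Prod>w\<in>W. [:- w, 1:])"
    using cofactor_roots by blast
  have "\<exists>z. z $ 0 = w \<and> poly local_sextic z = 0" if w: "w \<in> W" for w
  proof -
    have cw: "poly cofactor w = 0" using w W(1) by (simp add: W(3) poly_prod)
    have "w \<noteq> 0" using cw rho_nz by (auto simp: cofactor_def)
    thus ?thesis
      using pencil_root_exists[of "sextic xi H0" w "[:0, 0, 0, 9:]"] cofactor_roots_simple[OF cw] cw
      by (simp add: poly_local_sextic sextic_branch)
  qed
  then obtain \<zeta> where \<zeta>: "\<And>w. w \<in> W \<Longrightarrow> \<zeta> w $ 0 = w" "\<And>w. w \<in> W \<Longrightarrow> poly local_sextic (\<zeta> w) = 0"
    by metis
  have inj: "inj_on \<zeta> W" using \<zeta>(1) by (metis inj_onI)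
  have pr: "(\<Prod>a\<in>\<zeta> ` W. [:- a, 1:]) = (\<Prod>w\<in>W. [:- \<zeta> w, 1:])"
    by (simp add: prod.reindex[OF inj])
  have "(\<Prod>a\<in>\<zeta> ` W. [:- a, 1:]) dvd local_sextic"
    using W(1) \<zeta>(2) by (intro prod_linear_dvd) auto
  then obtain q where q: "local_sextic = (\<Prod>w\<in>W. [:- \<zeta> w, 1:]) * q"
    unfolding pr by (auto elim: dvdE)
  have "degree (\<Prod>w\<in>W. [:- \<zeta> w, 1:]) = 4"
    using W(1,2) by (simp add: degree_prod_eq_sum_degree)
  moreover have "lead_coeff (\<Prod>w\<in>W. [:- \<zeta> w, 1:]) = 1" unfolding lead_coeff_prod by simp
  ultimately have dP: "degree (\<Prod>w\<in>W. [:- \<zeta> w, 1:]) = 4" "lead_coeff (\<Prod>w\<in>W. [:- \<zeta> w, 1:]) = 1"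
    by blast+
  have S: "degree local_sextic = 6" "lead_coeff local_sextic = - 1"
    unfolding local_sextic_def sextic_def by simp_all
  have q0: "q \<noteq> 0" using q S(1) by auto
  have P0: "(\<Prod>w\<in>W. [:- \<zeta> w, 1:]) \<noteq> 0" using dP(2) by auto
  have "degree local_sextic = 4 + degree q"
    unfolding q using dP(1) q0 P0 by (simp add: degree_mult_eq)
  hence dq: "degree q = 2" using S(1) by simp
  have lq: "lead_coeff q = - 1" using S(2) unfolding q lead_coeff_mult dP(2) by simp
  define \<gamma> \<beta> where "\<gamma> = coeff q 0" and "\<beta> = coeff q 1"
  have qq: "q = [:\<gamma>, \<beta>, - 1:]"
    using dq lq by (intro poly_eqI) (auto simp: \<gamma>_def \<beta>_def coeff_pCons coeff_eq_0 numeral_2_eq_2 split: nat.splits)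
  let ?e = "\<lambda>f :: k fps. f $ 0"
  interpret e: rhom ?e by (rule rhom_fps_nth_0)
  interpret me: rhom "map_poly ?e" by (rule e.rhom_map_poly)
  have red: "map_poly ?e local_sextic = sextic xi H0"
    unfolding local_sextic_def e.map_poly_sextic by simp
  have red_prod: "map_poly ?e (\<Prod>w\<in>W'. [:- \<zeta> w, 1:]) = (\<Prod>w\<in>W'. [:- w, 1:])" if "W' \<subseteq> W" for W'
    using finite_subset[OF that W(1)] that
  proof (induction W' rule: finite_induct)
    case (insert w W')
    have "map_poly ?e [:- \<zeta> w, 1:] = [:- w, 1:]" using insert.prems \<zeta>(1) by (simp add: e.map_poly_pCons)
    moreover have "map_poly ?e (\<Prod>w\<in>W'. [:- \<zeta> w, 1:]) = (\<Prod>w\<in>W'. [:- w, 1:])"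
      using insert by blast
    ultimately show ?case
      unfolding prod.insert[OF insert.hyps] me.h_mult by (rule arg_cong2[of _ _ _ _ "(*)"])
  qed simp
  have "map_poly ?e q = [:\<gamma> $ 0, \<beta> $ 0, - 1:]" by (simp add: qq e.map_poly_pCons)
  with red have "- ([:- rho, 1:] ^ 2 * cofactor) = cofactor * [:\<gamma> $ 0, \<beta> $ 0, - 1:]"
    unfolding q me.h_mult red_prod[OF order.refl] W(3)[symmetric] sextic_branch by (simp only:)
  hence "cofactor * [:\<gamma> $ 0, \<beta> $ 0, - 1:] = cofactor * - ([:- rho, 1:] ^ 2)"
    by (simp add: mult.commute)
  moreover have "cofactor \<noteq> 0" by (simp add: cofactor_def)
  ultimately have "[:\<gamma> $ 0, \<beta> $ 0, - 1:] = - ([:- rho, 1:] ^ 2)" using mult_cancel_left by blast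
  hence "\<gamma> $ 0 = - (rho ^ 2)" "\<beta> $ 0 = 2 * rho" by (simp_all add: power2_eq_square)
  thus ?thesis using W(1,2) \<zeta>(1) q unfolding qq by blast
qed

text \<open>A root in the Laurent series field would be a power series \<open>r = \<rho> + O(t)\<close>, and the \<open>t\<close>-coefficient
  of the sextic at \<open>r\<close> would be \<open>9 \<rho>\<^sup>3\<close>.\<close>

lemma local_quadratic_no_root:
  assumes dvd: "[:\<gamma>, \<beta>, - 1:] dvd local_sextic" and c: "\<gamma> $ 0 = - (rho ^ 2)" "\<beta> $ 0 = 2 * rho"
  shows "poly [:fps_to_fls \<gamma>, fps_to_fls \<beta>, - 1:] r \<noteq> 0"
proof
  assume r: "poly [:fps_to_fls \<gamma>, fps_to_fls \<beta>, - 1:] r = 0"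
  show False
  proof (cases "fls_subdegree r \<ge> 0")
    case True
    define s where "s = fls_regpart r"
    have rs: "r = fps_to_fls s" using True by (simp add: s_def)
    have "poly [:fps_to_fls \<gamma>, fps_to_fls \<beta>, - 1:] (fps_to_fls s) = fps_to_fls (poly [:\<gamma>, \<beta>, - 1:] s)"
      by (simp add: fls_times_fps_to_fls)
    hence "fps_to_fls (poly [:\<gamma>, \<beta>, - 1:] s) = 0" using r unfolding rs by (rule trans[OF sym])
    hence s: "poly [:\<gamma>, \<beta>, - 1:] s = 0" by (rule iffD1[OF fps_to_fls_eq_0_iff])
    have "poly [:\<gamma>, \<beta>, - 1:] s $ 0 = - ((s $ 0 - rho) ^ 2)"
      by (simp add: c algebra_simps power2_eq_square)
    hence "(s $ 0 - rho) ^ 2 = 0" unfolding s by simp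
    hence s0: "s $ 0 = rho" by simp
    obtain q where q: "local_sextic = [:\<gamma>, \<beta>, - 1:] * q" using dvd by (elim dvdE)
    have "poly local_sextic s = 0" unfolding q Polynomial.poly_mult s by (rule mult_zero_left)
    moreover define u v Q where "u = s - fps_const rho" and "v = poly (map_poly fps_const cofactor) s"
      and "Q = poly (map_poly fps_const [:0, 0, 0, 9:]) s"
    have "poly (map_poly fps_const (sextic xi H0)) s = - (u * u * v)"
    proof -
      interpret m: rhom "map_poly fps_const :: k poly \<Rightarrow> _" by (rule rhom.rhom_map_poly[OF rhom_fps_const])
      have "poly (map_poly fps_const [:- rho, 1:]) s = u"
        by (simp add: u_def rhom.map_poly_pCons[OF rhom_fps_const] flip: fps_const_neg)
      thus ?thesis
        unfolding sextic_branch m.h_minus m.h_mult power2_eq_square Polynomial.poly_minus Polynomial.poly_mult v_def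
        by (simp only:)
    qed
    \<comment> \<open>As \<open>u\<close> has no constant term, the product \<open>u * u * v\<close>
      does not contribute to the coefficient of \<open>t\<close>; what remains is the constant term
      of \<open>Q\<close>, namely \<open>9 rho^3\<close>.\<close>
    ultimately have "(- (u * u * v) + fps_X * Q) $ Suc 0 = 0"
      by (simp only: poly_local_sextic Q_def fps_zero_nth)
    moreover have "u $ 0 = 0" using s0 by (simp add: u_def)
    ultimately have "Q $ 0 = 0" by simp
    hence "9 * rho ^ 3 = 0"
      using s0 by (simp add: Q_def rhom.map_poly_pCons[OF rhom_fps_const] eval_nat_numeral)
    thus False using rho_nz by simp
  next
    \<comment> \<open>If \<open>r\<close> has a pole, its inverse \<open>s\<close> has no constant
      term, and division of the quadratic by \<open>r^2\<close> gives an equation in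
      \<open>s\<close> whose constant term is \<open>-1\<close>.\<close>
    case False
    hence r0: "r \<noteq> 0" by auto
    define s where "s = fls_regpart (inverse r)"
    have sd: "fls_subdegree (inverse r) > 0" using False by simp
    hence rs: "inverse r = fps_to_fls s" by (simp add: s_def)
    have s0: "s $ 0 = 0" using sd by (simp add: s_def)
    have "inverse r ^ 2 * poly [:fps_to_fls \<gamma>, fps_to_fls \<beta>, - 1:] r
        = fps_to_fls \<gamma> * inverse r ^ 2 + fps_to_fls \<beta> * inverse r - 1"
      using r0 by (simp add: field_simps power2_eq_square)
    hence "fps_to_fls (\<gamma> * s ^ 2 + \<beta> * s - 1) = 0"
      using r by (simp add: rs fls_times_fps_to_fls fps_to_fls_power)
    hence "\<gamma> * s ^ 2 + \<beta> * s - 1 = 0" by (simp only: fps_to_fls_eq_0_iff)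
    hence "(\<gamma> * s ^ 2 + \<beta> * s - 1) $ 0 = 0" by simp
    thus False using s0 by (simp add: power2_eq_square)
  qed
qed

section \<open>Embedding Q(x,H) into the Laurent series field at the branch point\<close>

definition local_hom :: "rat poly poly \<Rightarrow> k fls" where
  "local_hom a = fps_to_fls (fps_of_poly (pcompose (map_poly (\<lambda>c. poly (map_poly emb c) xi) a) [:H0, 1:]))"

lemma rhom_emb_xi: "rhom (\<lambda>c. poly (map_poly emb c) xi)"
  by (rule rhom.rhom_eval[OF rhom_emb])

lemma rhom_local_hom: "rhom local_hom"
proof -
  have 1: "rhom (\<lambda>p. pcompose p [:H0, 1:])"
    by unfold_locales (auto simp: pcompose_1 pcompose_add pcompose_mult)
  have 2: "rhom (fps_of_poly :: k poly \<Rightarrow> _)"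
    by unfold_locales (auto simp: fps_of_poly_add fps_of_poly_mult)
  show ?thesis
    unfolding local_hom_def
    using rhom_comp[OF rhom_comp[OF rhom_comp[OF rhom.rhom_map_poly[OF rhom_emb_xi] 1] 2] rhom_fps_to_fls] .
qed

lemma poly_emb_xi_eq_0D:
  assumes "poly (map_poly emb c) xi = 0"
  shows "c = 0"
proof -
  have "poly (map_poly emb (pcompose c q)) tau = poly (map_poly emb c) (poly (map_poly emb q) tau)" for q
    by (induction c) (simp_all add: pcompose_pCons rhom.map_poly_add[OF rhom_emb]
        rhom.map_poly_mult[OF rhom_emb] emb_simps)
  moreover have "poly (map_poly emb [:0, 0, 0, 0, - 1:]) tau = xi"
    by (simp add: emb_simps xi_def eval_nat_numeral)
  ultimately have "poly (map_poly emb (pcompose c [:0, 0, 0, 0, - 1:])) tau = 0" using assms by metis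
  hence "pcompose c [:0, 0, 0, 0, - 1:] = 0" by (rule poly_tau_eq_0D)
  thus ?thesis by (rule pcompose_eq_0) simp
qed

text \<open>Although \<open>x\<close> goes to a constant, nothing is lost: \<open>xi\<close> is
  transcendental over the rationals because \<open>tau\<close> is, and the shift from
  \<open>H\<close> to \<open>H0 + t\<close> is injective on polynomials over
  \<open>k\<close>.\<close>

lemma local_hom_eq_0D:
  assumes "local_hom a = 0"
  shows "a = 0"
proof -
  have "pcompose (map_poly (\<lambda>c. poly (map_poly emb c) xi) a) [:H0, 1:] = 0"
    using assms by (simp add: local_hom_def fps_of_poly_eq_iff[of _ 0, simplified])
  hence "map_poly (\<lambda>c. poly (map_poly emb c) xi) a = 0" by (rule pcompose_eq_0) simp
  hence "poly (map_poly emb (coeff a n)) xi = 0" for n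
    by (metis (no_types, lifting) coeff_0 coeff_map_poly rhom.h_0[OF rhom_emb_xi])
  hence "coeff a n = 0" for n using poly_emb_xi_eq_0D by blast
  thus ?thesis by (simp add: poly_eq_iff)
qed

definition local_emb :: "rat poly poly fract \<Rightarrow> k fls" where
  "local_emb = fract_lift local_hom"

lemma rhom_local_emb: "rhom local_emb"
  unfolding local_emb_def using rhom_local_hom local_hom_eq_0D by (rule rhom_fract_lift)

lemma local_emb_xK: "local_emb xK = fps_to_fls (fps_const xi)"
  and local_emb_hK: "local_emb hK = fps_to_fls (fps_const H0 + fps_X)"
proof -
  have e: "local_emb (to_fract a) = local_hom a" for a
    unfolding local_emb_def using fract_lift_to_fract[OF rhom_local_hom local_hom_eq_0D] by blast
  show "local_emb xK = fps_to_fls (fps_const xi)"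
    by (simp add: e local_hom_def rhom.map_poly_pCons[OF rhom_emb_xi] emb_simps fps_of_poly_const)
  show "local_emb hK = fps_to_fls (fps_const H0 + fps_X)"
    by (simp add: e local_hom_def rhom.map_poly_pCons[OF rhom_emb_xi] emb_simps pcompose_pCons
        fps_of_poly_const fps_of_poly_pCons)
qed

lemma map_poly_local_emb: "map_poly local_emb gK = map_poly fps_to_fls local_sextic"
  by (simp only: rhom.map_poly_sextic[OF rhom_local_emb] local_emb_xK local_emb_hK local_sextic_def
      rhom.map_poly_sextic[OF rhom_fps_to_fls])

section \<open>Roots of \<open>P4\<close> from roots of the sextic\<close>

lemma rhom_rat:
  fixes h :: "rat \<Rightarrow> 'a :: field_char_0"
  assumes "rhom h"
  shows "h c = of_rat c"
proof -
  interpret rhom h by fact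
  have int: "h (of_int a) = of_int a" for a
    by (cases a rule: int_cases2) (simp_all add: h_minus)
  obtain a b where ab: "quotient_of c = (a, b)" by force
  hence b: "b > 0" "c = of_int a / of_int b"
    using quotient_of_denom_pos quotient_of_div by blast+
  have "h c * of_int b = h (c * of_int b)" by (simp add: h_mult int)
  also have "\<dots> = of_int a" using b by (simp add: int)
  finally have "h c = of_int a / of_int b" using b(1) by (simp add: eq_divide_eq)
  also have "\<dots> = of_rat c" unfolding b(2) by (simp add: of_rat_divide)
  finally show ?thesis .
qed

text \<open>Stated for an arbitrary homomorphism out of Q[x,H], since it is applied twice: in the
  algebraic closure of Q(x,H) for the Galois group, and in Laurent series in \<open>H\<close> for
  the generating function.\<close>

lemma P4_root:
  fixes \<phi> :: "rat poly poly \<Rightarrow> 'a :: field_char_0"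
  assumes \<phi>: "rhom \<phi>" and x: "x = \<phi> [:[:0, 1:]:]" and h: "h = \<phi> [:0, 1:]"
    and hz: "9 * h * z ^ 3 = - ((1 - z) ^ 3 * (z ^ 3 + x ^ 3))" and z: "z \<noteq> 0"
    and F: "27 * F * z ^ 2 = poly (numer x) z"
  shows "poly (map_poly \<phi> P4) F = 0"
proof -
  interpret rhom \<phi> by fact
  have "rhom (\<lambda>c. \<phi> [:[:c:]:])"
    using rhom_comp[OF rhom_comp[OF rhom_const rhom_const] \<phi>] .
  hence cst: "\<phi> [:[:c:]:] = of_rat c" for c by (rule rhom_rat)
  note ev = Let_def h_simps h_numeral h_1 cst x[symmetric] h[symmetric]

  have a5: "\<phi> A5 = (1/9) * (1 + x) * (x^2 + 5 * x + 1) - 2 * h"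
    unfolding A5_def by (simp only: ev) (simp add: of_rat_divide of_rat_minus)

  have a4: "\<phi> A4 = (1/243) * (x^6 + 15 * x^5 + 60 * x^4 + 83 * x^3 + 60 * x^2 + 15 * x + 1) - (2/27) * (3 * x^3 + 15 * x^2 + 15 * x + 2) * h + (4/3) * h^2"
    unfolding A4_def by (simp only: ev) (simp add: of_rat_divide of_rat_minus)

  have a3: "\<phi> A3 = (1/19683) * (1 + x)^3 * (x^6 + 33 * x^5 + 204 * x^4 + 263 * x^3 + 204 * x^2 + 33 * x + 1) - (2/729) * (3 * x^6 + 36 * x^5 + 126 * x^4 + 166 * x^3 + 114 * x^2 + 24 * x + 1) * h + (1/81) * (3 * x^3 + 48 * x^2 + 48 * x - 5) * h^2 - (8/27) * h^3"
    unfolding A3_def by (simp only: ev) (simp add: of_rat_divide of_rat_minus)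

  have a2: "\<phi> A2 = (1/59049) * x * (1 + x)^6 * (x^4 + 13 * x^3 + 15 * x^2 + 13 * x + 1) - (2/19683) * x * (1 + x)^2 * (x^6 + 25 * x^5 + 138 * x^4 + 241 * x^3 + 226 * x^2 + 99 * x + 9) * h + (1/2187) * x * (12 * x^5 + 27 * x^4 + 243 * x^3 + 422 * x^2 + 171 * x - 45) * h^2 + (2/243) * x * (23 * x^2 - 12 * x - 12) * h^3"
    unfolding A2_def by (simp only: ev) (simp add: of_rat_divide of_rat_minus)

  have a1: "\<phi> A1 = (1/531441) * x^2 * (1 + x)^9 * (x^2 + x + 1) - (2/177147) * x^2 * (1 + x)^5 * (2 * x^4 + 19 * x^3 + 29 * x^2 + 27 * x + 9) * h + (1/59049) * x^2 * (1 + x) * (4 * x^6 + 68 * x^5 + 85 * x^4 + 729 * x^3 + 588 * x^2 + 513 * x - 135) * h^2 - (4/6561) * x^2 * (2 * x^4 - 69 * x^3 - 51 * x^2 + 45 * x + 18) * h^3 - (4/27) * x^3 * h^4"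
    unfolding A1_def by (simp only: ev) (simp add: of_rat_divide of_rat_minus)

  have a0: "\<phi> A0 = - (2/1594323) * x^3 * (1 + x)^8 * (x^2 + x + 1) * h + (1/531441) * x^3 * (1 + x)^4 * (4 * x^4 + 24 * x^3 + 57 * x^2 + 57 * x + 33) * h^2 - (2/531441) * x^3 * (4 * x^6 + 36 * x^5 - 585 * x^4 + 324 * x^3 - 135 * x^2 + 486 * x - 486) * h^3 - (1/2187) * x^3 * (36 * x^2 + 36 * x - 31) * h^4 + (8/243) * x^3 * h^5"
    unfolding A0_def by (simp only: ev) (simp add: of_rat_divide of_rat_minus)

  define n m where "n = 27 * F * z ^ 2" and "m = 9 * h * z ^ 3"

  have b5: "(3 * (1 + x) * (x^2 + 5 * x + 1) * z^5 - 6 * m * z^2) = 27 ^ 1 * \<phi> A5 * z ^ 5"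
    unfolding a5 m_def by Groebner_Basis.algebra

  have b4: "(3 * (x^6 + 15 * x^5 + 60 * x^4 + 83 * x^3 + 60 * x^2 + 15 * x + 1) * z^7 - 6 * (3 * x^3 + 15 * x^2 + 15 * x + 2) * m * z^4 + 12 * m^2 * z) = 27 ^ 2 * \<phi> A4 * z ^ 7"
    unfolding a4 m_def by Groebner_Basis.algebra

  have b3: "((1 + x)^3 * (x^6 + 33 * x^5 + 204 * x^4 + 263 * x^3 + 204 * x^2 + 33 * x + 1) * z^9 - 6 * (3 * x^6 + 36 * x^5 + 126 * x^4 + 166 * x^3 + 114 * x^2 + 24 * x + 1) * m * z^6 + 3 * (3 * x^3 + 48 * x^2 + 48 * x - 5) * m^2 * z^3 - 8 * m^3) = 27 ^ 3 * \<phi> A3 * z ^ 9"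
    unfolding a3 m_def by Groebner_Basis.algebra

  have b2: "(9 * x * (1 + x)^6 * (x^4 + 13 * x^3 + 15 * x^2 + 13 * x + 1) * z^11 - 6 * x * (1 + x)^2 * (x^6 + 25 * x^5 + 138 * x^4 + 241 * x^3 + 226 * x^2 + 99 * x + 9) * m * z^8 + 3 * x * (12 * x^5 + 27 * x^4 + 243 * x^3 + 422 * x^2 + 171 * x - 45) * m^2 * z^5 + 6 * x * (23 * x^2 - 12 * x - 12) * m^3 * z^2) = 27 ^ 4 * \<phi> A2 * z ^ 11"
    unfolding a2 m_def by Groebner_Basis.algebra

  have b1: "(27 * x^2 * (1 + x)^9 * (x^2 + x + 1) * z^13 - 18 * x^2 * (1 + x)^5 * (2 * x^4 + 19 * x^3 + 29 * x^2 + 27 * x + 9) * m * z^10 + 3 * x^2 * (1 + x) * (4 * x^6 + 68 * x^5 + 85 * x^4 + 729 * x^3 + 588 * x^2 + 513 * x - 135) * m^2 * z^7 - 12 * x^2 * (2 * x^4 - 69 * x^3 - 51 * x^2 + 45 * x + 18) * m^3 * z^4 - 324 * x^3 * m^4 * z) = 27 ^ 5 * \<phi> A1 * z ^ 13"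
    unfolding a1 m_def by Groebner_Basis.algebra

  have b0: "(- 54 * x^3 * (1 + x)^8 * (x^2 + x + 1) * m * z^12 + 9 * x^3 * (1 + x)^4 * (4 * x^4 + 24 * x^3 + 57 * x^2 + 57 * x + 33) * m^2 * z^9 - 2 * x^3 * (4 * x^6 + 36 * x^5 - 585 * x^4 + 324 * x^3 - 135 * x^2 + 486 * x - 486) * m^3 * z^6 - 27 * x^3 * (36 * x^2 + 36 * x - 31) * m^4 * z^3 + 216 * x^3 * m^5) = 27 ^ 6 * \<phi> A0 * z ^ 15"
    unfolding a0 m_def by Groebner_Basis.algebra

  have n: "n = 3*x^3 - 6*x^3*z + (2*x^3 - 3*x^2 - 3*x)*z^2 - 3*z^4 + 2*z^5"
    unfolding n_def F by (simp add: numer_def algebra_simps eval_nat_numeral)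
  have m: "m = - ((1 - z)^3 * (z^3 + x^3))" unfolding m_def hz ..
  have P: "poly (map_poly \<phi> P4) F = F^6 + \<phi> A5 * F^5 + \<phi> A4 * F^4 + \<phi> A3 * F^3 + \<phi> A2 * F^2 + \<phi> A1 * F + \<phi> A0"
    unfolding P4_def by (simp add: map_poly_pCons) (simp add: algebra_simps eval_nat_numeral)
  have "27 ^ 6 * z ^ 15 * poly (map_poly \<phi> P4) F =
      n^6*z^3 + 27 ^ 1 * \<phi> A5 * z^5 * n^5 + 27 ^ 2 * \<phi> A4 * z^7 * n^4 + 27 ^ 3 * \<phi> A3 * z^9 * n^3
      + 27 ^ 4 * \<phi> A2 * z^11 * n^2 + 27 ^ 5 * \<phi> A1 * z^13 * n + 27 ^ 6 * \<phi> A0 * z^15"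
    unfolding P n_def by Groebner_Basis.algebra
  also have "\<dots> = 0"
    using P4_parametrization_identity[OF n m] unfolding b5 b4 b3 b2 b1 b0 .
  finally show ?thesis using z by simp
qed

text \<open>Over the Laurent series field four roots of the sextic lie in the base field, hence are
  fixed, and the other two are exchanged because their quadratic is irreducible. The same
  description shows that the six roots are distinct.\<close>

lemma sextic_transposition:
  "card (rts to_ac gK) = 6 \<and> (\<exists>u v \<sigma>. u \<in> rts to_ac gK \<and> v \<in> rts to_ac gK \<and> u \<noteq> v \<and> aut gK \<sigma> \<and>
     root_perm gK \<sigma> = Transposition.transpose u v)"
proof -
  let ?Z = "rts to_ac gK"
  obtain W \<zeta> \<gamma> \<beta> where W: "finite W" "card W = 4" "\<And>w. w \<in> W \<Longrightarrow> \<zeta> w $ 0 = w"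
    and S: "local_sextic = (\<Prod>w\<in>W. [:- \<zeta> w, 1:]) * [:\<gamma>, \<beta>, - 1:]"
    and c: "\<gamma> $ 0 = - (rho ^ 2)" "\<beta> $ 0 = 2 * rho"
    using local_sextic_factorization by blast
  define q where "q = [:fps_to_fls \<gamma>, fps_to_fls \<beta>, - 1:]"
  have nr: "poly q r \<noteq> 0" for r
    unfolding q_def by (rule local_quadratic_no_root[OF _ c]) (simp add: S del: mult_pCons_left mult_pCons_right)
  define \<eta> where "\<eta> f = to_ac (fps_to_fls f)" for f :: "k fps"
  have \<eta>: "rhom \<eta>" unfolding \<eta>_def using rhom_comp[OF rhom_fps_to_fls rhom_to_ac] .
  interpret \<eta>: rhom \<eta> by (rule \<eta>)
  interpret m\<eta>: rhom "map_poly \<eta>" by (rule \<eta>.rhom_map_poly)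
  have \<eta>inj: "\<eta> f = \<eta> g \<longleftrightarrow> f = g" for f g by (simp add: \<eta>_def)
  have mq: "map_poly to_ac q = [:\<eta> \<gamma>, \<eta> \<beta>, - 1:]"
    by (simp add: q_def \<eta>_def rhom.map_poly_pCons[OF rhom_to_ac])
  have "degree (map_poly to_ac q) > 0" unfolding mq by simp
  then obtain a where a: "poly (map_poly to_ac q) a = 0" using alg_closed_imp_poly_has_root by blast
  define b where "b = \<eta> \<beta> - a"
  have "\<eta> \<gamma> = a * a - a * \<eta> \<beta>" using a unfolding mq by (simp add: algebra_simps add_eq_0_iff2)
  hence qf: "poly (map_poly to_ac q) z = - ((z - a) * (z - b))" for z
    unfolding mq by (simp add: b_def algebra_simps)
  have nrange: "poly (map_poly to_ac q) z \<noteq> 0" if z: "z \<in> range to_ac" for z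
  proof -
    obtain r where r: "z = to_ac r" using z by blast
    have "poly (map_poly to_ac q) z = to_ac (poly q r)" by (simp only: r rhom.h_poly[OF rhom_to_ac])
    thus ?thesis using nr by simp
  qed
  have ar: "a \<notin> range to_ac" and br: "b \<notin> range to_ac" using nrange[of a] nrange[of b] qf by auto
  have ab: "a \<noteq> b"
  proof
    assume "a = b"
    \<comment> \<open>A double root would be half the sum of the roots, which lies in the base
      field.\<close>
    hence "2 * a = \<eta> \<beta>" by (simp add: b_def algebra_simps)
    hence "a = to_ac (fps_to_fls \<beta> / 2)" by (simp add: \<eta>_def field_simps)
    thus False using ar by blast
  qed
  have e: "partial_hom UNIV local_emb" by (simp add: partial_hom_UNIV_iff rhom_local_emb)
  have "map_poly to_ac (map_poly local_emb gK) = map_poly \<eta> local_sextic"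
    unfolding map_poly_local_emb by (intro poly_eqI) (simp add: coeff_map_poly \<eta>_def)
  also have "\<dots> = map_poly \<eta> (\<Prod>w\<in>W. [:- \<zeta> w, 1:]) * map_poly to_ac q"
    unfolding S m\<eta>.h_mult mq by (simp add: \<eta>.map_poly_pCons \<eta>.h_minus)
  finally have fac: "map_poly to_ac (map_poly local_emb gK) = map_poly \<eta> (\<Prod>w\<in>W. [:- \<zeta> w, 1:]) * map_poly to_ac q" .
  have pz: "poly (map_poly \<eta> (\<Prod>w\<in>W'. [:- \<zeta> w, 1:])) z = (\<Prod>w\<in>W'. z - \<eta> (\<zeta> w))" if "finite W'" for W' z
    using that
  proof (induction W' rule: finite_induct)
    case (insert w W')
    have "poly (map_poly \<eta> [:- \<zeta> w, 1:]) z = z - \<eta> (\<zeta> w)" by (simp add: \<eta>.map_poly_pCons \<eta>.h_minus)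
    thus ?case using insert.IH
      unfolding prod.insert[OF insert.hyps] m\<eta>.h_mult Polynomial.poly_mult by (simp only:)
  qed simp
  have ev: "poly (map_poly to_ac (map_poly local_emb gK)) z = (\<Prod>w\<in>W. z - \<eta> (\<zeta> w)) * - ((z - a) * (z - b))" for z
    unfolding fac Polynomial.poly_mult pz[OF W(1)] qf ..
  have R: "poly (map_poly to_ac (map_poly local_emb gK)) z = 0 \<longleftrightarrow> z \<in> (\<lambda>w. \<eta> (\<zeta> w)) ` W \<union> {a, b}" for z
    unfolding ev mult_eq_0_iff neg_equal_0_iff_equal prod_zero_iff[OF W(1)] by auto
  have roots: "rts to_ac (map_poly local_emb gK) = (\<lambda>w. \<eta> (\<zeta> w)) ` W \<union> {a, b}"
    by (rule Set.set_eqI) (simp only: mem_Collect_eq R)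
  have \<eta>r: "\<eta> f \<in> range to_ac" for f by (simp add: \<eta>_def)
  have "inj_on (\<lambda>w. \<eta> (\<zeta> w)) W"
  proof (rule inj_onI)
    fix w w' assume w: "w \<in> W" "w' \<in> W" "\<eta> (\<zeta> w) = \<eta> (\<zeta> w')"
    hence *: "\<zeta> w = \<zeta> w'" by (simp only: \<eta>inj)
    have "w = \<zeta> w $ 0" by (rule W(3)[OF w(1), symmetric])
    also have "\<dots> = \<zeta> w' $ 0" unfolding * ..
    also have "\<dots> = w'" by (rule W(3)[OF w(2)])
    finally show "w = w'" .
  qed
  from card_image[OF this] have c4: "card ((\<lambda>w. \<eta> (\<zeta> w)) ` W) = 4" unfolding W(2) .
  have "card ((\<lambda>w. \<eta> (\<zeta> w)) ` W \<union> {a, b}) = card ((\<lambda>w. \<eta> (\<zeta> w)) ` W) + card {a, b}"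
    using W(1) ar br \<eta>r by (intro card_Un_disjoint) auto
  hence card6: "card (rts to_ac (map_poly local_emb gK)) = 6"
    unfolding roots c4 using ab by simp
  from galois_transfer[OF e sextic_nonzero, of xK hK] obtain \<iota> where
    \<iota>: "bij_betw \<iota> ?Z (rts to_ac (map_poly local_emb gK))"
    and tr: "\<forall>q a b. q \<noteq> 0 \<and> (\<forall>r s. q = r * s \<longrightarrow> degree r = 0 \<or> degree s = 0) \<and>
        a \<in> rts to_ac q \<and> b \<in> rts to_ac q \<longrightarrow>
        (\<exists>\<sigma>. aut gK \<sigma> \<and> (\<forall>z\<in>?Z. \<iota> z \<in> range to_ac \<longrightarrow> \<sigma> z = z) \<and> (\<forall>z\<in>?Z. \<iota> z = a \<longrightarrow> \<iota> (\<sigma> z) = b))"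
    by (elim exE conjE) (rule that)
  have card: "card ?Z = 6" using bij_betw_same_card[OF \<iota>] card6 by simp
  have \<iota>inj: "\<iota> u = \<iota> v \<Longrightarrow> u = v" if "u \<in> ?Z" "v \<in> ?Z" for u v
    using inj_onD[OF bij_betw_imp_inj_on[OF \<iota>] _ that] .
  have "a \<in> \<iota> ` ?Z" "b \<in> \<iota> ` ?Z" unfolding bij_betw_imp_surj_on[OF \<iota>] roots by simp_all
  then obtain u v where uv: "u \<in> ?Z" "\<iota> u = a" "v \<in> ?Z" "\<iota> v = b" by (elim imageE) (rule that, simp_all)
  have irr: "\<forall>r s. q = r * s \<longrightarrow> degree r = 0 \<or> degree s = 0"
  proof (intro allI impI)
    have no1: "degree r \<noteq> 1" if "q = r * s" for r s
    proof
      assume "degree r = 1"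
      hence r1: "coeff r 1 \<noteq> 0" by (metis degree_0 leading_coeff_0_iff zero_neq_one)
      have r: "r = [:coeff r 0, coeff r 1:]"
        using \<open>degree r = 1\<close>
        by (intro poly_eqI) (auto simp: coeff_pCons coeff_eq_0 split: nat.splits)
      have "poly r (- coeff r 0 / coeff r 1) = 0" using r1 by (subst r) simp
      hence "poly q (- coeff r 0 / coeff r 1) = 0" unfolding that Polynomial.poly_mult by (simp only: mult_zero_left)
      thus False using nr by blast
    qed
    fix r s assume rs: "q = r * s"
    have "degree q = 2" "q \<noteq> 0" by (simp_all add: q_def)
    hence "degree r + degree s = 2" using degree_mult_eq[of r s] rs by auto
    moreover have "degree r \<noteq> 1" "degree s \<noteq> 1" using no1[OF rs] no1[of s r] rs by (simp_all add: mult.commute)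
    ultimately show "degree r = 0 \<or> degree s = 0" by linarith
  qed
  have "q \<noteq> 0 \<and> (\<forall>r s. q = r * s \<longrightarrow> degree r = 0 \<or> degree s = 0) \<and> a \<in> rts to_ac q \<and> b \<in> rts to_ac q"
    using irr by (intro conjI) (simp_all add: qf, simp add: q_def)
  from tr[THEN spec[of _ q], THEN spec[of _ a], THEN spec[of _ b], THEN HOL.mp, OF this]
  obtain \<sigma> where \<sigma>: "aut gK \<sigma>" "\<forall>z\<in>?Z. \<iota> z \<in> range to_ac \<longrightarrow> \<sigma> z = z"
    "\<forall>z\<in>?Z. \<iota> z = a \<longrightarrow> \<iota> (\<sigma> z) = b"
    by (elim exE conjE) (rule that)
  have uvne: "u \<noteq> v" using ab uv by auto
  have sZ: "\<sigma> z \<in> ?Z" if "z \<in> ?Z" for z using bij_betw_apply[OF aut_roots[OF \<sigma>(1)] that] by simp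
  have sinj: "y = z" if "y \<in> ?Z" "z \<in> ?Z" "\<sigma> y = \<sigma> z" for y z
    using inj_onD[OF bij_betw_imp_inj_on[OF aut_roots[OF \<sigma>(1)]] that(3) that(1,2)] by simp
  have fixed: "\<sigma> z = z" if z: "z \<in> ?Z" "z \<noteq> u" "z \<noteq> v" for z
  proof -
    have "\<iota> z \<in> (\<lambda>w. \<eta> (\<zeta> w)) ` W \<union> {a, b}" using bij_betw_apply[OF \<iota> z(1)] unfolding roots .
    moreover have "\<iota> z \<noteq> a" "\<iota> z \<noteq> b" using \<iota>inj[OF z(1) uv(1)] \<iota>inj[OF z(1) uv(3)] uv z(2,3) by auto
    ultimately have "\<iota> z \<in> range to_ac" using \<eta>r by auto
    thus ?thesis using \<sigma>(2) z(1) by blast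
  qed
  have su: "\<sigma> u = v" using \<sigma>(3) uv \<iota>inj[OF sZ[OF uv(1)] uv(3)] by simp
  \<comment> \<open>The transfer provides only \<open>u\<close> going to \<open>v\<close>. As all
    other roots are fixed and \<open>\<sigma>\<close> is injective, \<open>v\<close> has nowhere
    else to go.\<close>
  have sv: "\<sigma> v = u"
  proof (rule ccontr)
    assume ne: "\<sigma> v \<noteq> u"
    have "\<sigma> v \<noteq> v" using sinj[OF uv(1,3)] su uvne by auto
    hence "\<sigma> (\<sigma> v) = \<sigma> v" using fixed[OF sZ[OF uv(3)] ne] by simp
    thus False using sinj[OF sZ[OF uv(3)] uv(3)] \<open>\<sigma> v \<noteq> v\<close> by simp
  qed
  have "root_perm gK \<sigma> z = Transposition.transpose u v z" for z
    using fixed su sv uv(1,3) uvne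
    by (cases "z \<in> ?Z") (auto simp: root_perm_def Transposition.transpose_def)
  hence "root_perm gK \<sigma> = Transposition.transpose u v" by (rule ext)
  thus ?thesis using card uv(1,3) uvne \<sigma>(1) by blast
qed

lemma sextic_all_permutations:
  assumes "\<pi> permutes rts to_ac gK"
  shows "\<exists>\<sigma>. aut gK \<sigma> \<and> (\<forall>z\<in>rts to_ac gK. \<sigma> z = \<pi> z)"
proof -
  interpret perm_group "rts to_ac gK" "root_perm gK ` Collect (aut gK)"
    by (rule perm_group_root_perm) simp
  obtain u v \<sigma> where t: "u \<in> rts to_ac gK" "v \<in> rts to_ac gK" "u \<noteq> v" "aut gK \<sigma>"
    "root_perm gK \<sigma> = Transposition.transpose u v"
    using sextic_transposition by blast
  have rp: "root_perm gK \<sigma> w = \<sigma> w" if "w \<in> rts to_ac gK" for \<sigma> w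
    using that by (simp add: root_perm_def)
  have "\<pi> \<in> root_perm gK ` Collect (aut gK)"
  proof (rule contains_all_permutations[OF _ _ t(1-3) assms])
    show "Transposition.transpose u v \<in> root_perm gK ` Collect (aut gK)"
      using t(4,5) by (metis imageI mem_Collect_eq)
    fix a b c d
    assume abcd: "a \<in> rts to_ac gK" "b \<in> rts to_ac gK" "a \<noteq> b" "c \<in> rts to_ac gK" "d \<in> rts to_ac gK" "c \<noteq> d"
    obtain \<tau> where "aut gK \<tau>" "\<tau> a = c" "\<tau> b = d" using sextic_doubly_transitive[OF abcd] by blast
    thus "\<exists>\<pi>\<in>root_perm gK ` Collect (aut gK). \<pi> a = c \<and> \<pi> b = d"
      using rp[OF abcd(1), of \<tau>] rp[OF abcd(2), of \<tau>] by (intro bexI[of _ "root_perm gK \<tau>"]) simp_all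
  qed
  thus ?thesis using rp by auto
qed

subsection \<open>The Galois group of \<open>P\<^sub>4\<close>\<close>

abbreviation PK :: "rat poly poly fract poly" where "PK \<equiv> fract_poly P4"

lemma PK_nonzero: "PK \<noteq> 0" and degree_PK: "degree PK = 6"
proof -
  have "degree PK = degree P4" by (rule map_poly_degree_eq) (simp add: P4_def)
  thus "degree PK = 6" by (simp add: P4_def)
  thus "PK \<noteq> 0" by auto
qed

text \<open>\<open>\<Phi>\<close> is the rational function \<open>F\<close> of the root
  \<open>z\<close>, with coefficients in Q(x), so it commutes with automorphisms. It is injective on
  the six roots of the sextic, and the degree bound makes it a bijection onto the roots of
  \<open>P4\<close>, along which permutations are transported.\<close>

lemma galois_group_P4: "galois_group PK \<cong> sym_group 6"
proof (rule galois_group_iso_sym_group[OF PK_nonzero])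
  let ?Z = "rts to_ac gK" and ?Y = "rts to_ac PK"
  define \<Phi> where "\<Phi> z = poly (numer (to_ac xK)) z / (27 * z ^ 2)" for z
  have nz: "z \<noteq> 0" and rel: "9 * to_ac hK * z ^ 3 = - ((1 - z) ^ 3 * (z ^ 3 + to_ac xK ^ 3))"
    if z: "z \<in> ?Z" for z
  proof -
    have "poly (sextic (to_ac xK) (to_ac hK)) z = 0"
      using z by (simp add: rhom.map_poly_sextic[OF rhom_to_ac])
    hence 0: "(1 - z) ^ 3 * (z ^ 3 + to_ac xK ^ 3) + 9 * to_ac hK * z ^ 3 = 0" by (simp only: poly_sextic)
    thus "9 * to_ac hK * z ^ 3 = - ((1 - z) ^ 3 * (z ^ 3 + to_ac xK ^ 3))"
      by (simp only: eq_neg_iff_add_eq_0 add.commute)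
    show "z \<noteq> 0" using 0 by auto
  qed
  have h: "rhom (\<lambda>a. to_ac (to_fract a) :: rat poly poly fract alg_closure)"
    using rhom_comp[OF rhom_to_fract rhom_to_ac] .
  have mP: "map_poly to_ac PK = map_poly (\<lambda>a. to_ac (to_fract a)) P4"
    by (intro poly_eqI) (simp add: coeff_map_poly)
  have \<Phi>Y: "\<Phi> z \<in> ?Y" if z: "z \<in> ?Z" for z
  proof -
    have "27 * \<Phi> z * z ^ 2 = poly (numer (to_ac xK)) z" using nz[OF z] by (simp add: \<Phi>_def)
    from P4_root[OF h refl refl rel[OF z] nz[OF z] this] show ?thesis by (simp add: mP)
  qed
  have inj: "inj_on \<Phi> ?Z"
  proof (rule inj_onI)
    fix u v assume uv: "u \<in> ?Z" "v \<in> ?Z" "\<Phi> u = \<Phi> v"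
    have "v ^ 2 * poly (numer (to_ac xK)) u = u ^ 2 * poly (numer (to_ac xK)) v"
      using uv(3) nz[OF uv(1)] nz[OF uv(2)] unfolding \<Phi>_def by (simp add: frac_eq_eq mult.commute)
    thus "u = v" by (rule numer_separates_roots[OF uv(1,2)])
  qed
  have finY: "finite ?Y" using finite_rts[OF PK_nonzero partial_hom_to_ac] .
  have "card ?Y \<le> 6"
    using card_poly_roots_bound[of "map_poly to_ac PK"] PK_nonzero degree_PK
    by (simp add: partial_hom.map_poly_eq_0_iff[OF partial_hom_to_ac] partial_hom.degree_map_poly[OF partial_hom_to_ac])
  moreover have "card (\<Phi> ` ?Z) = 6" using sextic_transposition inj by (simp add: card_image)
  moreover have "\<Phi> ` ?Z \<subseteq> ?Y" using \<Phi>Y by blast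
  ultimately have im: "\<Phi> ` ?Z = ?Y" using finY by (metis card_seteq)
  thus "card ?Y = 6" using \<open>card (\<Phi> ` ?Z) = 6\<close> by simp
  have bij: "bij_betw \<Phi> ?Z ?Y" using inj im by (simp add: bij_betw_def)
  interpret L: subfld "splitting_field gK" by (rule subfld_splitting_field)
  have ZL: "z \<in> splitting_field gK" if "z \<in> ?Z" for z using that roots_in_splitting_field by blast
  have nL: "L.pol (numer (to_ac xK))"
    unfolding rhom.map_poly_numer[OF rhom_to_ac, symmetric]
    by (simp add: L.pol_def coeff_map_poly splitting_field_to_ac)
  have 27: "27 \<in> splitting_field gK" using splitting_field_to_ac[of 27 gK] by simp
  have \<Phi>L: "\<Phi> z \<in> splitting_field gK" if "z \<in> ?Z" for z
    unfolding \<Phi>_def divide_inverse power2_eq_square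
    using ZL[OF that] 27 L.poly_in[OF nL ZL[OF that]] by (intro L.mult_in L.inverse_in)
  fix \<pi> assume \<pi>: "\<pi> permutes ?Y"
  define \<rho> where "\<rho> z = (if z \<in> ?Z then inv_into ?Z \<Phi> (\<pi> (\<Phi> z)) else z)" for z
  have "bij_betw (\<lambda>z. inv_into ?Z \<Phi> (\<pi> (\<Phi> z))) ?Z ?Z"
    using bij_betw_trans[OF bij_betw_trans[OF bij permutes_imp_bij[OF \<pi>]] bij_betw_inv_into[OF bij]]
    by (simp add: o_def)
  hence "bij_betw \<rho> ?Z ?Z" by (subst bij_betw_cong) (auto simp: \<rho>_def)
  hence "\<rho> permutes ?Z" by (rule bij_imp_permutes) (auto simp: \<rho>_def)
  from sextic_all_permutations[OF this] obtain \<sigma> where \<sigma>: "aut gK \<sigma>" "\<forall>z\<in>?Z. \<sigma> z = \<rho> z" by blast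
  interpret \<sigma>: partial_hom "splitting_field gK" \<sigma> using \<sigma>(1) by (simp add: aut_def)
  have \<sigma>c: "\<sigma> (to_ac c) = to_ac c" for c using \<sigma>(1) by (simp add: aut_def)
  have YL: "?Y \<subseteq> splitting_field gK" unfolding im[symmetric] by (rule image_subsetI) (rule \<Phi>L)
  \<comment> \<open>The realising automorphism is found on the larger field; it restricts to the
    splitting field of \<open>P4\<close> because it permutes the roots of \<open>P4\<close>.\<close>
  have sub: "splitting_field PK \<subseteq> splitting_field gK"
    using YL by (intro splitting_field_subset) (auto simp: splitting_field_to_ac L.subfld_axioms)
  have hP: "partial_hom (splitting_field PK) \<sigma>"
    by (rule \<sigma>.partial_hom_subset[OF subfld_splitting_field sub])
  have b: "\<sigma> ` ?Y = ?Y"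
    using partial_hom_roots[OF \<sigma>.partial_hom_axioms _ \<sigma>c YL PK_nonzero]
    by (auto simp: bij_betw_def splitting_field_to_ac)
  have "\<sigma> ` splitting_field PK \<subseteq> splitting_field PK"
    using hP subfld_splitting_field
    by (rule splitting_field_image_subset) (use b roots_in_splitting_field[of PK] in \<open>auto simp: \<sigma>c splitting_field_to_ac\<close>)
  moreover have "splitting_field PK \<subseteq> \<sigma> ` splitting_field PK"
  proof (rule splitting_field_subset)
    show "subfld (\<sigma> ` splitting_field PK)" using partial_hom.subfld_image[OF hP] .
    show "range to_ac \<subseteq> \<sigma> ` splitting_field PK"
      using \<sigma>c splitting_field_to_ac by (metis image_eqI image_subsetI)
    show "?Y \<subseteq> \<sigma> ` splitting_field PK"
      using b roots_in_splitting_field[of PK] by blast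
  qed
  ultimately have "aut PK \<sigma>" using hP \<sigma>c by (auto simp: aut_def)
  moreover have "\<sigma> y = \<pi> y" if y: "y \<in> ?Y" for y
  proof -
    obtain z where z: "z \<in> ?Z" "y = \<Phi> z" using im y by blast
    have "map_poly \<sigma> (numer (to_ac xK)) = numer (to_ac xK)"
      unfolding rhom.map_poly_numer[OF rhom_to_ac, symmetric]
      by (intro poly_eqI) (simp add: coeff_map_poly \<sigma>c)
    hence "\<sigma> (poly (numer (to_ac xK)) z) = poly (numer (to_ac xK)) (\<sigma> z)"
      using \<sigma>.f_poly[OF nL ZL[OF z(1)]] by simp
    moreover define k :: "rat poly poly fract alg_closure" where "k = 27"
    have "\<sigma> k = k" "k \<in> splitting_field gK" using \<sigma>c[of 27] 27 by (simp_all add: k_def)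
    ultimately have "\<sigma> (\<Phi> z) = \<Phi> (\<sigma> z)"
      unfolding \<Phi>_def divide_inverse power2_eq_square k_def[symmetric]
      using ZL[OF z(1)] L.poly_in[OF nL ZL[OF z(1)]]
      by (simp add: \<sigma>.f_mult \<sigma>.f_inverse L.mult_in L.inverse_in)
    also have "\<sigma> z = inv_into ?Z \<Phi> (\<pi> (\<Phi> z))" using \<sigma>(2) z(1) by (simp add: \<rho>_def)
    also have "\<Phi> (inv_into ?Z \<Phi> (\<pi> (\<Phi> z))) = \<pi> (\<Phi> z)"
    proof (rule f_inv_into_f)
      show "\<pi> (\<Phi> z) \<in> \<Phi> ` ?Z" unfolding im permutes_in_image[OF \<pi>] by (rule \<Phi>Y[OF z(1)])
    qed
    finally show ?thesis by (simp only: z(2))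
  qed
  ultimately show "\<exists>\<sigma>. aut PK \<sigma> \<and> (\<forall>z\<in>?Y. \<sigma> z = \<pi> z)" by blast
qed

subsection \<open>Derivations\<close>

locale derivation =
  fixes d :: "'a :: idom \<Rightarrow> 'a"
  assumes d_add: "d (a + b) = d a + d b"
    and d_mult: "d (a * b) = d a * b + a * d b"
begin

lemma d_0 [simp]: "d 0 = 0"
  using d_add[of 0 0] by (metis add_0 add_cancel_right_right)

lemma d_1 [simp]: "d 1 = 0"
  using d_mult[of 1 1] by (metis add_cancel_right_right mult_1 mult_1_right)

lemma d_minus: "d (- a) = - d a"
  using d_add[of a "- a"] by (simp add: eq_neg_iff_add_eq_0 add.commute)

lemma d_diff: "d (a - b) = d a - d b"
  using d_add[of a "- b"] by (simp add: d_minus)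

lemma d_of_nat [simp]: "d (of_nat n) = 0"
  by (induction n) (auto simp: d_add)

lemma d_numeral [simp]: "d (numeral n) = 0"
  using d_of_nat[of "numeral n"] by (simp del: d_of_nat)

lemma d_double: "d (2 * a) = 2 * d a"
  by (simp add: d_mult)

lemma d_power: "d (a ^ n) = of_nat n * a ^ (n - 1) * d a"
proof (induction n)
  case (Suc n)
  thus ?case by (cases n) (auto simp: d_mult algebra_simps)
qed simp

lemmas d_simps = d_add d_diff d_minus d_mult d_power

end

instance fps :: (ring_char_0) ring_char_0 ..

text \<open>In the coordinates \<open>p = z - 1\<close>, \<open>Y = (z - 1) / z\<close> the parametrisation reads
  \<open>9H = p\<^sup>3 + x\<^sup>3 Y\<^sup>3\<close>, \<open>p - Y = p Y\<close>; the only denominator in the derivatives is \<open>D = p\<^sup>4 + x\<^sup>3 Y\<^sup>4\<close>.\<close>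

locale branch =
  fixes x H p Y u y z v :: "'a :: {idom, ring_char_0}"
  assumes zv: "z * v = 1" and p: "p = z - 1" and Y: "Y = 1 - v"
    and E: "9 * H = p ^ 3 + x ^ 3 * Y ^ 3"
    and uD: "u * (p ^ 4 + x ^ 3 * Y ^ 4) = 1"
    and yY: "y * Y = 1"
begin

lemma pY: "p - Y = p * Y" "p * v = Y" "(1 - Y) * z = 1" "Y = p * (1 - Y)"
  using zv by (simp_all add: p Y algebra_simps)

lemma nonzero: "p \<noteq> 0" "Y \<noteq> 0"
  using yY pY by auto

text \<open>Power sums \<open>p^k + x^3 Y^k\<close> for \<open>k\<close> = 5, 6 and 3; the
  denominator \<open>D\<close> is the one for \<open>k\<close> = 4. The derivation \<open>dh\<close>
  below multiplies the \<open>k\<close>-th sum by \<open>k u EE\<close> and raises its index by one,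
  so repeated differentiation stays within this family.\<close>

definition "SS = p ^ 5 + x ^ 3 * Y ^ 5"
definition "TT = p ^ 6 + x ^ 3 * Y ^ 6"
definition "EE = p ^ 3 + x ^ 3 * Y ^ 3"

lemma differential_equation_core:
  "- 8 * EE * u + 36 * EE^2 * u^3 * SS - 48 * EE^3 * u^5 * SS^2 + 20 * EE^3 * u^4 * TT
   = x^3 * Y^3 * u * (Y^2 * p^4 * u) * (4 * (4 * u * SS - 5 * Y - 4 * p)
      + x^3 * Y^3 * u * ((4 * u * SS - 5 * Y - 4 * p)^2 + (4 * u * SS - 6 * Y) * (4 * u * SS - 5 * Y - 4 * p)
        + 16 * u^2 * SS^2 - 12 * u * Y * SS - 20 * u * TT + 17 * Y^2 + 4 * p^2))"
proof -
  define D where "D = p ^ 4 + x ^ 3 * Y ^ 4"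
  have uD': "u * D = 1" using uD by (simp add: D_def)
  define L where "L = - 8 * EE * D^4 + 36 * EE^2 * D^2 * SS - 48 * EE^3 * SS^2 + 20 * EE^3 * D * TT"
  define K where "K = 4 * SS - (5 * Y + 4 * p) * D"
  define R where "R = x^3 * Y^5 * p^4 * (4 * K * D^2 + x^3 * Y^3 * (K^2 + (4 * SS - 6 * Y * D) * K
      + 16 * SS^2 - 12 * Y * SS * D - 20 * TT * D + (17 * Y^2 + 4 * p^2) * D^2))"
  \<comment> \<open>\<open>R = L\<close> fails for independent variables and depends on
    \<open>p - Y = p Y\<close>. With these cubes as factors both sides become homogeneous of the
    same degree in \<open>p\<close> and \<open>Y\<close>, and the identity holds for free
    \<open>x\<close>, \<open>p\<close>, \<open>Y\<close>.\<close>
  have "(p - Y)^3 * R = (p * Y)^3 * L"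
    unfolding L_def R_def K_def D_def SS_def TT_def EE_def by Groebner_Basis.algebra
  hence "R = L" using nonzero by (simp add: pY(1))
  moreover have "- 8 * EE * u + 36 * EE^2 * u^3 * SS - 48 * EE^3 * u^5 * SS^2 + 20 * EE^3 * u^4 * TT = u^5 * L"
  proof -
    have "u^5 * L = - 8 * EE * u * (u * D)^4 + 36 * EE^2 * u^3 * SS * (u * D)^2
        - 48 * EE^3 * u^5 * SS^2 + 20 * EE^3 * u^4 * TT * (u * D)"
      unfolding L_def by Groebner_Basis.algebra
    thus ?thesis by (simp add: uD')
  qed
  moreover have "x^3 * Y^3 * u * (Y^2 * p^4 * u) * (4 * (4 * u * SS - 5 * Y - 4 * p)
      + x^3 * Y^3 * u * ((4 * u * SS - 5 * Y - 4 * p)^2 + (4 * u * SS - 6 * Y) * (4 * u * SS - 5 * Y - 4 * p)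
        + 16 * u^2 * SS^2 - 12 * u * Y * SS - 20 * u * TT + 17 * Y^2 + 4 * p^2)) = u^5 * R"
  proof -
    have k: "4 * u * SS - 5 * Y - 4 * p = u * K + (1 - u * D) * (- 5 * Y - 4 * p)"
      unfolding K_def by Groebner_Basis.algebra
    hence k: "4 * u * SS - 5 * Y - 4 * p = u * K" by (simp add: uD')
    have "u^5 * R = x^3 * Y^3 * u * (Y^2 * p^4 * u) * (4 * (u * K) * (u * D)^2
      + x^3 * Y^3 * u * ((u * K)^2 + (4 * u * SS - 6 * Y * (u * D)) * (u * K)
        + 16 * u^2 * SS^2 - 12 * u * Y * SS * (u * D) - 20 * u * TT * (u * D) + (17 * Y^2 + 4 * p^2) * (u * D)^2))"
      unfolding R_def by Groebner_Basis.algebra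
    thus ?thesis unfolding k uD' by (simp add: algebra_simps)
  qed
  ultimately show ?thesis by simp
qed

text \<open>Implicit differentiation of \<open>9 H = p^3 + x^3 Y^3\<close>, with
  \<open>d Y = v^2 d p\<close>, makes \<open>D\<close> the coefficient of \<open>d p\<close>. A
  general derivation \<open>d\<close> covers the derivatives in \<open>x\<close> and in
  \<open>H\<close> at once.\<close>

lemma derivatives:
  assumes "derivation d"
  shows "d p = u * p^2 * (3 * d H - x^2 * Y^3 * d x)" "d Y = u * Y^2 * (3 * d H - x^2 * Y^3 * d x)"
    "d y = - u * (3 * d H - x^2 * Y^3 * d x)"
    "d u = - (u^2) * (4 * p^3 * d p + 3 * x^2 * Y^4 * d x + 4 * x^3 * Y^3 * d Y)"
proof -
  interpret derivation d by fact
  define D where "D = p ^ 4 + x ^ 3 * Y ^ 4"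
  have uD': "u * D = 1" using uD by (simp add: D_def)
  have "d (z * v) = 0" using zv by simp
  hence "d z * v + z * d v = 0" by (simp add: d_mult)
  hence "v * (d z * v) + (z * v) * d v = 0" by (metis distrib_left mult.assoc mult.left_commute mult_zero_right)
  hence "d v = - (v^2 * d z)" using zv by (simp add: power2_eq_square algebra_simps add_eq_0_iff2)
  hence dY: "d Y = v^2 * d p" by (simp add: Y p d_diff)
  have "d (9 * H) = d (p ^ 3 + x ^ 3 * Y ^ 3)" using E by simp
  hence "3 * (3 * d H) = 3 * (p^2 * d p + x^2 * Y^3 * d x + x^3 * Y^2 * d Y)"
    by (simp add: d_simps algebra_simps)
  hence e: "3 * d H = p^2 * d p + x^2 * Y^3 * d x + x^3 * Y^2 * d Y" by (simp only: mult_cancel_left) simp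
  have "p^2 * (3 * d H - x^2 * Y^3 * d x) = p^4 * d p + x^3 * Y^2 * (p * v)^2 * d p"
    unfolding e dY by Groebner_Basis.algebra
  also have "\<dots> = D * d p" unfolding pY(2) D_def by Groebner_Basis.algebra
  finally have "u * p^2 * (3 * d H - x^2 * Y^3 * d x) = (u * D) * d p" by (simp only: mult.assoc)
  thus dp: "d p = u * p^2 * (3 * d H - x^2 * Y^3 * d x)" using uD' by simp
  have "d Y = u * (p * v)^2 * (3 * d H - x^2 * Y^3 * d x)"
    unfolding dY dp by (simp add: power_mult_distrib algebra_simps)
  thus dY': "d Y = u * Y^2 * (3 * d H - x^2 * Y^3 * d x)" unfolding pY(2) .
  have "d (y * Y) = 0" using yY by simp
  hence "d y * Y = - (y * d Y)" by (simp add: d_mult add_eq_0_iff2)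
  have "d y = (d y * Y) * y" using yY by (simp add: mult.assoc mult.commute[of Y])
  also have "\<dots> = - ((y * Y) * (y * Y) * (u * (3 * d H - x^2 * Y^3 * d x)))"
    unfolding \<open>d y * Y = _\<close> dY' by Groebner_Basis.algebra
  finally show "d y = - u * (3 * d H - x^2 * Y^3 * d x)" unfolding yY by simp
  have "d (u * D) = 0" using uD' by simp
  hence "d u * D = - (u * d D)" by (simp add: d_mult add_eq_0_iff2)
  hence "u * (d u * D) = u * (- (u * d D))" by (simp only:)
  hence "d u * (u * D) = - (u^2) * d D" by (simp add: power2_eq_square mult_ac)
  thus "d u = - (u^2) * (4 * p^3 * d p + 3 * x^2 * Y^4 * d x + 4 * x^3 * Y^3 * d Y)"
    unfolding uD' by (simp add: D_def d_simps algebra_simps)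
qed

text \<open>This is the recurrence in closed form: \<open>dh\<close> multiplies the coefficient of
  \<open>H^k\<close> by \<open>3k\<close>, so \<open>dh^3 - dh\<close> produces the factors
  \<open>(3k+1)(3k)(3k-1)\<close>. The factor \<open>3k+3\<close> and one derivative in
  \<open>x\<close> are absorbed in passing from \<open>F\<close> to \<open>y\<close> and
  \<open>(x Y)^2\<close>.\<close>

lemma differential_equation:
  assumes dx: "derivation dx" "dx x = 1" "dx H = 0"
    and dh: "derivation dh" "dh x = 0" "dh H = 3 * H"
  shows "2 * (dh (dh (dh y)) - dh y) = x * dx (dx (dx ((x * Y) ^ 2)))"
proof -
  interpret X: derivation dx by fact
  interpret H: derivation dh by fact
  note X = derivatives[OF dx(1), unfolded dx(2,3)] and H = derivatives[OF dh(1), unfolded dh(2,3)]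
  have EE: "9 * H = EE" using E by (simp add: EE_def)
  have Hp: "dh p = u * p^2 * EE" and HY: "dh Y = u * Y^2 * EE" and Hy: "dh y = - u * EE"
    using H(1-3) EE by simp_all
  have HE: "dh EE = 3 * EE" using arg_cong[OF EE, of dh] by (simp add: H.d_simps dh flip: EE)
  have Hu: "dh u = - 4 * u^3 * EE * SS"
  proof -
    have "dh u = - (u^2) * (4 * p^3 * (u * p^2 * EE) + 4 * x^3 * Y^3 * (u * Y^2 * EE))"
      using H(4) by (simp add: Hp HY)
    thus ?thesis unfolding SS_def by Groebner_Basis.algebra
  qed
  have HS: "dh SS = 5 * u * EE * TT"
    unfolding SS_def TT_def by (simp add: H.d_simps dh Hp HY) Groebner_Basis.algebra
  have H2: "dh (dh y) = - 3 * EE * u + 4 * EE^2 * u^3 * SS"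
    unfolding Hy by (simp add: H.d_simps HE Hu) Groebner_Basis.algebra
  have H3: "dh (dh (dh y)) = - 9 * EE * u + 36 * EE^2 * u^3 * SS - 48 * EE^3 * u^5 * SS^2 + 20 * EE^3 * u^4 * TT"
    unfolding H2 by (simp add: H.d_simps HE Hu HS) Groebner_Basis.algebra
  define q K where "q = x^2 * Y^3 * u" and "K = 4 * u * SS - 5 * Y - 4 * p"
  have Xp: "dx p = - (p^2) * q" and XY: "dx Y = - (Y^2) * q"
    using X(1,2) by (simp_all add: q_def algebra_simps)
  have Xu: "dx u = u * q * (4 * u * SS - 3 * Y)"
  proof -
    have "dx u = - (u^2) * (4 * p^3 * (- (p^2) * q) + 3 * x^2 * Y^4 + 4 * x^3 * Y^3 * (- (Y^2) * q))"
      using X(4) by (simp add: Xp XY)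
    thus ?thesis unfolding SS_def q_def by Groebner_Basis.algebra
  qed
  have "dx (x * Y) = Y * (1 - u * (x^3 * Y^4))"
    by (simp add: X.d_mult dx XY q_def) Groebner_Basis.algebra
  also have "1 - u * (x^3 * Y^4) = u * p^4" using uD by (simp add: algebra_simps)
  finally have w: "dx (x * Y) = Y * (u * p^4)" .
  have "dx ((x * Y)^2) = 2 * (x * (Y^2 * p^4 * u))"
    unfolding power2_eq_square[of "x * Y"] X.d_mult[of "x * Y"] w by Groebner_Basis.algebra
  hence X1: "dx (dx (dx ((x * Y)^2))) = 2 * dx (dx (x * (Y^2 * p^4 * u)))"
    by (simp only: X.d_double)
  define M where "M = Y^2 * p^4 * u"
  have XM: "dx M = M * q * K"
    unfolding M_def K_def by (simp add: X.d_simps Xp XY Xu) Groebner_Basis.algebra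
  have X2: "dx (x * M) = M * (1 + x * q * K)"
    by (simp add: X.d_mult dx XM algebra_simps)
  have XS: "dx SS = - 5 * q * TT + 3 * x^2 * Y^5"
    unfolding SS_def TT_def by (simp add: X.d_simps dx Xp XY) Groebner_Basis.algebra
  \<comment> \<open>Multiplied by \<open>x\<close>, the derivative of \<open>q\<close> is
    expressible through \<open>q\<close> itself, which avoids dividing by \<open>x\<close>.\<close>
  have Xq: "x * dx q = 2 * q + x * q^2 * (4 * u * SS - 6 * Y)"
  proof -
    have "x * dx q = 2 * q + 3 * x^3 * Y^2 * dx Y * u + x^3 * Y^3 * dx u"
      unfolding q_def by (simp add: X.d_simps dx) Groebner_Basis.algebra
    also have "\<dots> = 2 * q + x * q^2 * (4 * u * SS - 6 * Y)"
      unfolding XY Xu unfolding q_def by Groebner_Basis.algebra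
    finally show ?thesis .
  qed
  have XK: "dx K = q * (16 * u^2 * SS^2 - 12 * u * Y * SS - 20 * u * TT + 17 * Y^2 + 4 * p^2)"
  proof -
    have "dx K = 4 * (u * q * (4 * u * SS - 3 * Y)) * SS + 4 * u * (- 5 * q * TT + 3 * x^2 * Y^5) + 5 * Y^2 * q + 4 * p^2 * q"
      unfolding K_def by (simp add: X.d_simps Xu XS XY Xp)
    also have "4 * u * (- 5 * q * TT + 3 * x^2 * Y^5) = - 20 * u * q * TT + 12 * q * Y^2"
      unfolding q_def by Groebner_Basis.algebra
    finally show ?thesis by Groebner_Basis.algebra
  qed
  have "x * dx (dx (x * M)) = x * (M * q * K) * (1 + x * q * K) + M * (x * q * K + x * (x * dx q) * K + x^2 * q * dx K)"
    unfolding X2 by (simp add: X.d_simps dx XM) Groebner_Basis.algebra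
  also have "\<dots> = x * q * M * (4 * K + x * q * (K^2 + (4 * u * SS - 6 * Y) * K
        + 16 * u^2 * SS^2 - 12 * u * Y * SS - 20 * u * TT + 17 * Y^2 + 4 * p^2))"
    unfolding Xq XK by Groebner_Basis.algebra
  also have "x * q = x^3 * Y^3 * u" unfolding q_def by (simp add: eval_nat_numeral)
  also have "x^3 * Y^3 * u * M * (4 * K + x^3 * Y^3 * u * (K^2 + (4 * u * SS - 6 * Y) * K
        + 16 * u^2 * SS^2 - 12 * u * Y * SS - 20 * u * TT + 17 * Y^2 + 4 * p^2))
      = - 8 * EE * u + 36 * EE^2 * u^3 * SS - 48 * EE^3 * u^5 * SS^2 + 20 * EE^3 * u^4 * TT"
    unfolding K_def M_def by (rule differential_equation_core[symmetric])
  finally have xM: "x * dx (dx (x * M)) = - 8 * EE * u + 36 * EE^2 * u^3 * SS - 48 * EE^3 * u^5 * SS^2 + 20 * EE^3 * u^4 * TT" .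
  have "x * dx (dx (dx ((x * Y)^2))) = 2 * (x * dx (dx (x * M)))"
    unfolding X1 M_def[symmetric] by (rule mult.left_commute)
  also have "\<dots> = 2 * (dh (dh (dh y)) - dh y)"
    unfolding xM H3 unfolding Hy by (simp add: algebra_simps)
  finally show ?thesis by simp
qed

end

subsection \<open>The generating function\<close>

lemma fract_deriv_add:
  fixes a b :: "'a :: field_gcd poly fract"
  shows "fract_deriv (a + b) = fract_deriv a + fract_deriv b"
proof -
  obtain p q where a: "a = Fract p q" "q \<noteq> 0" by (cases a)
  obtain r s where b: "b = Fract r s" "s \<noteq> 0" by (cases b)
  show ?thesis using a b
    by (simp add: fract_deriv_Fract eq_fract pderiv_add pderiv_mult algebra_simps power2_eq_square)
qed

lemma fract_deriv_mult:
  fixes a b :: "'a :: field_gcd poly fract"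
  shows "fract_deriv (a * b) = fract_deriv a * b + a * fract_deriv b"
proof -
  obtain p q where a: "a = Fract p q" "q \<noteq> 0" by (cases a)
  obtain r s where b: "b = Fract r s" "s \<noteq> 0" by (cases b)
  show ?thesis using a b
    by (simp add: fract_deriv_Fract eq_fract pderiv_add pderiv_mult algebra_simps power2_eq_square)
qed

lemma derivation_fract_deriv: "derivation (fract_deriv :: rat poly fract \<Rightarrow> _)"
  by unfold_locales (simp_all add: fract_deriv_add fract_deriv_mult)

abbreviation X0 :: "rat poly fract" where "X0 \<equiv> to_fract [:0, 1:]"

lemma fract_deriv_X0: "fract_deriv X0 = 1"
  by (simp add: to_fract_def fract_deriv_Fract pderiv_pCons One_fract_def flip: one_pCons)

definition series_dx :: "rat poly fract fps \<Rightarrow> rat poly fract fps" where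
  "series_dx f = Abs_fps (\<lambda>n. fract_deriv (f $ n))"

text \<open>This is \<open>h d/dh\<close> for \<open>H = h^3\<close>, hence the factor 3.\<close>

definition series_dh :: "rat poly fract fps \<Rightarrow> rat poly fract fps" where
  "series_dh f = 3 * (fps_X * fps_deriv f)"

lemma derivation_series_dx: "derivation series_dx"
proof
  interpret d: derivation "fract_deriv :: rat poly fract \<Rightarrow> _" by (rule derivation_fract_deriv)
  have sum: "fract_deriv (sum g A) = (\<Sum>i\<in>A. fract_deriv (g i))" for g :: "nat \<Rightarrow> rat poly fract" and A
    by (induction A rule: infinite_finite_induct) (simp_all add: d.d_add)
  fix a b
  show "series_dx (a + b) = series_dx a + series_dx b"
    by (intro fps_ext) (simp add: series_dx_def d.d_add)
  show "series_dx (a * b) = series_dx a * b + a * series_dx b"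
    by (intro fps_ext) (simp add: series_dx_def fps_mult_nth sum d.d_mult sum.distrib)
qed

lemma derivation_series_dh: "derivation series_dh"
  by unfold_locales (simp_all add: series_dh_def algebra_simps)

lemma series_dh_nth: "series_dh f $ n = 3 * of_nat n * f $ n"
  by (cases n) (simp_all add: series_dh_def numeral_fps_const mult.assoc)

text \<open>At \<open>H = 0\<close> the zeros of the sextic in Q(x) are the triple zero 1 and the
  simple zero \<open>-x\<close>; the simple one lifts to a power series in \<open>H\<close>.\<close>

lemma branch_exists:
  "\<exists>z. z $ 0 = - X0 \<and> poly (sextic (fps_const X0) fps_X) z = 0"
proof -
  have X: "X0 \<noteq> 0" "1 + X0 \<noteq> 0"
    by simp (simp only: to_fract_1[symmetric] to_fract_add[symmetric] to_fract_eq_0_iff, simp add: one_pCons)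
  have "(- X0) * poly (pderiv (sextic X0 0)) (- X0) = - 3 * (1 + X0) ^ 2 * X0 ^ 3 * (1 + X0)"
    unfolding pderiv_sextic poly_sextic by (simp add: algebra_simps eval_nat_numeral)
  hence d: "poly (pderiv (sextic X0 0)) (- X0) \<noteq> 0" using X by auto
  have "poly (sextic X0 0) (- X0) = 0" by (simp add: poly_sextic)
  from pencil_root_exists[OF this _ d, of "[:0, 0, 0, 9:]"] X obtain z where
    z: "z $ 0 = - X0" "poly (map_poly fps_const (sextic X0 0)) z + fps_X * poly (map_poly fps_const [:0, 0, 0, 9:]) z = 0"
    by auto
  have "poly (sextic (fps_const X0) fps_X) z = 0"
    using z(2) unfolding rhom.map_poly_sextic[OF rhom_fps_const]
    by (simp add: poly_sextic rhom.map_poly_pCons[OF rhom_fps_const] rhom.h_numeral[OF rhom_fps_const] eval_nat_numeral algebra_simps)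
  thus ?thesis using z(1) by blast
qed

text \<open>The series \<open>F\<close> is built from the branch and identified with
  \<open>F4\<close> by uniqueness: both have constant term 0 and the same coefficient of
  \<open>H\<close>, and the differential equation gives \<open>F\<close> the recurrence that
  determines the rest.\<close>

lemma F4_parametrization:
  "\<exists>z. z \<noteq> 0 \<and> 9 * fps_X * z ^ 3 = - ((1 - z) ^ 3 * (z ^ 3 + fps_const X0 ^ 3)) \<and>
     27 * F4 * z ^ 2 = poly (numer (fps_const X0)) z"
proof -
  obtain z where z: "z $ 0 = - X0" "poly (sextic (fps_const X0) fps_X) z = 0"
    using branch_exists by blast
  have X: "X0 \<noteq> 0" "1 + X0 \<noteq> 0" "X0 + 1 \<noteq> 0"
    by simp (simp_all only: to_fract_1[symmetric] to_fract_add[symmetric] to_fract_eq_0_iff, simp_all add: one_pCons)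
  define x where "x = fps_const X0"
  define H :: "rat poly fract fps" where "H = fps_X"
  define v p Y where "v = inverse z" and "p = z - 1" and "Y = 1 - v"
  have zv: "z * v = 1" using z(1) X unfolding v_def by (simp add: inverse_mult_eq_1')
  define D where "D = p ^ 4 + x ^ 3 * Y ^ 4"
  define u y where "u = inverse D" and "y = inverse Y"
  have v0: "v $ 0 = - (1 / X0)" using z(1) by (simp add: v_def divide_inverse)
  have p0: "p $ 0 = - (X0 + 1)" using z(1) by (simp add: p_def)
  have Y0: "Y $ 0 = (X0 + 1) / X0" using v0 X by (simp add: Y_def field_simps)
  have "D $ 0 = (X0 + 1) ^ 5 / X0"
    using X by (simp add: D_def p0 Y0 x_def fps_power_zeroth field_simps eval_nat_numeral)
  hence D0: "D $ 0 \<noteq> 0" using X by simp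
  have uD: "u * D = 1" using D0 by (simp add: u_def inverse_mult_eq_1)
  have yY: "y * Y = 1" using Y0 X by (simp add: y_def inverse_mult_eq_1)
  have s: "(1 - z) ^ 3 * (z ^ 3 + x ^ 3) + 9 * H * z ^ 3 = 0"
    using z(2) by (simp only: poly_sextic x_def H_def)
  have "9 * H * (z * v) ^ 3 = p ^ 3 * ((z * v) ^ 3 + (x * v) ^ 3)"
  proof -
    have "9 * H * (z * v) ^ 3 - p ^ 3 * ((z * v) ^ 3 + (x * v) ^ 3)
        = v ^ 3 * ((1 - z) ^ 3 * (z ^ 3 + x ^ 3) + 9 * H * z ^ 3)"
      unfolding p_def by Groebner_Basis.algebra
    thus ?thesis by (simp add: s)
  qed
  hence "9 * H = p ^ 3 + x ^ 3 * (p * v) ^ 3" unfolding zv by (simp add: algebra_simps power_mult_distrib)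
  moreover have "p * v = Y" using zv by (simp add: p_def Y_def algebra_simps)
  ultimately have E: "9 * H = p ^ 3 + x ^ 3 * Y ^ 3" by simp
  interpret branch x H p Y u y z v
    by unfold_locales (use zv E uD yY in \<open>simp_all add: p_def Y_def D_def\<close>)
  have dxx: "series_dx x = 1" "series_dx H = 0" and dhx: "series_dh x = 0" "series_dh H = 3 * H"
  proof -
    interpret d: derivation "fract_deriv :: rat poly fract \<Rightarrow> _" by (rule derivation_fract_deriv)
    show "series_dx x = 1" "series_dx H = 0"
      by (auto intro!: fps_ext simp: series_dx_def x_def H_def fract_deriv_X0 fps_X_def)
    show "series_dh x = 0" "series_dh H = 3 * H" by (simp_all add: series_dh_def x_def H_def)
  qed
  define F where "F = fps_const (1 / 27) * (3 * x^3 * v^2 - 6 * x^3 * v + (2 * x^3 - 3 * x^2 - 3 * x) - 3 * z^2 + 2 * z^3)"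
  have F27: "27 * F = 3 * x^3 * v^2 - 6 * x^3 * v + (2 * x^3 - 3 * x^2 - 3 * x) - 3 * z^2 + 2 * z^3"
    by (simp add: F_def numeral_fps_const flip: mult.assoc)
  have yp: "y * p = z"
  proof -
    have "y * p = (y * (p * v)) * z" using zv by (simp add: mult_ac)
    thus ?thesis using pY(2) yY by simp
  qed
  \<comment> \<open>Both first derivatives of \<open>F\<close> contain the factor
    \<open>z + x^3 v^3\<close>. The remaining powers of \<open>p\<close> turn it into
    \<open>y\<close> times the denominator \<open>D\<close>, which cancels \<open>u\<close>.\<close>
  have pz: "p^3 * (z + x^3 * v^3) = y * (p^4 + x^3 * (p * v)^4)"
  proof -
    have "y * (p^4 + x^3 * (p * v)^4) = (y * p) * p^3 + x^3 * v^3 * (y * p) * p^3 * v" by Groebner_Basis.algebra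
    also have "\<dots> = p^3 * (z + x^3 * v^3 * (z * v))" unfolding yp by Groebner_Basis.algebra
    finally show ?thesis unfolding zv by simp
  qed
  have dF: "27 * d F = 6 * p * d p * (z + x^3 * v^3) + (9 * x^2 * v^2 - 18 * x^2 * v + 6 * x^2 - 6 * x - 3) * d x"
    if "derivation d" for d
  proof -
    interpret derivation d by fact
    have dz: "d z = d p" by (simp add: p d_diff)
    have "d (z * v) = 0" using zv by simp
    hence "d z * v + z * d v = 0" by (simp add: d_mult)
    hence "v * (d z * v + z * d v) = 0" by simp
    hence "d v * (z * v) = - (v^2 * d z)" by (simp add: power2_eq_square algebra_simps add_eq_0_iff2)
    hence dv: "d v = - (v^2 * d p)" using zv dz by simp
    have "27 * d F = d (27 * F)" by (simp add: d_mult)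
    also have "\<dots> = 6 * d p * (z * (z - 1) + x^3 * v^2 * (1 - v)) + (9 * x^2 * v^2 - 18 * x^2 * v + 6 * x^2 - 6 * x - 3) * d x"
      unfolding F27 by (simp add: d_simps dv dz) Groebner_Basis.algebra
    also have "z * (z - 1) + x^3 * v^2 * (1 - v) = z * p + x^3 * v^2 * (p * v)"
      unfolding pY(2) by (simp add: p Y)
    also have "\<dots> = p * (z + x^3 * v^3)" by Groebner_Basis.algebra
    finally show ?thesis by (simp add: mult_ac)
  qed
  note dp = derivatives(1)
  have Fh: "series_dh F = 2 * H * y"
  proof -
    have "27 * series_dh F = 54 * H * u * (p^3 * (z + x^3 * v^3))"
      unfolding dF[OF derivation_series_dh] dp[OF derivation_series_dh] dhx by Groebner_Basis.algebra
    also have "\<dots> = 54 * H * y * (u * (p^4 + x^3 * Y^4))"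
      unfolding pz pY(2) by Groebner_Basis.algebra
    also have "\<dots> = 27 * (2 * H * y)" unfolding uD[unfolded D_def] by simp
    finally show ?thesis by (simp only: mult_cancel_left) simp
  qed
  have Fx: "9 * series_dx F = (x * Y)^2 - (1 + x)^2"
  proof -
    have "27 * series_dx F = - 6 * x^2 * Y^3 * u * (p^3 * (z + x^3 * v^3)) + (9 * x^2 * v^2 - 18 * x^2 * v + 6 * x^2 - 6 * x - 3)"
      unfolding dF[OF derivation_series_dx] dp[OF derivation_series_dx] dxx by Groebner_Basis.algebra
    also have "- 6 * x^2 * Y^3 * u * (p^3 * (z + x^3 * v^3)) = - 6 * x^2 * Y^2 * (y * Y) * (u * (p^4 + x^3 * Y^4))"
      unfolding pz pY(2) by Groebner_Basis.algebra
    also have "\<dots> = - 6 * x^2 * Y^2" unfolding uD[unfolded D_def] yY by simp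
    also have "- 6 * x^2 * Y^2 + (9 * x^2 * v^2 - 18 * x^2 * v + 6 * x^2 - 6 * x - 3) = 3 * ((x * Y)^2 - (1 + x)^2)"
      unfolding Y by Groebner_Basis.algebra
    finally have "3 * (9 * series_dx F) = 3 * ((x * Y)^2 - (1 + x)^2)" by simp
    thus ?thesis by (simp only: mult_cancel_left) simp
  qed
  note pde = differential_equation[OF derivation_series_dx dxx derivation_series_dh dhx]
  \<comment> \<open>Multiplication by \<open>H\<close> shifts the index: coefficient
    \<open>Suc n\<close> of \<open>F\<close> belongs to coefficient \<open>n\<close> of
    \<open>y\<close>.\<close>
  have F1: "3 * of_nat (Suc n) * F $ Suc n = 2 * y $ n" for n
    using arg_cong[OF Fh, of "\<lambda>f. f $ Suc n"]
    by (simp add: series_dh_nth H_def mult.assoc numeral_fps_const del: of_nat_Suc)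
  \<comment> \<open>The term \<open>(1 + x)^2\<close> is constant in \<open>H\<close> and affects
    only coefficient 0.\<close>
  have W: "((x * Y)^2) $ n = 9 * fract_deriv (F $ n)" if "n > 0" for n
  proof -
    have "(1 + x)^2 = fps_const ((1 + X0)^2)" by (simp add: x_def power2_eq_square flip: fps_const_1_eq_1)
    hence "((x * Y)^2 - (1 + x)^2) $ n = ((x * Y)^2) $ n" using that by simp
    thus ?thesis using arg_cong[OF Fx, of "\<lambda>f. f $ n"] by (simp add: series_dx_def numeral_fps_const)
  qed
  \<comment> \<open>Compare coefficients of \<open>H^n\<close> with \<open>n = k + 1\<close>: the
    factors \<open>3n\<close>, \<open>3n-1\<close>, \<open>3n+1\<close> come from
    \<open>dh^3 - dh\<close>, and \<open>3(n+1)\<close> from \<open>F1\<close>.\<close>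
  have rec: "of_nat ((3 * k + 6) * (3 * k + 4) * (3 * k + 3) * (3 * k + 2)) * F $ Suc (Suc k)
      = 9 * (X0 * (fract_deriv ^^ 4) (F $ Suc k))" for k
  proof -
    interpret d: derivation "fract_deriv :: rat poly fract \<Rightarrow> _" by (rule derivation_fract_deriv)
    define n :: "rat poly fract" where "n = of_nat (Suc k)"
    have d9: "fract_deriv (9 * a) = 9 * fract_deriv a" for a :: "rat poly fract" by (simp add: d.d_mult)
    have "2 * (3 * n * (3 * n * (3 * n * y $ Suc k)) - 3 * n * y $ Suc k)
        = X0 * fract_deriv (fract_deriv (fract_deriv (((x * Y)^2) $ Suc k)))"
      using arg_cong[OF pde, of "\<lambda>f. f $ Suc k"]
      by (simp add: series_dh_nth series_dx_def x_def n_def numeral_fps_const del: of_nat_Suc)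
    also have "\<dots> = 9 * (X0 * (fract_deriv ^^ 4) (F $ Suc k))"
      unfolding W[OF zero_less_Suc] d9 by (simp add: eval_nat_numeral mult.left_commute)
    finally have e: "2 * (3 * n * (3 * n * (3 * n * y $ Suc k)) - 3 * n * y $ Suc k)
        = 9 * (X0 * (fract_deriv ^^ 4) (F $ Suc k))" .
    have F1': "2 * y $ Suc k = 3 * (n + 1) * F $ Suc (Suc k)"
      using F1[of "Suc k"] by (simp add: n_def algebra_simps)
    have "2 * (3 * n * (3 * n * (3 * n * y $ Suc k)) - 3 * n * y $ Suc k)
        = 3 * n * (3 * n - 1) * (3 * n + 1) * (2 * y $ Suc k)" by Groebner_Basis.algebra
    also have "\<dots> = 3 * n * (3 * n - 1) * (3 * n + 1) * (3 * (n + 1)) * F $ Suc (Suc k)"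
      unfolding F1' by (simp add: mult.assoc)
    also have "3 * n * (3 * n - 1) * (3 * n + 1) * (3 * (n + 1)) = of_nat ((3 * k + 6) * (3 * k + 4) * (3 * k + 3) * (3 * k + 2))"
      by (simp add: n_def algebra_simps)
    finally show ?thesis using e by simp
  qed
  have R: "F $ Suc k = R4 k" for k
  proof (induction k)
    case 0
    have "y $ 0 = X0 / (1 + X0)" using Y0 by (simp add: y_def add.commute)
    hence "3 * F $ Suc 0 = 2 * (X0 / (1 + X0))" using F1[of 0] by simp
    also have "2 * t = 3 * (2 / 3 * t)" for t :: "rat poly fract" by simp
    finally have "3 * F $ Suc 0 = 3 * R4 0" unfolding R4.simps(1) .
    thus ?case by (simp only: mult_cancel_left) simp
  next
    case (Suc k)
    have "of_nat ((3 * k + 6) * (3 * k + 4) * (3 * k + 3) * (3 * k + 2)) \<noteq> (0 :: rat poly fract)"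
      by (simp only: of_nat_eq_0_iff) simp
    thus ?case using rec[of k] unfolding Suc R4.simps(2) by (metis nonzero_mult_div_cancel_left)
  qed
  have "27 * F $ 0 = (27 * F) $ 0" by (simp add: numeral_fps_const)
  also have "\<dots> = 0"
    unfolding F27 using X by (simp add: x_def z(1) v0 fps_power_zeroth numeral_fps_const field_simps eval_nat_numeral)
  finally have "F $ 0 = 0" by simp
  hence "F = F4" unfolding F4_def using R by (intro fps_ext) (simp split: nat.split)
  moreover have "27 * F * z^2 = poly (numer x) z"
  proof -
    have "27 * F * z^2 = 3 * x^3 * (z * v)^2 - 6 * x^3 * (z * v) * z + (2 * x^3 - 3 * x^2 - 3 * x) * z^2 - 3 * z^4 + 2 * z^5"
      unfolding F27 by Groebner_Basis.algebra
    thus ?thesis unfolding zv by (simp add: numer_def algebra_simps eval_nat_numeral)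
  qed
  moreover have "9 * H * z ^ 3 = - ((1 - z) ^ 3 * (z ^ 3 + x ^ 3))"
    using s by (simp only: eq_neg_iff_add_eq_0 add.commute)
  moreover have "z \<noteq> 0" using zv by auto
  ultimately show ?thesis unfolding x_def H_def by blast
qed

theorem mainTheorem8:
  shows "poly (map_poly (\<lambda>a. fps_of_poly (fract_poly a)) P4) F4 = 0
    \<and> galois_group (fract_poly P4 :: rat poly poly fract poly) \<cong> sym_group 6
    \<and> map_poly (\<lambda>a. poly a 0) P4 =
        (let x = [:[:0, 1:]:]; F = [:0, 1:] :: rat poly poly in
          smult [:1 / 3 ^ 12:]
            (F * (27 * F + (1 + x) ^ 3) ^ 3
               * (27 * F ^ 2 + 9 * x * (1 + x) * F + x ^ 2 * (x ^ 2 + x + 1))))"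
proof (intro conjI galois_group_P4)
  show "poly (map_poly (\<lambda>a. fps_of_poly (fract_poly a)) P4) F4 = 0"
  proof -
    obtain z where z: "z \<noteq> 0" "9 * fps_X * z ^ 3 = - ((1 - z) ^ 3 * (z ^ 3 + fps_const X0 ^ 3))"
      "27 * F4 * z ^ 2 = poly (numer (fps_const X0)) z"
      using F4_parametrization by blast
    have \<psi>: "rhom (\<lambda>a :: rat poly poly. fps_of_poly (fract_poly a))"
      by unfold_locales (simp_all add: fps_of_poly_add fps_of_poly_mult)
    \<comment> \<open>\<open>P4_root\<close> needs a field, so the computation takes place in
      Laurent series and is pulled back along the injection of power series.\<close>
    interpret f: rhom "fps_to_fls :: rat poly fract fps \<Rightarrow> _" by (rule rhom_fps_to_fls)
    have h: "fps_to_fls (fps_of_poly (fract_poly [:0, 1:])) = fps_to_fls fps_X"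
      by (simp add: map_poly_pCons fps_of_poly_pCons)
    have x: "fps_to_fls (fps_of_poly (fract_poly [:[:0, 1:]:])) = fps_to_fls (fps_const X0)"
      by (simp add: map_poly_pCons fps_of_poly_const)
    have 1: "9 * fps_to_fls fps_X * fps_to_fls z ^ 3
        = - ((1 - fps_to_fls z) ^ 3 * (fps_to_fls z ^ 3 + fps_to_fls (fps_const X0) ^ 3))"
      using arg_cong[OF z(2), of fps_to_fls] by (simp only: f.h_simps f.h_numeral f.h_1)
    have 2: "27 * fps_to_fls F4 * fps_to_fls z ^ 2 = poly (numer (fps_to_fls (fps_const X0))) (fps_to_fls z)"
      using arg_cong[OF z(3), of fps_to_fls]
      by (simp only: f.h_mult f.h_power f.h_numeral f.h_poly f.map_poly_numer)
    have "poly (map_poly (\<lambda>a. fps_to_fls (fps_of_poly (fract_poly a))) P4) (fps_to_fls F4) = 0"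
      using P4_root[OF rhom_comp[OF \<psi> rhom_fps_to_fls] refl refl, unfolded x h, OF 1 _ 2] z(1) by simp
    also have "map_poly (\<lambda>a. fps_to_fls (fps_of_poly (fract_poly a))) P4 = map_poly fps_to_fls (map_poly (\<lambda>a. fps_of_poly (fract_poly a)) P4)"
      by (intro poly_eqI) (simp add: coeff_map_poly)
    finally have "fps_to_fls (poly (map_poly (\<lambda>a. fps_of_poly (fract_poly a)) P4) F4) = 0"
      by (simp only: f.h_poly)
    thus ?thesis by (rule iffD1[OF fps_to_fls_eq_0_iff])
  qed
next
  show "map_poly (\<lambda>a. poly a 0) P4 =
        (let x = [:[:0, 1:]:]; F = [:0, 1:] :: rat poly poly in
          smult [:1 / 3 ^ 12:]
            (F * (27 * F + (1 + x) ^ 3) ^ 3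
               * (27 * F ^ 2 + 9 * x * (1 + x) * F + x ^ 2 * (x ^ 2 + x + 1))))"
    unfolding P4_def A0_def A1_def A2_def A3_def A4_def A5_def Let_def
    by (simp add: map_poly_pCons eval_nat_numeral numeral_poly algebra_simps one_pCons)
qed

end
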